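(* Let $X=X_1\times X_2\times\cdots\times X_r$ be a product of locally compact Hadamard spaces and let $\Gamma<\mathrm{Is}(X_1)\times\cdots\times\mathrm{Is}(X_r)$ be a group which acts properly discontinuously on $X$ and contains two independent regular axial isometries. Then the set of pairs of fixed points $(\gamma^+,\gamma^-)\in\partial^F X\times\partial^F X$ of regular axial isometries $\gamma\in\Gamma$ is dense in $(F_\Gamma\times F_\Gamma)\setminus\Delta$, where $\Delta=\{(\xi,\eta)\in\partial^F X\times\partial^F X:\ \xi_i=\eta_i\text{ for some }i\in\{1,\ldots,r\}\}$.
   Context: A Hadamard space is a complete CAT(0) metric space. Let $(X_i,d_i)$, $i=1,\ldots,r$, be locally compact Hadamard spaces, and let $X=X_1\times\cdots\times X_r$ carry the product distance $d=\sqrt{d_1^2+\cdots+d_r^2}$. $\partial X_i$ and $\partial X$ denote the geometric boundaries with the cone topology. An isometry $h$ of a Hadamard space $Y$ is axial if there are $l(h)>0$ and a geodesic line $\sigma:\mathbb{R}\to Y$ (an axis) with $h(\sigma(t))=\sigma(t+l(h))$ for all $t$; set $h^+=\sigma(\infty)$ (attractive fixed point), $h^-=\sigma(-\infty)$ (repulsive fixed point). It is rank one if it has an axis which does not bound a flat half-plane (a closed convex subset of $Y$ isometric to $[0,\infty)\times\mathbb{R}$ whose boundary line is the axis). Two rank one isometries $g,h$ are independent if $\{g^+,g^-\}\cap\{h^+,h^-\}=\emptyset$. An element $h=(h_1,\ldots,h_r)\in\mathrm{Is}(X_1)\times\cdots\times\mathrm{Is}(X_r)$ is regular axial if each $h_i$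 is a rank one isometry of $X_i$; then $h^{\pm}:=(h_1^{\pm},\ldots,h_r^{\pm})\in\partial^F X$. Two regular axial isometries $g,h$ are independent if $g_i,h_i$ are independent for all $i$. The Furstenberg boundary is $\partial^F X=\partial X_1\times\cdots\times\partial X_r$ with the product topology. Every geodesic ray in $X$ has the form $\sigma(t)=(\sigma_1(\theta_1 t),\ldots,\sigma_r(\theta_r t))$ with $\sigma_i$ geodesic rays in $X_i$, $\theta_i\ge 0$, $\sum\theta_i^2=1$; $\theta$ is its slope and depends only on the class of $\sigma$. The regular boundary $\partial X^{reg}$ is the set of points of $\partial X$ whose slope has all coordinates positive, and $\pi^F:\partial X^{reg}\to\partial^F X$ maps the class of $\sigma$ to $(\sigma_1(\infty),\ldots,\sigma_r(\infty))$. $L_\Gamma=\overline{\Gamma\cdot x}\cap\partial X$ ($x\in X$ arbitrary) is the geometric limit set and $F_\Gamma=\pi^F(L_\Gamma\cap\partial X^{reg})$ is the Furstenberg limit set. *)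

theory Defs
  imports
    "HOL-Analysis.Analysis"
    "HOL-Algebra.Bij"
    "HOL-Algebra.Product_Groups"
begin

section \<open>Hadamard spaces\<close>

text \<open>Metric spaces are elements of the type \<open>'a metric\<close>, so that a family of different spaces
  can be indexed by a finite type.\<close>

definition geodesic_on :: "real set \<Rightarrow> 'a metric \<Rightarrow> (real \<Rightarrow> 'a) \<Rightarrow> bool" where
  "geodesic_on S M c \<longleftrightarrow>
     c ` S \<subseteq> mspace M \<and> (\<forall>s\<in>S. \<forall>t\<in>S. mdist M (c s) (c t) = \<bar>s - t\<bar>)"

definition geodesic_between :: "'a metric \<Rightarrow> 'a \<Rightarrow> 'a \<Rightarrow> (real \<Rightarrow> 'a) \<Rightarrow> bool" where
  "geodesic_between M x y c \<longleftrightarrow>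
     geodesic_on {0..mdist M x y} M c \<and> c 0 = x \<and> c (mdist M x y) = y"

definition geodesic_space :: "'a metric \<Rightarrow> bool" where
  "geodesic_space M \<longleftrightarrow> (\<forall>x\<in>mspace M. \<forall>y\<in>mspace M. \<exists>c. geodesic_between M x y c)"

text \<open>Two distinct sides of a geodesic triangle share a vertex and may be parametrised from it,
  so it suffices to compare points on the sides \<open>xy\<close> and \<open>xz\<close> (for all \<open>x\<close>, \<open>y\<close>, \<open>z\<close>).
  Here \<open>x'\<close>, \<open>y'\<close>, \<open>z'\<close> is a comparison triangle in the Euclidean plane and \<open>p\<close>, \<open>q\<close> are the
  comparison points of \<open>c s\<close> and \<open>c' t\<close>.\<close>

definition CAT0_space :: "'a metric \<Rightarrow> bool" where
  "CAT0_space M \<longleftrightarrow> geodesic_space M \<and>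
     (\<forall>x\<in>mspace M. \<forall>y\<in>mspace M. \<forall>z\<in>mspace M. \<forall>c c'.
        geodesic_between M x y c \<longrightarrow> geodesic_between M x z c' \<longrightarrow>
        (\<forall>(x'::real^2) y' z'.
           dist x' y' = mdist M x y \<longrightarrow> dist y' z' = mdist M y z \<longrightarrow> dist x' z' = mdist M x z \<longrightarrow>
           (\<forall>s\<in>{0..mdist M x y}. \<forall>t\<in>{0..mdist M x z}.
              \<forall>p\<in>closed_segment x' y'. \<forall>q\<in>closed_segment x' z'.
                dist x' p = s \<longrightarrow> dist x' q = t \<longrightarrow> mdist M (c s) (c' t) \<le> dist p q)))"

definition hadamard_space :: "'a metric \<Rightarrow> bool" where
  "hadamard_space M \<longleftrightarrow> mcomplete_of M \<and> CAT0_space M"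


section \<open>The geometric boundary and the cone topology\<close>

definition rays :: "'a metric \<Rightarrow> (real \<Rightarrow> 'a) set" where
  "rays M = {c. geodesic_on {0..} M c}"

text \<open>Only the restriction of a ray to \<open>{0..}\<close> matters; the equivalence classes below identify
  functions that differ only at negative arguments.\<close>

definition asymptotic :: "'a metric \<Rightarrow> ((real \<Rightarrow> 'a) \<times> (real \<Rightarrow> 'a)) set" where
  "asymptotic M =
     {(c, c'). c \<in> rays M \<and> c' \<in> rays M \<and> (\<exists>K. \<forall>t\<ge>0. mdist M (c t) (c' t) \<le> K)}"

definition gboundary :: "'a metric \<Rightarrow> (real \<Rightarrow> 'a) set set" where
  "gboundary M = rays M // asymptotic M"

definition endpoint :: "'a metric \<Rightarrow> (real \<Rightarrow> 'a) \<Rightarrow> (real \<Rightarrow> 'a) set" where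
  "endpoint M c = asymptotic M `` {c}"

text \<open>The compactification is modelled on a sum type: \<open>Inl x\<close> is a point of the space and \<open>Inr \<xi>\<close>
  a boundary point. The set below is \<open>U(c, R, \<epsilon>)\<close>: all \<open>z\<close> with \<open>d(z, c(0)) > R\<close> such that the
  geodesic (ray) from \<open>c(0)\<close> to \<open>z\<close> passes at time \<open>R\<close> within distance less than \<open>\<epsilon>\<close> of \<open>c(R)\<close>.\<close>

definition cone_nbhd ::
  "'a metric \<Rightarrow> (real \<Rightarrow> 'a) \<Rightarrow> real \<Rightarrow> real \<Rightarrow> ('a + (real \<Rightarrow> 'a) set) set" where
  "cone_nbhd M c R \<epsilon> =
     Inl ` {x \<in> mspace M. mdist M (c 0) x > R \<and>
              (\<exists>g. geodesic_between M (c 0) x g \<and> mdist M (g R) (c R) < \<epsilon>)} \<union>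
     Inr ` {\<xi> \<in> gboundary M. \<exists>g\<in>\<xi>. g 0 = c 0 \<and> mdist M (g R) (c R) < \<epsilon>}"

text \<open>Usually the rays \<open>c\<close> are restricted to a fixed base point. In a Hadamard space the resulting
  topology does not depend on the base point, so rays from all points can be used.\<close>

definition cone_topology :: "'a metric \<Rightarrow> ('a + (real \<Rightarrow> 'a) set) topology" where
  "cone_topology M = topology_generated_by
     ({Inl ` mball_of M x \<epsilon> | x \<epsilon>. x \<in> mspace M \<and> \<epsilon> > 0} \<union>
      {cone_nbhd M c R \<epsilon> | c R \<epsilon>. c \<in> rays M \<and> R > 0 \<and> \<epsilon> > 0})"

definition boundary_topology :: "'a metric \<Rightarrow> (real \<Rightarrow> 'a) set topology" where
  "boundary_topology M = pullback_topology (gboundary M) Inr (cone_topology M)"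


section \<open>Isometries\<close>

text \<open>Isometries are extensional functions (\<open>undefined\<close> outside the space), so that different
  elements of the group are different as maps of the space.\<close>

definition isometries :: "'a metric \<Rightarrow> ('a \<Rightarrow> 'a) set" where
  "isometries M = {h \<in> Bij (mspace M).
     \<forall>x\<in>mspace M. \<forall>y\<in>mspace M. mdist M (h x) (h y) = mdist M x y}"

definition isometry_group :: "'a metric \<Rightarrow> ('a \<Rightarrow> 'a) monoid" where
  "isometry_group M = (BijGroup (mspace M)) \<lparr>carrier := isometries M\<rparr>"

definition is_axis :: "'a metric \<Rightarrow> ('a \<Rightarrow> 'a) \<Rightarrow> (real \<Rightarrow> 'a) \<Rightarrow> bool" where
  "is_axis M h \<sigma> \<longleftrightarrow> geodesic_on UNIV M \<sigma> \<and> (\<exists>l>0. \<forall>t. h (\<sigma> t) = \<sigma> (t + l))"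

text \<open>The endpoints do not depend on the choice of the axis; see \<open>attracting_fixpoint_eq\<close> and
  \<open>repelling_fixpoint_eq\<close> below.\<close>

definition attracting_fixpoint :: "'a metric \<Rightarrow> ('a \<Rightarrow> 'a) \<Rightarrow> (real \<Rightarrow> 'a) set" where
  "attracting_fixpoint M h = (THE \<xi>. \<exists>\<sigma>. is_axis M h \<sigma> \<and> \<xi> = endpoint M \<sigma>)"

definition repelling_fixpoint :: "'a metric \<Rightarrow> ('a \<Rightarrow> 'a) \<Rightarrow> (real \<Rightarrow> 'a) set" where
  "repelling_fixpoint M h = (THE \<xi>. \<exists>\<sigma>. is_axis M h \<sigma> \<and> \<xi> = endpoint M (\<lambda>t. \<sigma> (- t)))"

definition gconvex :: "'a metric \<Rightarrow> 'a set \<Rightarrow> bool" where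
  "gconvex M A \<longleftrightarrow> A \<subseteq> mspace M \<and>
     (\<forall>x\<in>A. \<forall>y\<in>A. \<forall>c. geodesic_between M x y c \<longrightarrow> c ` {0..mdist M x y} \<subseteq> A)"

text \<open>On \<open>real \<times> real\<close> the library distance is the Euclidean one.\<close>

definition bounds_flat_half_plane :: "'a metric \<Rightarrow> (real \<Rightarrow> 'a) \<Rightarrow> bool" where
  "bounds_flat_half_plane M \<sigma> \<longleftrightarrow> (\<exists>A f.
     closedin (mtopology_of M) A \<and> gconvex M A \<and>
     f ` ({0..} \<times> (UNIV :: real set)) = A \<and>
     (\<forall>p\<in>{0..} \<times> (UNIV :: real set). \<forall>q\<in>{0..} \<times> (UNIV :: real set).
        mdist M (f p) (f q) = dist p q) \<and>
     f ` ({0 :: real} \<times> (UNIV :: real set)) = range \<sigma>)"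

definition rank_one :: "'a metric \<Rightarrow> ('a \<Rightarrow> 'a) \<Rightarrow> bool" where
  "rank_one M h \<longleftrightarrow> h \<in> isometries M \<and> (\<exists>\<sigma>. is_axis M h \<sigma> \<and> \<not> bounds_flat_half_plane M \<sigma>)"

definition independent_isometries :: "'a metric \<Rightarrow> ('a \<Rightarrow> 'a) \<Rightarrow> ('a \<Rightarrow> 'a) \<Rightarrow> bool" where
  "independent_isometries M g h \<longleftrightarrow>
     {attracting_fixpoint M g, repelling_fixpoint M g} \<inter>
     {attracting_fixpoint M h, repelling_fixpoint M h} = {}"


section \<open>Products\<close>

definition product_metric :: "('n::finite \<Rightarrow> 'a metric) \<Rightarrow> ('n \<Rightarrow> 'a) metric" where
  "product_metric X = metric (\<Pi>\<^sub>E i\<in>UNIV. mspace (X i),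
     \<lambda>x y. sqrt (\<Sum>i\<in>UNIV. (mdist (X i) (x i) (y i))\<^sup>2))"

definition act :: "('n \<Rightarrow> 'a \<Rightarrow> 'a) \<Rightarrow> ('n \<Rightarrow> 'a) \<Rightarrow> ('n \<Rightarrow> 'a)" where
  "act h x = (\<lambda>i. h i (x i))"

definition acts_properly_discontinuously ::
  "('n::finite \<Rightarrow> 'a metric) \<Rightarrow> ('n \<Rightarrow> 'a \<Rightarrow> 'a) set \<Rightarrow> bool" where
  "acts_properly_discontinuously X \<Gamma> \<longleftrightarrow>
     (\<forall>K. compactin (mtopology_of (product_metric X)) K \<longrightarrow> finite {\<gamma>\<in>\<Gamma>. act \<gamma> ` K \<inter> K \<noteq> {}})"

definition regular_axial :: "('n \<Rightarrow> 'a metric) \<Rightarrow> ('n \<Rightarrow> 'a \<Rightarrow> 'a) \<Rightarrow> bool" where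
  "regular_axial X h \<longleftrightarrow> (\<forall>i. rank_one (X i) (h i))"

definition independent_regular_axial ::
  "('n \<Rightarrow> 'a metric) \<Rightarrow> ('n \<Rightarrow> 'a \<Rightarrow> 'a) \<Rightarrow> ('n \<Rightarrow> 'a \<Rightarrow> 'a) \<Rightarrow> bool" where
  "independent_regular_axial X g h \<longleftrightarrow>
     regular_axial X g \<and> regular_axial X h \<and> (\<forall>i. independent_isometries (X i) (g i) (h i))"

definition attracting_tuple ::
  "('n \<Rightarrow> 'a metric) \<Rightarrow> ('n \<Rightarrow> 'a \<Rightarrow> 'a) \<Rightarrow> 'n \<Rightarrow> (real \<Rightarrow> 'a) set" where
  "attracting_tuple X h = (\<lambda>i. attracting_fixpoint (X i) (h i))"

definition repelling_tuple ::
  "('n \<Rightarrow> 'a metric) \<Rightarrow> ('n \<Rightarrow> 'a \<Rightarrow> 'a) \<Rightarrow> 'n \<Rightarrow> (real \<Rightarrow> 'a) set" where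
  "repelling_tuple X h = (\<lambda>i. repelling_fixpoint (X i) (h i))"

definition furstenberg_topology ::
  "('n \<Rightarrow> 'a metric) \<Rightarrow> ('n \<Rightarrow> (real \<Rightarrow> 'a) set) topology" where
  "furstenberg_topology X = product_topology (\<lambda>i. boundary_topology (X i)) UNIV"

definition furstenberg_boundary ::
  "('n \<Rightarrow> 'a metric) \<Rightarrow> ('n \<Rightarrow> (real \<Rightarrow> 'a) set) set" where
  "furstenberg_boundary X = (\<Pi>\<^sub>E i\<in>UNIV. gboundary (X i))"

text \<open>\<open>represents X \<xi> \<theta> \<sigma>\<close>: the boundary point \<open>\<xi>\<close> of the product is the class of the ray
  \<open>t \<mapsto> (\<sigma>\<^sub>i(\<theta>\<^sub>i t))\<^sub>i\<close> of slope \<open>\<theta>\<close>.\<close>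

definition represents ::
  "('n::finite \<Rightarrow> 'a metric) \<Rightarrow> (real \<Rightarrow> 'n \<Rightarrow> 'a) set \<Rightarrow> ('n \<Rightarrow> real) \<Rightarrow> ('n \<Rightarrow> real \<Rightarrow> 'a) \<Rightarrow> bool"
  where
  "represents X \<xi> \<theta> \<sigma> \<longleftrightarrow>
     \<xi> \<in> gboundary (product_metric X) \<and>
     (\<forall>i. 0 \<le> \<theta> i) \<and> (\<Sum>i\<in>UNIV. (\<theta> i)\<^sup>2) = 1 \<and> (\<forall>i. \<sigma> i \<in> rays (X i)) \<and>
     (\<lambda>t i. \<sigma> i (\<theta> i * t)) \<in> \<xi>"

definition regular_boundary ::
  "('n::finite \<Rightarrow> 'a metric) \<Rightarrow> (real \<Rightarrow> 'n \<Rightarrow> 'a) set set" where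
  "regular_boundary X =
     {\<xi> \<in> gboundary (product_metric X). \<exists>\<theta> \<sigma>. represents X \<xi> \<theta> \<sigma> \<and> (\<forall>i. 0 < \<theta> i)}"

text \<open>Well defined on the regular boundary; see \<open>furstenberg_proj_eq\<close> below.\<close>

definition furstenberg_proj ::
  "('n::finite \<Rightarrow> 'a metric) \<Rightarrow> (real \<Rightarrow> 'n \<Rightarrow> 'a) set \<Rightarrow> 'n \<Rightarrow> (real \<Rightarrow> 'a) set" where
  "furstenberg_proj X \<xi> =
     (THE \<eta>. \<exists>\<theta> \<sigma>. represents X \<xi> \<theta> \<sigma> \<and> (\<forall>i. 0 < \<theta> i) \<and> \<eta> = (\<lambda>i. endpoint (X i) (\<sigma> i)))"

definition limit_set ::
  "('n::finite \<Rightarrow> 'a metric) \<Rightarrow> ('n \<Rightarrow> 'a \<Rightarrow> 'a) set \<Rightarrow> ('n \<Rightarrow> 'a) \<Rightarrow> (real \<Rightarrow> 'n \<Rightarrow> 'a) set set" where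
  "limit_set X \<Gamma> x = {\<xi> \<in> gboundary (product_metric X).
     Inr \<xi> \<in> cone_topology (product_metric X) closure_of (Inl ` {act \<gamma> x | \<gamma>. \<gamma> \<in> \<Gamma>})}"

definition furstenberg_limit_set ::
  "('n::finite \<Rightarrow> 'a metric) \<Rightarrow> ('n \<Rightarrow> 'a \<Rightarrow> 'a) set \<Rightarrow> ('n \<Rightarrow> 'a) \<Rightarrow> ('n \<Rightarrow> (real \<Rightarrow> 'a) set) set" where
  "furstenberg_limit_set X \<Gamma> x = furstenberg_proj X ` (limit_set X \<Gamma> x \<inter> regular_boundary X)"

definition fat_diagonal ::
  "('n \<Rightarrow> 'a metric) \<Rightarrow> (('n \<Rightarrow> (real \<Rightarrow> 'a) set) \<times> ('n \<Rightarrow> (real \<Rightarrow> 'a) set)) set" where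
  "fat_diagonal X =
     {(\<xi>, \<eta>) \<in> furstenberg_boundary X \<times> furstenberg_boundary X. \<exists>i. \<xi> i = \<eta> i}"

definition dense_in :: "'b topology \<Rightarrow> 'b set \<Rightarrow> 'b set \<Rightarrow> bool" where
  "dense_in T A B \<longleftrightarrow> A \<subseteq> B \<and> B \<subseteq> T closure_of A"


section \<open>The definitions are well formed\<close>

lemma Metric_space_product:
  fixes X :: "'n::finite \<Rightarrow> 'a metric"
  shows "Metric_space (\<Pi>\<^sub>E i\<in>UNIV. mspace (X i))
           (\<lambda>x y. sqrt (\<Sum>i\<in>UNIV. (mdist (X i) (x i) (y i))\<^sup>2))"
proof
  fix x y z
  show "0 \<le> sqrt (\<Sum>i\<in>UNIV. (mdist (X i) (x i) (y i))\<^sup>2)"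
    by (simp add: sum_nonneg)
  show "sqrt (\<Sum>i\<in>UNIV. (mdist (X i) (x i) (y i))\<^sup>2) =
        sqrt (\<Sum>i\<in>UNIV. (mdist (X i) (y i) (x i))\<^sup>2)"
    by (simp add: mdist_commute)
  assume x: "x \<in> (\<Pi>\<^sub>E i\<in>UNIV. mspace (X i))" and y: "y \<in> (\<Pi>\<^sub>E i\<in>UNIV. mspace (X i))"
  show "(sqrt (\<Sum>i\<in>UNIV. (mdist (X i) (x i) (y i))\<^sup>2) = 0) = (x = y)"
    using x y by (auto simp: sum_nonneg_eq_0_iff PiE_iff fun_eq_iff)
  assume z: "z \<in> (\<Pi>\<^sub>E i\<in>UNIV. mspace (X i))"
  have "L2_set (\<lambda>i. mdist (X i) (x i) (z i)) UNIV \<le>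
        L2_set (\<lambda>i. mdist (X i) (x i) (y i) + mdist (X i) (y i) (z i)) UNIV"
    using x y z by (intro L2_set_mono) (auto simp: PiE_iff mdist_triangle)
  also have "\<dots> \<le> L2_set (\<lambda>i. mdist (X i) (x i) (y i)) UNIV +
                   L2_set (\<lambda>i. mdist (X i) (y i) (z i)) UNIV"
    by (rule L2_set_triangle_ineq)
  finally show "sqrt (\<Sum>i\<in>UNIV. (mdist (X i) (x i) (z i))\<^sup>2) \<le>
      sqrt (\<Sum>i\<in>UNIV. (mdist (X i) (x i) (y i))\<^sup>2) + sqrt (\<Sum>i\<in>UNIV. (mdist (X i) (y i) (z i))\<^sup>2)"
    by (simp add: L2_set_def)
qed

lemma mspace_product_metric [simp]: "mspace (product_metric X) = (\<Pi>\<^sub>E i\<in>UNIV. mspace (X i))"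
  by (simp add: product_metric_def Metric_space.mspace_metric [OF Metric_space_product])

lemma mdist_product_metric [simp]:
  "mdist (product_metric X) x y = sqrt (\<Sum>i\<in>UNIV. (mdist (X i) (x i) (y i))\<^sup>2)"
  by (simp add: product_metric_def Metric_space.mdist_metric [OF Metric_space_product])

lemma mdist_component_le:
  "mdist (X i) (x i) (y i) \<le> mdist (product_metric X) x y"
  using member_le_L2_set [of UNIV i "\<lambda>i. mdist (X i) (x i) (y i)"] by (simp add: L2_set_def)

lemma isometries_subgroup: "subgroup (isometries M) (BijGroup (mspace M))"
proof (rule group.subgroupI [OF group_BijGroup])
  show "isometries M \<subseteq> carrier (BijGroup (mspace M))"
    by (auto simp: isometries_def BijGroup_def)
  have "(\<lambda>x\<in>mspace M. x) \<in> isometries M"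
    by (simp add: isometries_def id_Bij)
  then show "isometries M \<noteq> {}"
    by blast
next
  fix g assume g: "g \<in> isometries M"
  then have gB: "g \<in> Bij (mspace M)" and
    iso: "\<And>x y. x \<in> mspace M \<Longrightarrow> y \<in> mspace M \<Longrightarrow> mdist M (g x) (g y) = mdist M x y"
    by (auto simp: isometries_def)
  have bij: "bij_betw g (mspace M) (mspace M)"
    using gB by (simp add: Bij_def)
  have "(\<lambda>x\<in>mspace M. inv_into (mspace M) g x) \<in> isometries M"
    unfolding isometries_def
  proof (intro CollectI conjI ballI)
    show "(\<lambda>x\<in>mspace M. inv_into (mspace M) g x) \<in> Bij (mspace M)"
      by (rule restrict_inv_into_Bij [OF gB])
    fix x y assume x: "x \<in> mspace M" and y: "y \<in> mspace M"
    have "inv_into (mspace M) g x \<in> mspace M" "inv_into (mspace M) g y \<in> mspace M"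
      and "g (inv_into (mspace M) g x) = x" "g (inv_into (mspace M) g y) = y"
      using bij x y by (auto simp: bij_betw_def inv_into_into f_inv_into_f)
    then show "mdist M ((\<lambda>x\<in>mspace M. inv_into (mspace M) g x) x)
                 ((\<lambda>x\<in>mspace M. inv_into (mspace M) g x) y) = mdist M x y"
      using iso x y by (metis restrict_apply')
  qed
  then show "inv\<^bsub>BijGroup (mspace M)\<^esub> g \<in> isometries M"
    by (simp add: inv_BijGroup gB)
next
  fix g h assume g: "g \<in> isometries M" and h: "h \<in> isometries M"
  have gh: "g \<in> Bij (mspace M)" "h \<in> Bij (mspace M)"
    using g h by (auto simp: isometries_def)
  have hm: "h x \<in> mspace M" if "x \<in> mspace M" for x
    using gh(2) that by (auto simp: Bij_def bij_betw_def)
  show "g \<otimes>\<^bsub>BijGroup (mspace M)\<^esub> h \<in> isometries M"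
    using g h hm by (auto simp: isometries_def BijGroup_def compose_Bij compose_eq)
qed

lemma group_isometry_group: "group (isometry_group M)"
  unfolding isometry_group_def
  by (rule subgroup.subgroup_is_group [OF isometries_subgroup group_BijGroup])

lemma equiv_asymptotic: "equiv (rays M) (asymptotic M)"
proof (rule equivI)
  show "asymptotic M \<subseteq> rays M \<times> rays M"
    by (auto simp: asymptotic_def)
  show "refl_on (rays M) (asymptotic M)"
  proof (rule refl_onI)
    fix c assume c: "c \<in> rays M"
    have "\<forall>t\<ge>0. mdist M (c t) (c t) \<le> 0"
      using c by (auto simp: rays_def geodesic_on_def)
    with c show "(c, c) \<in> asymptotic M"
      unfolding asymptotic_def by blast
  qed
  show "sym (asymptotic M)"
    by (rule symI) (auto simp: asymptotic_def mdist_commute)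
  show "trans (asymptotic M)"
  proof (rule transI)
    fix a b c assume ab: "(a, b) \<in> asymptotic M" and bc: "(b, c) \<in> asymptotic M"
    obtain K where K: "\<forall>t\<ge>0. mdist M (a t) (b t) \<le> K"
      using ab by (auto simp: asymptotic_def)
    obtain L where L: "\<forall>t\<ge>0. mdist M (b t) (c t) \<le> L"
      using bc by (auto simp: asymptotic_def)
    have "mdist M (a t) (c t) \<le> K + L" if "t \<ge> 0" for t
    proof -
      have "a t \<in> mspace M" "b t \<in> mspace M" "c t \<in> mspace M"
        using ab bc that by (auto simp: asymptotic_def rays_def geodesic_on_def)
      then have "mdist M (a t) (c t) \<le> mdist M (a t) (b t) + mdist M (b t) (c t)"
        by (rule mdist_triangle)
      then show ?thesis
        using K L that by (meson add_mono order_trans)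
    qed
    then show "(a, c) \<in> asymptotic M"
      using ab bc unfolding asymptotic_def by blast
  qed
qed

lemma endpoint_eq: "(c, c') \<in> asymptotic M \<Longrightarrow> endpoint M c = endpoint M c'"
  unfolding endpoint_def by (rule equiv_class_eq [OF equiv_asymptotic])

lemma geodesic_line_ray: "geodesic_on UNIV M \<sigma> \<Longrightarrow> \<sigma> \<in> rays M"
  by (auto simp: rays_def geodesic_on_def)

lemma geodesic_line_reverse: "geodesic_on UNIV M \<sigma> \<Longrightarrow> geodesic_on UNIV M (\<lambda>t. \<sigma> (- t))"
  by (auto simp: geodesic_on_def)

lemma axes_bounded_distance:
  assumes h: "h \<in> isometries M" and s: "is_axis M h \<sigma>" and s': "is_axis M h \<sigma>'"
  shows "\<exists>K. \<forall>t. mdist M (\<sigma> t) (\<sigma>' t) \<le> K"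
proof -
  obtain l where l: "l > 0" "\<And>t. h (\<sigma> t) = \<sigma> (t + l)"
    using s by (auto simp: is_axis_def)
  obtain m where m: "m > 0" "\<And>t. h (\<sigma>' t) = \<sigma>' (t + m)"
    using s' by (auto simp: is_axis_def)
  have in1: "\<sigma> t \<in> mspace M" and in2: "\<sigma>' t \<in> mspace M" for t
    using s s' by (auto simp: is_axis_def geodesic_on_def)
  have d1: "mdist M (\<sigma> a) (\<sigma> b) = \<bar>a - b\<bar>" and d2: "mdist M (\<sigma>' a) (\<sigma>' b) = \<bar>a - b\<bar>" for a b
    using s s' by (auto simp: is_axis_def geodesic_on_def)
  have shift: "mdist M (\<sigma> (a + l)) (\<sigma>' (b + m)) = mdist M (\<sigma> a) (\<sigma>' b)" for a b
    unfolding l(2) [symmetric] m(2) [symmetric] using h in1 in2 by (simp add: isometries_def)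
  have shift_n: "mdist M (\<sigma> (a + of_nat n * l)) (\<sigma>' (b + of_nat n * m)) = mdist M (\<sigma> a) (\<sigma>' b)"
    for a b and n :: nat
  proof (induction n)
    case (Suc n)
    have "a + of_nat (Suc n) * l = (a + of_nat n * l) + l"
      "b + of_nat (Suc n) * m = (b + of_nat n * m) + m"
      by (simp_all add: algebra_simps)
    then show ?case
      using shift [of "a + of_nat n * l" "b + of_nat n * m"] Suc by (simp only:)
  qed simp
  define D where "D = mdist M (\<sigma> 0) (\<sigma>' 0)"
  have le: "of_nat n * \<bar>l - m\<bar> \<le> 2 * D" for n :: nat
  proof -
    have A: "mdist M (\<sigma> (of_nat n * l)) (\<sigma>' (of_nat n * m)) = D"
      using shift_n [of 0 n 0] by (simp add: D_def)
    have "mdist M (\<sigma> 0) (\<sigma> (of_nat n * l)) \<le>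
        mdist M (\<sigma> 0) (\<sigma>' 0) + mdist M (\<sigma>' 0) (\<sigma>' (of_nat n * m)) +
        mdist M (\<sigma>' (of_nat n * m)) (\<sigma> (of_nat n * l))"
      using mdist_triangle [OF in1 in2 in1] mdist_triangle [OF in2 in2 in1]
      by (smt (verit))
    then have 1: "of_nat n * l \<le> 2 * D + of_nat n * m"
      using A l(1) m(1) by (simp add: d1 d2 D_def mdist_commute abs_mult)
    have "mdist M (\<sigma>' 0) (\<sigma>' (of_nat n * m)) \<le>
        mdist M (\<sigma>' 0) (\<sigma> 0) + mdist M (\<sigma> 0) (\<sigma> (of_nat n * l)) +
        mdist M (\<sigma> (of_nat n * l)) (\<sigma>' (of_nat n * m))"
      using mdist_triangle [OF in2 in1 in2] mdist_triangle [OF in1 in1 in2]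
      by (smt (verit))
    then have 2: "of_nat n * m \<le> 2 * D + of_nat n * l"
      using A l(1) m(1) by (simp add: d1 d2 D_def mdist_commute abs_mult)
    show ?thesis
      using 1 2 by (cases "l \<ge> m") (auto simp: algebra_simps)
  qed
  have lm: "l = m"
  proof (rule ccontr)
    assume "l \<noteq> m"
    then have "\<bar>l - m\<bar> > 0"
      by simp
    then obtain n :: nat where "2 * D < of_nat n * \<bar>l - m\<bar>"
      using reals_Archimedean3 by blast
    with le [of n] show False
      by simp
  qed
  have shift_i: "mdist M (\<sigma> (a + of_int k * l)) (\<sigma>' (a + of_int k * l)) = mdist M (\<sigma> a) (\<sigma>' a)"
    for a and k :: int
  proof (cases "k \<ge> 0")
    case True
    then show ?thesis
      using shift_n [of a "nat k" a] lm by simp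
  next
    case False
    then show ?thesis
      using shift_n [of "a + of_int k * l" "nat (- k)" "a + of_int k * l"] lm by simp
  qed
  have "mdist M (\<sigma> t) (\<sigma>' t) \<le> 2 * l + D" for t
  proof -
    define k where "k = \<lfloor>t / l\<rfloor>"
    define a where "a = t - of_int k * l"
    have "of_int k \<le> t / l" "t / l < of_int k + 1"
      unfolding k_def by linarith+
    then have a: "0 \<le> a" "a < l"
      using l(1) by (auto simp: a_def field_simps)
    have "mdist M (\<sigma> t) (\<sigma>' t) = mdist M (\<sigma> a) (\<sigma>' a)"
      using shift_i [of a k] by (simp add: a_def)
    also have "\<dots> \<le> mdist M (\<sigma> a) (\<sigma> 0) + mdist M (\<sigma> 0) (\<sigma>' 0) + mdist M (\<sigma>' 0) (\<sigma>' a)"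
      using mdist_triangle [OF in1 in1 in2] mdist_triangle [OF in1 in2 in2]
      by (smt (verit))
    also have "\<dots> \<le> 2 * l + D"
      using a by (simp add: d1 d2 D_def)
    finally show ?thesis .
  qed
  then show ?thesis
    by blast
qed

lemma attracting_fixpoint_eq:
  assumes h: "h \<in> isometries M" and s: "is_axis M h \<sigma>"
  shows "attracting_fixpoint M h = endpoint M \<sigma>"
  unfolding attracting_fixpoint_def
proof (rule the_equality)
  show "\<exists>\<sigma>'. is_axis M h \<sigma>' \<and> endpoint M \<sigma> = endpoint M \<sigma>'"
    using s by blast
  fix \<xi> assume "\<exists>\<sigma>'. is_axis M h \<sigma>' \<and> \<xi> = endpoint M \<sigma>'"
  then obtain \<sigma>' where s': "is_axis M h \<sigma>'" and xi: "\<xi> = endpoint M \<sigma>'"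
    by blast
  have "(\<sigma>', \<sigma>) \<in> asymptotic M"
    using axes_bounded_distance [OF h s' s] s s'
    by (auto simp: asymptotic_def is_axis_def geodesic_line_ray)
  then show "\<xi> = endpoint M \<sigma>"
    by (simp add: xi endpoint_eq)
qed

lemma repelling_fixpoint_eq:
  assumes h: "h \<in> isometries M" and s: "is_axis M h \<sigma>"
  shows "repelling_fixpoint M h = endpoint M (\<lambda>t. \<sigma> (- t))"
  unfolding repelling_fixpoint_def
proof (rule the_equality)
  show "\<exists>\<sigma>'. is_axis M h \<sigma>' \<and> endpoint M (\<lambda>t. \<sigma> (- t)) = endpoint M (\<lambda>t. \<sigma>' (- t))"
    using s by blast
  fix \<xi> assume "\<exists>\<sigma>'. is_axis M h \<sigma>' \<and> \<xi> = endpoint M (\<lambda>t. \<sigma>' (- t))"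
  then obtain \<sigma>' where s': "is_axis M h \<sigma>'" and xi: "\<xi> = endpoint M (\<lambda>t. \<sigma>' (- t))"
    by blast
  have "((\<lambda>t. \<sigma>' (- t)), (\<lambda>t. \<sigma> (- t))) \<in> asymptotic M"
    using axes_bounded_distance [OF h s' s] s s'
    by (auto simp: asymptotic_def is_axis_def geodesic_line_ray geodesic_line_reverse)
  then show "\<xi> = endpoint M (\<lambda>t. \<sigma> (- t))"
    by (simp add: xi endpoint_eq)
qed

lemma reparametrised_rays_asymptotic:
  assumes c: "c \<in> rays M" "c' \<in> rays M" and pos: "0 < a" "0 < b"
    and K: "\<And>t. 0 \<le> t \<Longrightarrow> mdist M (c (a * t)) (c' (b * t)) \<le> K"
  shows "a = b" and "(c, c') \<in> asymptotic M"
proof -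
  have in1: "c t \<in> mspace M" and in2: "c' t \<in> mspace M" if "0 \<le> t" for t
    using c that by (auto simp: rays_def geodesic_on_def)
  have d0: "mdist M (c 0) (c t) = t" and d0': "mdist M (c' 0) (c' t) = t" if "0 \<le> t" for t
    using c that by (auto simp: rays_def geodesic_on_def)
  define D where "D = mdist M (c 0) (c' 0)"
  have le: "t * \<bar>a - b\<bar> \<le> D + K" if t: "0 \<le> t" for t
  proof -
    have p: "0 \<le> a * t" "0 \<le> b * t"
      using pos t by auto
    have "mdist M (c 0) (c (a * t)) \<le>
        mdist M (c 0) (c' 0) + mdist M (c' 0) (c' (b * t)) + mdist M (c' (b * t)) (c (a * t))"
      using mdist_triangle [OF in1 [of 0] in2 [of 0] in1 [OF p(1)]]
        mdist_triangle [OF in2 [of 0] in2 [OF p(2)] in1 [OF p(1)]] by (smt (verit))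
    then have 1: "a * t \<le> D + b * t + K"
      using K [OF t] p by (simp add: d0 d0' D_def mdist_commute)
    have "mdist M (c' 0) (c' (b * t)) \<le>
        mdist M (c' 0) (c 0) + mdist M (c 0) (c (a * t)) + mdist M (c (a * t)) (c' (b * t))"
      using mdist_triangle [OF in2 [of 0] in1 [of 0] in2 [OF p(2)]]
        mdist_triangle [OF in1 [of 0] in1 [OF p(1)] in2 [OF p(2)]] by (smt (verit))
    then have 2: "b * t \<le> D + a * t + K"
      using K [OF t] p by (simp add: d0 d0' D_def mdist_commute)
    show ?thesis
      using 1 2 by (cases "a \<ge> b") (auto simp: algebra_simps)
  qed
  show ab: "a = b"
  proof (rule ccontr)
    assume "a \<noteq> b"
    then have "\<bar>a - b\<bar> > 0"
      by simp
    then obtain n :: nat where "D + K < of_nat n * \<bar>a - b\<bar>"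
      using reals_Archimedean3 by blast
    with le [of "of_nat n"] show False
      by simp
  qed
  have "mdist M (c t) (c' t) \<le> K" if "0 \<le> t" for t
    using K [of "t / a"] that pos ab by simp
  then show "(c, c') \<in> asymptotic M"
    using c unfolding asymptotic_def by blast
qed

lemma furstenberg_proj_eq:
  fixes X :: "'n::finite \<Rightarrow> 'a metric"
  assumes r: "represents X \<xi> \<theta> \<sigma>" and pos: "\<And>i. 0 < \<theta> i"
  shows "furstenberg_proj X \<xi> = (\<lambda>i. endpoint (X i) (\<sigma> i))"
  unfolding furstenberg_proj_def
proof (rule the_equality)
  show "\<exists>\<theta>' \<sigma>'. represents X \<xi> \<theta>' \<sigma>' \<and> (\<forall>i. 0 < \<theta>' i) \<and>
      (\<lambda>i. endpoint (X i) (\<sigma> i)) = (\<lambda>i. endpoint (X i) (\<sigma>' i))"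
    using r pos by blast
  fix \<eta> assume "\<exists>\<theta>' \<sigma>'. represents X \<xi> \<theta>' \<sigma>' \<and> (\<forall>i. 0 < \<theta>' i) \<and>
      \<eta> = (\<lambda>i. endpoint (X i) (\<sigma>' i))"
  then obtain \<theta>' \<sigma>' where r': "represents X \<xi> \<theta>' \<sigma>'" and pos': "\<And>i. 0 < \<theta>' i"
    and eta: "\<eta> = (\<lambda>i. endpoint (X i) (\<sigma>' i))"
    by blast
  have "\<xi> \<in> rays (product_metric X) // asymptotic (product_metric X)"
    using r by (simp add: represents_def gboundary_def)
  then have "((\<lambda>t i. \<sigma>' i (\<theta>' i * t)), (\<lambda>t i. \<sigma> i (\<theta> i * t))) \<in> asymptotic (product_metric X)"
    using r r' quotient_eq_iff [OF equiv_asymptotic, of \<xi> "product_metric X" \<xi>]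
    by (auto simp: represents_def)
  then obtain K where K: "\<And>t. 0 \<le> t \<Longrightarrow>
      mdist (product_metric X) (\<lambda>i. \<sigma>' i (\<theta>' i * t)) (\<lambda>i. \<sigma> i (\<theta> i * t)) \<le> K"
    unfolding asymptotic_def by blast
  have "(\<sigma>' i, \<sigma> i) \<in> asymptotic (X i)" for i
  proof (rule reparametrised_rays_asymptotic(2))
    show "\<sigma>' i \<in> rays (X i)" "\<sigma> i \<in> rays (X i)"
      using r r' by (auto simp: represents_def)
    show "0 < \<theta>' i" "0 < \<theta> i"
      by (rule pos' pos)+
    show "mdist (X i) (\<sigma>' i (\<theta>' i * t)) (\<sigma> i (\<theta> i * t)) \<le> K" if "0 \<le> t" for t
      using K [OF that] mdist_component_le [of X i "\<lambda>i. \<sigma>' i (\<theta>' i * t)" "\<lambda>i. \<sigma> i (\<theta> i * t)"]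
      by linarith
  qed
  then show "\<eta> = (\<lambda>i. endpoint (X i) (\<sigma> i))"
    unfolding eta by (intro ext endpoint_eq)
qed

lemma topspace_cone_topology:
  "topspace (cone_topology M) = Inl ` mspace M \<union> Inr ` gboundary M"
proof
  show "topspace (cone_topology M) \<subseteq> Inl ` mspace M \<union> Inr ` gboundary M"
    by (auto simp: cone_topology_def cone_nbhd_def mball_of_def
        Metric_space.in_mball [OF Metric_space_mspace_mdist])
  show "Inl ` mspace M \<union> Inr ` gboundary M \<subseteq> topspace (cone_topology M)"
  proof (intro Un_least image_subsetI)
    fix x assume x: "x \<in> mspace M"
    then have "mdist M x x = 0"
      by simp
    then have "mdist M x x < 1"
      by linarith
    with x have "x \<in> mball_of M x 1"
      by (simp add: mball_of_def Metric_space.in_mball [OF Metric_space_mspace_mdist])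
    then show "Inl x \<in> topspace (cone_topology M)"
      unfolding cone_topology_def topology_generated_by_topspace
      using x zero_less_one by blast
  next
    fix \<xi> assume xi: "\<xi> \<in> gboundary M"
    then obtain c where c: "c \<in> rays M" "c \<in> \<xi>"
      unfolding gboundary_def
      using equiv_class_self [OF equiv_asymptotic] by (blast elim: quotientE)
    then have "mdist M (c 1) (c 1) = 0"
      by (auto simp: rays_def geodesic_on_def)
    then have "mdist M (c 1) (c 1) < 1"
      by linarith
    then have "Inr \<xi> \<in> cone_nbhd M c 1 1"
      unfolding cone_nbhd_def using xi c(2) by (intro UnI2 imageI CollectI conjI) blast+
    then show "Inr \<xi> \<in> topspace (cone_topology M)"
      unfolding cone_topology_def topology_generated_by_topspace
      using c(1) zero_less_one by blast
  qed
qed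

lemma topspace_furstenberg_topology: "topspace (furstenberg_topology X) = furstenberg_boundary X"
  by (auto simp: furstenberg_topology_def furstenberg_boundary_def boundary_topology_def
      topspace_pullback_topology topspace_cone_topology PiE_iff)

end

theory Submission
  imports Defs "HOL-Library.Diagonal_Subsequence"
begin

text \<open>Each space is replaced by a pseudometric on its whole type. A geodesic line along which the
  distance to points going to infinity is asymptotically affine with slope in \<open>(-1, 1)\<close> bounds a
  flat half plane; hence the axis of a rank one isometry can be joined to every boundary point
  other than its ends, in the sense that geodesics between points close to the two boundary points
  pass through a fixed ball. Conversely, an isometry \<open>g\<close> such that \<open>g p\<close> and \<open>g\<^sup>-\<^sup>1 p\<close> are close to
  two boundary points that are joined in this sense has a rank one axis with ends close to them.

  For \<open>\<xi>\<close> in the Furstenberg limit set choose \<open>\<gamma>\<^sub>n\<close> such that \<open>\<gamma>\<^sub>n x\<close> converges to \<open>\<xi>\<close> and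
  \<open>\<gamma>\<^sub>n\<^sup>-\<^sup>1 x\<close> converges in every factor, and a regular axial \<open>a\<close> none of whose ends is one of
  these limits: almost all conjugates of one of the given isometries by powers of the other will
  do. Then both fixed points of \<open>\<gamma>\<^sub>n a \<gamma>\<^sub>n\<^sup>-\<^sup>1\<close> are close to \<open>\<xi>\<close>. If \<open>a\<close>, \<open>b\<close> are such conjugates for
  \<open>\<xi>\<close> and \<open>\<eta>\<close> with \<open>\<xi>\<^sub>i \<noteq> \<eta>\<^sub>i\<close> for all \<open>i\<close>, then \<open>a\<^sup>n b\<^sup>-\<^sup>n\<close> is regular axial for large \<open>n\<close>, with
  attracting point close to \<open>\<xi>\<close> and repelling point close to \<open>\<eta>\<close>.\<close>

section \<open>Geodesics, rays and neighbourhoods of boundary points\<close>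

text \<open>The obstacle is the product: one element has to be rank one in all factors at once,
  while the elements \<gamma>_n that approach \<xi> need not be axial in any of them. Hence only
  words and conjugates are used whose behaviour is controlled for all large exponents, so that
  finitely many "eventually" statements, one per factor, can be met together. For the same reason
  infinitely many conjugates are offered for \<open>a\<close>: each factor forbids finitely many.
  Because both ends of the conjugates are near the same limit point, neighbourhoods of \<xi> and
  \<eta> that are disjoint in every factor keep the ends of \<open>a\<close> and \<open>b\<close>
  apart; this is where the fat diagonal is excluded.

  Visibility is a statement about points near the ends, not a line joining them, because it can be
  tested on orbit points and transported: if a geodesic passes near \<open>p\<close>, its image
  under \<open>g\<close> passes near the image of \<open>p\<close>, which is far away in a known
  direction. With pseudometrics every element of the type is a point, so there are no membership
  conditions; the price is that equality of points becomes distance 0.\<close>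

text \<open>The last axiom is the inequality of Bruhat and Tits for points dividing the geodesic from
  \<open>x\<close> to \<open>y\<close> in the ratio \<open>t : 1 - t\<close>. No separation is assumed, so points are determined up to
  distance 0 only.\<close>

locale hadamard_pseudometric =
  fixes d :: "'a \<Rightarrow> 'a \<Rightarrow> real"
  assumes refl [simp]: "d x x = 0"
    and sym: "d x y = d y x"
    and tri: "d x z \<le> d x y + d y z"
    and complete: "(\<And>e. e > 0 \<Longrightarrow> \<exists>N. \<forall>m\<ge>N. \<forall>n\<ge>N. d (s m) (s n) < e) \<Longrightarrow>
          \<exists>l. (\<lambda>n::nat. d (s n) l) \<longlonglongrightarrow> 0"
    and cn_point: "0 \<le> t \<Longrightarrow> t \<le> 1 \<Longrightarrow>
          \<exists>p. \<forall>z. (d z p)\<^sup>2 \<le> (1 - t) * (d z x)\<^sup>2 + t * (d z y)\<^sup>2 - t * (1 - t) * (d x y)\<^sup>2"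
begin

text \<open>Any two choices are at distance 0 by \<open>gp_unique\<close>, so no distance depends on
  the choice.\<close>

definition gp :: "'a \<Rightarrow> 'a \<Rightarrow> real \<Rightarrow> 'a" where
  "gp x y t = (SOME p. \<forall>z. (d z p)\<^sup>2 \<le> (1 - t) * (d z x)\<^sup>2 + t * (d z y)\<^sup>2 - t * (1 - t) * (d x y)\<^sup>2)"

lemma gp_cn:
  assumes "0 \<le> t" "t \<le> 1"
  shows "(d z (gp x y t))\<^sup>2 \<le> (1 - t) * (d z x)\<^sup>2 + t * (d z y)\<^sup>2 - t * (1 - t) * (d x y)\<^sup>2"
  using someI_ex [OF cn_point [OF assms, of x y]] unfolding gp_def by blast

lemma nonneg [simp]: "0 \<le> d x y"
  using tri [of x x y] sym [of x y] by simp

lemma d0_cong: "d x x' = 0 \<Longrightarrow> d y y' = 0 \<Longrightarrow> d x y = d x' y'"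
  by (smt (verit) tri sym)

lemma d0_left: "d x x' = 0 \<Longrightarrow> d x y = d x' y"
  by (rule d0_cong) auto

lemma d0_right: "d x x' = 0 \<Longrightarrow> d y x = d y x'"
  by (rule d0_cong) auto

text \<open>Taking \<open>z\<close> to be an end in the inequality bounds both distances from above;
  as they must add up to at least \<open>d x y\<close>, both bounds are attained.\<close>

lemma gp_left: assumes "0 \<le> t" "t \<le> 1" shows "d x (gp x y t) = t * d x y"
  and gp_right: "d (gp x y t) y = (1 - t) * d x y"
proof -
  have "(d x (gp x y t))\<^sup>2 \<le> (t * d x y)\<^sup>2"
    using gp_cn [OF assms, of x x y] by (simp add: algebra_simps power2_eq_square)
  then have 1: "d x (gp x y t) \<le> t * d x y"
    using assms by (simp add: power2_le_iff_abs_le abs_mult)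
  have "(d y (gp x y t))\<^sup>2 \<le> ((1 - t) * d x y)\<^sup>2"
    using gp_cn [OF assms, of y x y] by (simp add: algebra_simps power2_eq_square sym [of y x])
  then have 2: "d y (gp x y t) \<le> (1 - t) * d x y"
    using assms by (simp add: power2_le_iff_abs_le abs_mult)
  have "d x y \<le> d x (gp x y t) + d y (gp x y t)"
    using tri [of x y "gp x y t"] sym by simp
  moreover have "t * d x y + (1 - t) * d x y = d x y"
    by (simp add: algebra_simps)
  ultimately show "d x (gp x y t) = t * d x y" "d (gp x y t) y = (1 - t) * d x y"
    using 1 2 sym [of y "gp x y t"] by linarith+
qed

text \<open>The test point \<open>z = p\<close> makes the right-hand side of \<open>gp_cn\<close> at
  most 0.\<close>

lemma gp_unique:
  assumes "0 \<le> t" "t \<le> 1" "d x p \<le> t * d x y" "d p y \<le> (1 - t) * d x y"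
  shows "d p (gp x y t) = 0"
proof -
  have 1: "(d p x)\<^sup>2 \<le> (t * d x y)\<^sup>2" "(d p y)\<^sup>2 \<le> ((1 - t) * d x y)\<^sup>2"
    using assms by (auto intro!: power_mono simp: sym [of p x])
  have "(d p (gp x y t))\<^sup>2 \<le> (1 - t) * (d p x)\<^sup>2 + t * (d p y)\<^sup>2 - t * (1 - t) * (d x y)\<^sup>2"
    by (rule gp_cn) fact+
  also have "\<dots> \<le> (1 - t) * (t * d x y)\<^sup>2 + t * ((1 - t) * d x y)\<^sup>2 - t * (1 - t) * (d x y)\<^sup>2"
    using assms 1 by (intro diff_right_mono add_mono mult_left_mono) auto
  also have "\<dots> = 0"
    by (simp add: algebra_simps power2_eq_square)
  finally show ?thesis
    by simp
qed

lemma gp_0: "d (gp x y 0) x = 0" and gp_1: "d (gp x y 1) y = 0"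
  using gp_left [of 0 x y] gp_right [of 1 x y] sym by simp_all

lemma gp_swap: "0 \<le> t \<Longrightarrow> t \<le> 1 \<Longrightarrow> d (gp x y t) (gp y x (1 - t)) = 0"
  by (rule gp_unique) (simp_all add: gp_left gp_right sym [of _ x] sym [of y] )

text \<open>Apply \<open>gp_cn\<close> to the second point tested at the first, then to the first
  point tested at \<open>z\<close>: everything cancels except \<open>(t * d y z)\<^sup>2\<close>.
  Convexity of the distance follows from this comparison of two geodesics issuing from
  \<open>x\<close>.\<close>

lemma gp_near_left:
  assumes "0 \<le> t" "t \<le> 1"
  shows "d (gp x y t) (gp x z t) \<le> t * d y z"
proof -
  let ?p = "gp x y t" and ?q = "gp x z t"
  have 1: "(d ?p ?q)\<^sup>2 \<le> (1 - t) * (t * d x y)\<^sup>2 + t * (d z ?p)\<^sup>2 - t * (1 - t) * (d x z)\<^sup>2"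
    using gp_cn [OF assms, of ?p x z] gp_left [OF assms, of x y] sym [of ?p x] sym [of ?p z] by simp
  have 2: "t * (d z ?p)\<^sup>2 \<le> t * ((1 - t) * (d x z)\<^sup>2 + t * (d y z)\<^sup>2 - t * (1 - t) * (d x y)\<^sup>2)"
    using gp_cn [OF assms, of z x y] assms sym [of z x] sym [of z y]
    by (intro mult_left_mono) simp_all
  have "(d ?p ?q)\<^sup>2 \<le> (t * d y z)\<^sup>2"
    using 1 2 by (simp add: algebra_simps power2_eq_square)
  then show ?thesis
    using assms by (simp add: power2_le_iff_abs_le abs_mult)
qed

lemma gp_near_right:
  assumes "0 \<le> t" "t \<le> 1"
  shows "d (gp x z t) (gp y z t) \<le> (1 - t) * d x y"
proof -
  have "d (gp x z t) (gp y z t) = d (gp z x (1 - t)) (gp z y (1 - t))"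
    by (intro d0_cong gp_swap assms)
  also have "\<dots> \<le> (1 - t) * d x y"
    using assms by (intro gp_near_left) auto
  finally show ?thesis .
qed

lemma gp_convex:
  assumes "0 \<le> t" "t \<le> 1"
  shows "d (gp x y t) (gp x' y' t) \<le> (1 - t) * d x x' + t * d y y'"
  using gp_near_left [OF assms, of x y y'] gp_near_right [OF assms, of x y' x']
    tri [of "gp x y t" "gp x' y' t" "gp x y' t"] by linarith

lemma gp_same: "0 \<le> t \<Longrightarrow> t \<le> 1 \<Longrightarrow> d (gp z z t) z = 0"
  using gp_left [of t z z] sym by simp

lemma gp_convex_point:
  assumes "0 \<le> t" "t \<le> 1"
  shows "d z (gp x y t) \<le> (1 - t) * d z x + t * d z y"
  using gp_convex [OF assms, of z z x y] d0_left [OF gp_same [OF assms, of z]] by simp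

section \<open>Points on geodesics and their distance from the initial point\<close>

definition btw :: "'a \<Rightarrow> 'a \<Rightarrow> 'a \<Rightarrow> bool" where
  "btw x w y \<longleftrightarrow> d x w + d w y = d x y"

lemma btw_sym: "btw x w y \<longleftrightarrow> btw y w x"
  unfolding btw_def using sym by (auto simp: add.commute)

lemma btw_gp: "0 \<le> t \<Longrightarrow> t \<le> 1 \<Longrightarrow> btw x (gp x y t) y"
  by (simp add: btw_def gp_left gp_right algebra_simps)

lemma btw_gpE:
  assumes "btw x w y"
  obtains t where "0 \<le> t" "t \<le> 1" "d w (gp x y t) = 0"
proof (cases "d x y = 0")
  case True
  then have "d x w = 0"
    using assms nonneg [of w y] nonneg [of x w] unfolding btw_def by linarith
  then have "d w (gp x y 0) = 0"
    using gp_0 [of x y] by (smt (verit) tri sym nonneg)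
  then show ?thesis
    using that [of 0] by simp
next
  case False
  let ?t = "d x w / d x y"
  have pos: "d x y > 0"
    using False nonneg [of x y] by linarith
  have "d x w \<le> d x y"
    using assms nonneg [of w y] unfolding btw_def by linarith
  then have t: "0 \<le> ?t" "?t \<le> 1"
    using pos by auto
  have "d w (gp x y ?t) = 0"
    using t assms pos unfolding btw_def
    by (intro gp_unique) (auto simp: left_diff_distrib)
  then show ?thesis
    using that t by blast
qed

lemma btw_convex:
  assumes "btw x w y" and f: "d z x \<le> B" "d z y \<le> B"
  shows "d z w \<le> B"
proof -
  obtain t where t: "0 \<le> t" "t \<le> 1" "d w (gp x y t) = 0"
    using btw_gpE [OF assms(1)] .
  have "d z w \<le> (1 - t) * d z x + t * d z y"
    using gp_convex_point [OF t(1,2), of z x y] d0_right [OF t(3), of z] by simp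
  also have "\<dots> \<le> (1 - t) * B + t * B"
    using t f by (intro add_mono mult_left_mono) auto
  finally show ?thesis
    by (simp add: algebra_simps)
qed

text \<open>Dividing the new segment in the same ratio moves the point no more than the end was
  moved. Changes of base point rest on this.\<close>

lemma btw_near:
  assumes "btw x w y"
  obtains w' where "btw x w' y'" "d w w' \<le> d y y'"
proof -
  obtain t where t: "0 \<le> t" "t \<le> 1" "d w (gp x y t) = 0"
    using btw_gpE [OF assms(1)] .
  have "d w (gp x y' t) \<le> t * d y y'"
    using gp_near_left [OF t(1,2), of x y y'] d0_left [OF t(3)] by simp
  also have "\<dots> \<le> d y y'"
    using t mult_right_mono [of t 1 "d y y'"] by simp
  finally show ?thesis
    using that btw_gp [OF t(1,2)] by blast
qed

text \<open>Beyond the end the value is \<open>y\<close>, which makes the function total, with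
  distance \<open>min s (d x y)\<close> from \<open>x\<close>.\<close>

definition pt :: "'a \<Rightarrow> 'a \<Rightarrow> real \<Rightarrow> 'a" where
  "pt x y s = (if s < d x y then gp x y (s / d x y) else y)"

lemma dist_pt: assumes "0 \<le> s"
  shows "d x (pt x y s) = min s (d x y)" and "d (pt x y s) y = d x y - min s (d x y)"
  using assms nonneg [of x y] by (auto simp: pt_def gp_left gp_right field_simps)

lemma btw_pt: "0 \<le> s \<Longrightarrow> btw x (pt x y s) y"
  by (simp add: btw_def dist_pt)

lemma pt_unique:
  assumes "0 \<le> s" "s \<le> d x y" "d x w \<le> s" "d w y \<le> d x y - s"
  shows "d w (pt x y s) = 0"
proof (cases "s < d x y")
  case True
  moreover have "d w (gp x y (s / d x y)) = 0"
    using assms True by (intro gp_unique) (auto simp: diff_divide_distrib left_diff_distrib)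
  ultimately show ?thesis
    by (simp add: pt_def)
next
  case False
  then show ?thesis
    using assms nonneg [of w y] by (simp add: pt_def)
qed

lemma pt_cong:
  assumes "d x x' = 0" "d y y' = 0" "0 \<le> s"
  shows "d (pt x y s) (pt x' y' s) = 0"
proof (cases "s \<le> d x y")
  case True
  have eq: "d x' y' = d x y"
    by (rule d0_cong [OF assms(1,2), symmetric])
  have "d x' (pt x y s) = s" "d (pt x y s) y' = d x y - s"
    using True assms(3) dist_pt [of s x y] d0_left [OF assms(1), of "pt x y s"]
      d0_right [OF assms(2), of "pt x y s"] by simp_all
  then show ?thesis
    using True assms(3) eq by (intro pt_unique) simp_all
next
  case False
  have "d x' y' = d x y"
    by (rule d0_cong [OF assms(1,2), symmetric])
  then show ?thesis
    using assms(2) False by (simp add: pt_def)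
qed

lemma pt_btw:
  assumes "btw x w y" "0 \<le> s" "s \<le> d x w"
  shows "d (pt x w s) (pt x y s) = 0"
proof (rule pt_unique)
  show "s \<le> d x y"
    using assms nonneg [of w y] unfolding btw_def by linarith
  show "d x (pt x w s) \<le> s"
    using assms by (simp add: dist_pt)
  show "d (pt x w s) y \<le> d x y - s"
    using assms tri [of "pt x w s" y w] dist_pt [of s x w] unfolding btw_def by auto
qed fact

lemma pt_contract_end:
  assumes "0 \<le> s" "s \<le> m" "0 < m" "d x y = m" "d x z = m"
  shows "d (pt x y s) (pt x z s) \<le> s / m * d y z"
proof (cases "s < m")
  case True
  then show ?thesis
    using assms gp_near_left [of "s / m" x y z] by (simp add: pt_def)
next
  case False
  then show ?thesis
    using assms by (simp add: pt_def)
qed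

text \<open>Cut both geodesics at distance \<open>m\<close>: they then have equal length, and the
  points at distance \<open>s\<close> divide them in the same ratio \<open>s / m\<close>.\<close>

lemma pt_contract:
  assumes "0 \<le> s" "s \<le> m" "0 < m" "m \<le> d x y" "m \<le> d x z"
  shows "d (pt x y s) (pt x z s) \<le> s / m * d (pt x y m) (pt x z m)"
proof -
  have m: "d x (pt x y m) = m" "d x (pt x z m) = m"
    using assms by (auto simp: dist_pt)
  have "d (pt x (pt x y m) s) (pt x y s) = 0" "d (pt x (pt x z m) s) (pt x z s) = 0"
    using assms m by (auto intro!: pt_btw btw_pt)
  then have "d (pt x y s) (pt x z s) = d (pt x (pt x y m) s) (pt x (pt x z m) s)"
    by (rule d0_cong [symmetric])
  also have "\<dots> \<le> s / m * d (pt x y m) (pt x z m)"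
    using assms m by (intro pt_contract_end) auto
  finally show ?thesis .
qed

text \<open>When the shorter geodesic ends, the two are at most \<open>2 * C\<close> apart:
  \<open>C\<close> for the distance of the ends and \<open>C\<close> for the difference of the
  lengths. Contraction towards \<open>x\<close> does the rest.\<close>

lemma pt_fellow:
  assumes "0 \<le> s" "d y w \<le> C" "s \<le> d x y - C" "C < d x y"
  shows "d (pt x y s) (pt x w s) \<le> 2 * C * s / (d x y - C)"
proof -
  let ?m = "min (d x y) (d x w)"
  have C: "0 \<le> C"
    using assms(2) nonneg [of y w] by linarith
  have w: "\<bar>d x y - d x w\<bar> \<le> C"
    using tri [of x y w] tri [of x w y] assms(2) sym by simp
  have m: "0 < ?m" "d x y - C \<le> ?m"
    using assms w by auto
  have "d (pt x y ?m) (pt x w ?m) \<le> 2 * C"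
  proof -
    have "d (pt x y ?m) y = d x y - ?m" "d (pt x w ?m) w = d x w - ?m"
      using m by (auto simp: dist_pt)
    then have "d (pt x y ?m) (pt x w ?m) \<le> (d x y - ?m) + d y w + (d x w - ?m)"
      using tri [of "pt x y ?m" "pt x w ?m" y] tri [of y "pt x w ?m" w] sym [of w "pt x w ?m"] by linarith
    then show ?thesis
      using w assms(2) by (auto simp: min_def split: if_splits)
  qed
  then have "s / ?m * d (pt x y ?m) (pt x w ?m) \<le> s / ?m * (2 * C)"
    using m assms by (intro mult_left_mono) auto
  moreover have "d (pt x y s) (pt x w s) \<le> s / ?m * d (pt x y ?m) (pt x w ?m)"
    using assms m by (intro pt_contract) auto
  ultimately have "d (pt x y s) (pt x w s) \<le> s / ?m * (2 * C)"
    by linarith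
  also have "\<dots> \<le> s / (d x y - C) * (2 * C)"
    using m assms C by (intro mult_right_mono divide_left_mono) auto
  finally show ?thesis
    by (simp add: mult.commute)
qed

lemma dist_pt_pt:
  assumes "0 \<le> s" "s \<le> d x y" "0 \<le> t" "t \<le> d x y"
  shows "d (pt x y s) (pt x y t) = \<bar>s - t\<bar>"
proof -
  have *: "d (pt x y a) (pt x y b) = b - a" if "0 \<le> a" "a \<le> b" "b \<le> d x y" for a b
  proof -
    have b: "d x (pt x y b) = b"
      using that by (simp add: dist_pt)
    have "d (pt x (pt x y b) a) (pt x y a) = 0"
      using that b by (intro pt_btw btw_pt) auto
    then have "d (pt x y a) (pt x y b) = d (pt x (pt x y b) a) (pt x y b)"
      by (rule d0_left [symmetric])
    then show ?thesis
      using that b by (simp add: dist_pt)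
  qed
  show ?thesis
    using *[of s t] *[of t s] assms sym [of "pt x y s" "pt x y t"] by linarith
qed

lemma abs_dist_diff: "\<bar>d x z - d y z\<bar> \<le> d x y"
  using tri [of x z y] tri [of y z x] sym [of x y] by linarith

lemma tendsto_dist:
  assumes "((\<lambda>n. d (s n) l) \<longlongrightarrow> 0) F" "((\<lambda>n. d (s' n) l') \<longlongrightarrow> 0) F"
  shows "((\<lambda>n. d (s n) (s' n)) \<longlongrightarrow> d l l') F"
proof -
  have "((\<lambda>n. d (s n) l + d (s' n) l') \<longlongrightarrow> 0) F"
    using tendsto_add [OF assms] by simp
  then have "((\<lambda>n. d (s n) (s' n) - d l l') \<longlongrightarrow> 0) F"
  proof (rule Lim_null_comparison [rotated])
    show "\<forall>\<^sub>F n in F. norm (d (s n) (s' n) - d l l') \<le> d (s n) l + d (s' n) l'"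
    proof (rule always_eventually, intro allI)
      fix n
      show "norm (d (s n) (s' n) - d l l') \<le> d (s n) l + d (s' n) l'"
        using abs_dist_diff [of "s n" "s' n" l] abs_dist_diff [of "s' n" l l']
          sym [of l "s' n"] sym [of l' l]
        unfolding real_norm_def by linarith
    qed
  qed
  then show ?thesis
    by (simp add: LIM_zero_iff)
qed

lemma tendsto_dist_const:
  assumes "((\<lambda>n. d (s n) l) \<longlongrightarrow> 0) F"
  shows "((\<lambda>n. d (s n) z) \<longlongrightarrow> d l z) F" "((\<lambda>n. d z (s n)) \<longlongrightarrow> d z l) F"
  using tendsto_dist [OF assms, of "\<lambda>_. z" z] tendsto_dist [OF _ assms, of "\<lambda>_. z" z] by simp_all

section \<open>Rays and neighbourhoods of their endpoints\<close>

definition ray :: "(real \<Rightarrow> 'a) \<Rightarrow> bool" where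
  "ray c \<longleftrightarrow> (\<forall>s\<ge>0. \<forall>t\<ge>0. d (c s) (c t) = \<bar>s - t\<bar>)"

definition line :: "(real \<Rightarrow> 'a) \<Rightarrow> bool" where
  "line c \<longleftrightarrow> (\<forall>s t. d (c s) (c t) = \<bar>s - t\<bar>)"

definition asym :: "(real \<Rightarrow> 'a) \<Rightarrow> (real \<Rightarrow> 'a) \<Rightarrow> bool" where
  "asym c c' \<longleftrightarrow> (\<exists>K. \<forall>t\<ge>0. d (c t) (c' t) \<le> K)"

text \<open>The points of the space in the cone neighbourhood U(c, T, 1), with a weak inequality for
  the length. The radius can stay fixed at 1: by contraction, a larger \<open>T\<close> means a
  smaller radius at any given earlier time.\<close>

definition N :: "(real \<Rightarrow> 'a) \<Rightarrow> real \<Rightarrow> 'a set" where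
  "N c T = {y. T \<le> d (c 0) y \<and> d (pt (c 0) y T) (c T) < 1}"

text \<open>Convergence to the boundary point of \<open>c\<close> is convergence to this filter. A
  boundary point given by a ray \<open>e\<close> counts as near that of \<open>c\<close> when
  \<open>nb e\<close> eventually lies in \<open>N c T\<close>.\<close>

definition nb :: "(real \<Rightarrow> 'a) \<Rightarrow> 'a filter" where
  "nb c = (INF T\<in>{0<..}. principal (N c T))"

lemma line_ray: "line c \<Longrightarrow> ray c" and line_reverse: "line c \<Longrightarrow> line (\<lambda>t. c (- t))"
  by (auto simp: line_def ray_def)

lemma rayD: "ray c \<Longrightarrow> 0 \<le> s \<Longrightarrow> 0 \<le> t \<Longrightarrow> d (c s) (c t) = \<bar>s - t\<bar>"
  by (simp add: ray_def)

lemma lineD: "line c \<Longrightarrow> d (c s) (c t) = \<bar>s - t\<bar>"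
  by (simp add: line_def)

lemma asym_refl: "asym c c"
  unfolding asym_def by auto

lemma asym_sym: "asym c c' \<Longrightarrow> asym c' c"
  unfolding asym_def using sym by simp

lemma asym_trans: assumes "asym a b" "asym b c" shows "asym a c"
proof -
  obtain K L where "\<forall>t\<ge>0. d (a t) (b t) \<le> K" "\<forall>t\<ge>0. d (b t) (c t) \<le> L"
    using assms unfolding asym_def by blast
  then have "\<forall>t\<ge>0. d (a t) (c t) \<le> K + L"
    using tri by (meson add_mono order_trans)
  then show ?thesis
    unfolding asym_def by blast
qed

lemma ray_pt:
  assumes "ray c" "0 \<le> s" "s \<le> T"
  shows "d (pt (c 0) (c T) s) (c s) = 0"
proof -
  have "d (c s) (pt (c 0) (c T) s) = 0"
    using assms by (intro pt_unique) (auto simp: rayD)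
  then show ?thesis
    by (simp add: sym)
qed

lemma ray_contract:
  assumes "ray c" "0 \<le> T" "T \<le> S" "0 < S" "S \<le> d (c 0) y"
  shows "d (pt (c 0) y T) (c T) \<le> T / S * d (pt (c 0) y S) (c S)"
proof -
  have "d (pt (c 0) y T) (pt (c 0) (c S) T) \<le> T / S * d (pt (c 0) y S) (pt (c 0) (c S) S)"
    using assms by (intro pt_contract) (auto simp: rayD)
  then show ?thesis
    using d0_right [OF ray_pt [OF assms(1), of T S], of "pt (c 0) y T"]
      d0_right [OF ray_pt [OF assms(1), of S S], of "pt (c 0) y S"] assms by simp
qed

lemma rays_contract:
  assumes "ray c" "ray e" "d (c 0) (e 0) = 0" "0 \<le> T" "T \<le> S" "0 < S"
  shows "d (e T) (c T) \<le> T / S * d (e S) (c S)"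
proof -
  have eS: "d (pt (c 0) (e S) s) (e s) = 0" if "0 \<le> s" "s \<le> S" for s
    using ray_pt [OF assms(2) that] pt_cong [OF assms(3), of "e S" "e S" s] that
      d0_left [of "pt (c 0) (e S) s" "pt (e 0) (e S) s" "e s"] by simp
  have "d (c 0) (e S) = S"
    using assms d0_left [OF assms(3), of "e S"] rayD [of e 0 S] by linarith
  then have "d (pt (c 0) (e S) T) (c T) \<le> T / S * d (pt (c 0) (e S) S) (c S)"
    using assms by (intro ray_contract) auto
  then show ?thesis
    using d0_left [OF eS [of T], of "c T"] d0_left [OF eS [of S], of "c S"] assms by simp
qed

lemma N_mono:
  assumes "ray c" "0 < T" "T \<le> S"
  shows "N c S \<subseteq> N c T"
proof
  fix y assume y: "y \<in> N c S"
  have "d (pt (c 0) y T) (c T) \<le> T / S * d (pt (c 0) y S) (c S)"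
    using assms y by (intro ray_contract) (auto simp: N_def)
  also have "\<dots> \<le> 1 * d (pt (c 0) y S) (c S)"
    using assms by (intro mult_right_mono) auto
  also have "\<dots> < 1"
    using y by (simp add: N_def)
  finally show "y \<in> N c T"
    using y assms by (simp add: N_def)
qed

lemma eventually_nb:
  assumes "ray c"
  shows "eventually P (nb c) \<longleftrightarrow> (\<exists>T>0. \<forall>y\<in>N c T. P y)"
  unfolding nb_def
proof (subst eventually_INF_base)
  show "\<exists>x\<in>{0<..}. principal (N c x) \<le> inf (principal (N c a)) (principal (N c b))"
    if "a \<in> {0<..}" "b \<in> {0<..}" for a b :: real
    using that N_mono [OF assms, of a "max a b"] N_mono [OF assms, of b "max a b"]
    by (intro bexI [of _ "max a b"]) auto
qed (auto simp: eventually_principal)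

lemma eventually_N: "ray c \<Longrightarrow> 0 < T \<Longrightarrow> eventually (\<lambda>y. y \<in> N c T) (nb c)"
  by (auto simp: eventually_nb)

lemma N_btw:
  assumes "w \<in> N c T" "btw (c 0) w y" "0 \<le> T"
  shows "y \<in> N c T"
proof -
  have "T \<le> d (c 0) y"
    using assms nonneg [of w y] unfolding btw_def N_def mem_Collect_eq by linarith
  moreover have "d (pt (c 0) w T) (pt (c 0) y T) = 0"
    using assms by (intro pt_btw) (auto simp: N_def)
  ultimately show ?thesis
    using assms d0_left [of "pt (c 0) w T" "pt (c 0) y T" "c T"] by (simp add: N_def)
qed

text \<open>The usual way to recognise a point of \<open>N c T\<close>: its geodesic from
  \<open>c 0\<close> passes within \<open>C\<close> of a late point \<open>c S\<close>. The bound on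
  \<open>S\<close> makes the error \<open>2 * C * T / (S - C)\<close> of \<open>pt_fellow\<close>
  less than 1 and leaves \<open>w\<close> at distance at least \<open>T\<close>.\<close>

lemma N_intro:
  assumes c: "ray c" and w: "btw (c 0) w y" "d w (c S) \<le> C" and T: "0 < T" "T + C + 2 * C * T < S"
  shows "y \<in> N c T"
proof -
  have C: "0 \<le> C"
    using w(2) nonneg [of w "c S"] by linarith
  then have "0 \<le> 2 * C * T"
    using T by simp
  then have S: "0 \<le> S" "T \<le> S" "T \<le> S - C" "C < S" "2 * C * T < S - C"
    using T C by linarith+
  have cS: "d (c 0) (c S) = S"
    using rayD [OF c _ S(1), of 0] S(1) by simp
  have "d (pt (c 0) (c S) T) (pt (c 0) w T) \<le> 2 * C * T / (d (c 0) (c S) - C)"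
    by (rule pt_fellow) (use T(1) S w(2) cS sym [of w "c S"] in linarith)+
  also have "\<dots> < 1"
    using S unfolding cS by simp
  also have "d (pt (c 0) (c S) T) (pt (c 0) w T) = d (c T) (pt (c 0) w T)"
    using T S by (intro d0_left ray_pt c) linarith+
  finally have "d (pt (c 0) w T) (c T) < 1"
    using sym [of "c T" "pt (c 0) w T"] by linarith
  moreover have "T \<le> d (c 0) w"
    using tri [of "c 0" "c S" w] cS S w(2) by linarith
  ultimately have "w \<in> N c T"
    unfolding N_def by blast
  then show ?thesis
    using T(1) w(1) N_btw [of w c T y] by simp
qed

lemma N_base_change:
  assumes c: "ray c" "ray c'" "\<And>t. 0 \<le> t \<Longrightarrow> d (c t) (c' t) \<le> K"
    and T: "0 < T" "T + (2 * K + 1) + 2 * (2 * K + 1) * T < S"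
  shows "N c S \<subseteq> N c' T"
proof
  fix y assume y: "y \<in> N c S"
  have "0 \<le> K"
    using c(3) [of 0] nonneg [of "c 0" "c' 0"] by linarith
  then have S: "0 \<le> S"
    using T by (smt (verit) mult_nonneg_nonneg)
  have "btw y (pt (c 0) y S) (c 0)"
    using btw_pt [OF S, of "c 0" y] by (simp add: btw_sym)
  then obtain w where w: "btw y w (c' 0)" "d (pt (c 0) y S) w \<le> d (c 0) (c' 0)"
    using btw_near by blast
  \<comment> \<open>\<open>K\<close> for moving the base point, 1 for the radius of
    \<open>N c S\<close>, and \<open>K\<close> for the distance of the two rays at time
    \<open>S\<close>.\<close>
  have "d w (c' S) \<le> 2 * K + 1"
    using w(2) c(3) [of 0] c(3) [OF S] y tri [of w "c' S" "pt (c 0) y S"]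
      tri [of "pt (c 0) y S" "c' S" "c S"] sym [of w "pt (c 0) y S"]
    unfolding N_def mem_Collect_eq by linarith
  then show "y \<in> N c' T"
    using w(1) c T by (intro N_intro [where w = w and S = S and C = "2 * K + 1"]) (simp_all add: btw_sym)
qed

lemma nb_cong:
  assumes "ray c" "ray c'" "asym c c'"
  shows "nb c = nb c'"
proof -
  have le: "nb a \<le> nb b" if ab: "ray a" "ray b" "asym a b" for a b
  proof (rule filter_leI)
    fix P assume "eventually P (nb b)"
    then obtain T where T: "T > 0" "\<forall>y\<in>N b T. P y"
      using eventually_nb ab by blast
    obtain K where K: "\<forall>t\<ge>0. d (a t) (b t) \<le> K"
      using ab unfolding asym_def by blast
    then have "0 \<le> K"
      using nonneg [of "a 0" "b 0"] by (meson order.trans order_refl)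
    define S where "S = T + (2 * K + 1) + 2 * (2 * K + 1) * T + 1"
    have "N a S \<subseteq> N b T"
      using ab K T by (intro N_base_change [where K = K]) (auto simp: S_def)
    moreover have "S > 0"
      using \<open>0 \<le> K\<close> T by (simp add: S_def add_pos_nonneg)
    ultimately show "eventually P (nb a)"
      using T eventually_nb ab by blast
  qed
  show ?thesis
    using le [of c c'] le [of c' c] assms asym_sym by (intro antisym) auto
qed

lemma N_perturb:
  assumes c: "ray c" and y: "y \<in> N c S" "d y y' \<le> K"
    and T: "0 < T" "T + (K + 1) + 2 * (K + 1) * T < S"
  shows "y' \<in> N c T"
proof -
  have "0 \<le> K"
    using y nonneg [of y y'] by linarith
  then have S: "0 \<le> S"
    using T by (smt (verit) mult_nonneg_nonneg)
  obtain w where w: "btw (c 0) w y'" "d (pt (c 0) y S) w \<le> d y y'"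
    using btw_near [OF btw_pt [OF S]] by blast
  have "d w (c S) \<le> K + 1"
    using w(2) y tri [of w "c S" "pt (c 0) y S"] sym [of w "pt (c 0) y S"]
    unfolding N_def mem_Collect_eq by linarith
  then show ?thesis
    using w(1) c T by (intro N_intro [where w = w and S = S and C = "K + 1"]) simp_all
qed

text \<open>Bounded changes vanish at infinity: in \<open>N_perturb\<close> the loss from
  \<open>S\<close> to \<open>T\<close> depends on \<open>K\<close> and \<open>T\<close>
  only.\<close>

lemma filterlim_nb_perturb:
  assumes c: "ray c" and Y: "filterlim Y (nb c) F" and K: "\<And>n. d (Y n) (Y' n) \<le> K"
  shows "filterlim Y' (nb c) F"
  unfolding filterlim_iff
proof (intro allI impI)
  fix P assume "eventually P (nb c)"
  then obtain T where T: "T > 0" "\<forall>y\<in>N c T. P y"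
    using eventually_nb c by blast
  have "0 \<le> K"
    using K nonneg order.trans by blast
  define S where "S = T + (K + 1) + 2 * (K + 1) * T + 1"
  have "S > 0"
    using \<open>0 \<le> K\<close> T by (simp add: S_def add_pos_nonneg)
  then have "eventually (\<lambda>n. Y n \<in> N c S) F"
    using Y eventually_N [OF c] unfolding filterlim_iff by blast
  then show "eventually (\<lambda>n. P (Y' n)) F"
  proof eventually_elim
    case (elim n)
    have "Y' n \<in> N c T"
      using c elim K [of n] T(1) by (rule N_perturb) (simp add: S_def)
    then show ?case
      using T by blast
  qed
qed

lemma ray_in_N: "ray c \<Longrightarrow> 0 < T \<Longrightarrow> T \<le> t \<Longrightarrow> c t \<in> N c T"
  by (simp add: N_def ray_pt rayD)

lemma filterlim_ray: assumes "ray c" shows "filterlim c (nb c) at_top"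
  unfolding filterlim_iff
proof (intro allI impI)
  fix P assume "eventually P (nb c)"
  then obtain T where T: "T > 0" "\<forall>y\<in>N c T. P y"
    using eventually_nb assms by blast
  have "P (c t)" if "t \<ge> T" for t
    using T ray_in_N [OF assms _ that] by blast
  then show "eventually (\<lambda>t. P (c t)) at_top"
    using eventually_at_top_linorder by blast
qed

lemma filterlim_ray_nat: "ray c \<Longrightarrow> filterlim (\<lambda>n. c (real n)) (nb c) sequentially"
  by (rule filterlim_compose [OF filterlim_ray filterlim_real_sequentially])

lemma nb_nontrivial: assumes "ray c" shows "nb c \<noteq> bot"
proof
  assume "nb c = bot"
  then have "eventually (\<lambda>y. False) (nb c)"
    by simp
  with filterlim_ray [OF assms] have "eventually (\<lambda>t. False) (at_top :: real filter)"
    unfolding filterlim_iff by blast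
  then show False
    using eventually_happens' [OF trivial_limit_at_top_linorder] by blast
qed

lemma nearI:
  assumes "ray c" "ray e" "d (c 0) (e 0) = 0" "0 < T" "d (c T) (e T) < 1"
  shows "eventually (\<lambda>y. y \<in> N c T) (nb e)"
proof -
  \<comment> \<open>The strict inequality leaves the slack \<open>1 - d (c T) (e T)\<close>;
    contraction from \<open>S\<close> to \<open>T\<close> reduces the radius 1 to less than this
    slack.\<close>
  define S where "S = T + T / (1 - d (c T) (e T)) + 1"
  have TS: "T < S" "T / (1 - d (c T) (e T)) < S"
    using assms by (auto simp: S_def add_pos_nonneg)
  have S: "0 < S" "T \<le> S"
    using TS assms by auto
  have "T / S < 1 - d (c T) (e T)"
    using TS S assms by (simp add: field_simps)
  moreover have "y \<in> N c T" if y: "y \<in> N e S" for y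
  proof -
    have "d (pt (e 0) y T) (e T) \<le> T / S * d (pt (e 0) y S) (e S)"
      using S y assms by (intro ray_contract) (auto simp: N_def)
    also have "\<dots> \<le> T / S * 1"
      using S y assms by (intro mult_left_mono) (auto simp: N_def)
    finally have "d (pt (e 0) y T) (c T) < 1"
      using \<open>T / S < 1 - d (c T) (e T)\<close> tri [of "pt (e 0) y T" "c T" "e T"] sym [of "c T" "e T"] by simp
    moreover have "d (pt (e 0) y T) (pt (c 0) y T) = 0"
      using assms sym [of "c 0" "e 0"] by (intro pt_cong) auto
    ultimately show ?thesis
      using y S d0_left [OF assms(3), of y] d0_left [of "pt (e 0) y T" "pt (c 0) y T" "c T"]
      by (simp add: N_def)
  qed
  ultimately show ?thesis
    using eventually_nb [OF assms(2)] S by blast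
qed

text \<open>A late point \<open>e t\<close> of the ray itself is the witness: its geodesic from the
  base point is at \<open>e T\<close> at time \<open>T\<close>.\<close>

lemma nearD:
  assumes "ray c" "ray e" "d (c 0) (e 0) = 0" "0 < T" and ev: "eventually (\<lambda>y. y \<in> N c T) (nb e)"
  shows "d (c T) (e T) < 1"
proof -
  have "eventually (\<lambda>t. e t \<in> N c T) at_top"
    using filterlim_ray [OF assms(2)] ev unfolding filterlim_iff by blast
  then have "eventually (\<lambda>t. e t \<in> N c T \<and> t \<ge> T) at_top"
    using eventually_ge_at_top eventually_conj by blast
  then obtain t where t: "e t \<in> N c T" "t \<ge> T"
    using eventually_happens'[OF trivial_limit_at_top_linorder] by blast
  have "d (pt (e 0) (e t) T) (e T) = 0" "d (pt (e 0) (e t) T) (pt (c 0) (e t) T) = 0"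
    using assms t sym [of "c 0" "e 0"] by (auto intro!: ray_pt pt_cong)
  then have "d (pt (c 0) (e t) T) (e T) = 0"
    using d0_left [of "pt (e 0) (e t) T" "pt (c 0) (e t) T" "e T"] by simp
  then have "d (e T) (c T) = d (pt (c 0) (e t) T) (c T)"
    by (rule d0_left [symmetric])
  then show ?thesis
    using t sym [of "c T" "e T"] unfolding N_def by simp
qed

lemma limit_ray:
  assumes far: "filterlim (\<lambda>n. d p (Z n)) at_top sequentially"
    and lim: "\<And>s. 0 \<le> s \<Longrightarrow> \<exists>l. (\<lambda>n. d (pt p (Z n) s) l) \<longlonglongrightarrow> 0"
  obtains c where "ray c" "c 0 = p" "\<And>s. 0 \<le> s \<Longrightarrow> (\<lambda>n. d (pt p (Z n) s) (c s)) \<longlonglongrightarrow> 0"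
proof -
  \<comment> \<open>At \<open>s = 0\<close> the limit is chosen to be \<open>p\<close> itself, so
    that the ray starts at \<open>p\<close> exactly and not only at distance 0.\<close>
  have lim': "\<exists>l. (\<lambda>n. d (pt p (Z n) s) l) \<longlonglongrightarrow> 0 \<and> (s = 0 \<longrightarrow> l = p)" if s: "0 \<le> s" for s
  proof (cases "s = 0")
    case True
    have "d (pt p (Z n) 0) p = 0" for n
      using dist_pt [of 0 p "Z n"] sym [of p "pt p (Z n) 0"] by simp
    then show ?thesis
      using True by auto
  qed (use lim [OF s] in auto)
  define c where "c s = (SOME l. (\<lambda>n. d (pt p (Z n) s) l) \<longlonglongrightarrow> 0 \<and> (s = 0 \<longrightarrow> l = p))" for s
  have c: "(\<lambda>n. d (pt p (Z n) s) (c s)) \<longlonglongrightarrow> 0" "s = 0 \<longrightarrow> c s = p" if "0 \<le> s" for s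
    using someI_ex [OF lim' [OF that]] unfolding c_def by blast+
  have "ray c"
    unfolding ray_def
  proof (intro allI impI)
    fix s t :: real assume st: "0 \<le> s" "0 \<le> t"
    have "eventually (\<lambda>n. max s t \<le> d p (Z n)) sequentially"
      using far unfolding filterlim_at_top by blast
    then have "eventually (\<lambda>n. d (pt p (Z n) s) (pt p (Z n) t) = \<bar>s - t\<bar>) sequentially"
      by eventually_elim (auto intro!: dist_pt_pt simp: st)
    then have "(\<lambda>n. d (pt p (Z n) s) (pt p (Z n) t)) \<longlonglongrightarrow> \<bar>s - t\<bar>"
      by (rule tendsto_eventually)
    with tendsto_dist [OF c(1) [OF st(1)] c(1) [OF st(2)]]
    show "d (c s) (c t) = \<bar>s - t\<bar>"
      using LIMSEQ_unique by blast
  qed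
  then show ?thesis
    using that c c(2) [of 0] by blast
qed

text \<open>The geodesics from \<open>p\<close> to \<open>c n\<close> converge: for
  \<open>n \<le> m\<close> the point \<open>c n\<close> lies on the geodesic from \<open>c m\<close>
  to \<open>c 0\<close>, hence within \<open>d p (c 0)\<close> of the one from \<open>c m\<close> to
  \<open>p\<close>, and at a fixed time the effect of this bounded error tends to 0.\<close>

lemma ray_from:
  assumes c: "ray c"
  obtains c' where "ray c'" "c' 0 = p" "asym c c'"
proof -
  define D where "D = d p (c 0)"
  have D: "0 \<le> D"
    by (simp add: D_def)
  have far: "d p (c t) \<ge> t - D" if "0 \<le> t" for t
    using tri [of "c 0" "c t" p] rayD [OF c, of 0 t] that sym [of p "c 0"] by (simp add: D_def)
  have close: "d (pt p (c n) s) (pt p (c m) s) \<le> 2 * D * s / (n - 2 * D)"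
    if s: "0 \<le> s" "s \<le> n - 2 * D" "2 * D < n" "n \<le> m" for s n m
  proof -
    have "btw (c m) (c n) (c 0)"
      using rayD [OF c] s D by (simp add: btw_def)
    then obtain w where w: "btw (c m) w p" "d (c n) w \<le> D"
      using btw_near [of "c m" "c n" "c 0" p] sym [of p] unfolding D_def by metis
    have n: "d p (c n) \<ge> n - D"
      using far s D by simp
    have "d (pt p (c n) s) (pt p w s) \<le> 2 * D * s / (d p (c n) - D)"
      using s n w D by (intro pt_fellow) auto
    also have "\<dots> \<le> 2 * D * s / (n - 2 * D)"
      using s n D by (intro divide_left_mono mult_nonneg_nonneg mult_pos_pos) auto
    also have "d (pt p (c n) s) (pt p w s) = d (pt p (c n) s) (pt p (c m) s)"
      using w s n tri [of p "c n" w] sym [of w "c n"] by (intro d0_right pt_btw) (auto simp: btw_sym)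
    finally show ?thesis .
  qed
  have lim: "\<exists>l. (\<lambda>n. d (pt p (c (real n)) s) l) \<longlonglongrightarrow> 0" if s: "0 \<le> s" for s
  proof (rule complete)
    fix e :: real assume e: "e > 0"
    define M where "M = nat \<lceil>2 * D + s + 2 * D * s / e + 1\<rceil>"
    have M: "real M \<ge> 2 * D + s + 2 * D * s / e + 1"
      unfolding M_def by linarith
    have q: "0 \<le> 2 * D * s / e"
      using D s e by simp
    have main: "d (pt p (c (real n)) s) (pt p (c (real m)) s) < e" if nm: "M \<le> n" "n \<le> m" for n m
    proof -
      have n: "real n - 2 * D > 2 * D * s / e + s"
        using M nm(1) by linarith
      have "d (pt p (c (real n)) s) (pt p (c (real m)) s) \<le> 2 * D * s / (real n - 2 * D)"
        using n q s D nm by (intro close) auto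
      also have "\<dots> < e"
      proof -
        have "2 * D * s / e < real n - 2 * D"
          using n s by linarith
        then have "2 * D * s < e * (real n - 2 * D)"
          using e by (simp add: field_simps)
        moreover have "0 < real n - 2 * D"
          using n q s by linarith
        ultimately show ?thesis
          by (simp add: field_simps)
      qed
      finally show ?thesis .
    qed
    show "\<exists>M. \<forall>m\<ge>M. \<forall>n\<ge>M. d (pt p (c (real m)) s) (pt p (c (real n)) s) < e"
    proof (intro exI allI impI)
      fix m n assume "M \<le> m" "M \<le> n"
      then show "d (pt p (c (real m)) s) (pt p (c (real n)) s) < e"
        using main [of m n] main [of n m] sym [of "pt p (c (real n)) s" "pt p (c (real m)) s"]
        by (cases "m \<le> n") auto
    qed
  qed
  have far_seq: "filterlim (\<lambda>n. d p (c (real n))) at_top sequentially"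
  proof (rule filterlim_at_top_mono)
    show "filterlim (\<lambda>n. - D + real n) at_top sequentially"
      by (intro filterlim_tendsto_add_at_top [OF tendsto_const] filterlim_real_sequentially)
    show "\<forall>\<^sub>F n in sequentially. - D + real n \<le> d p (c (real n))"
      using far by (intro always_eventually allI) (simp add: algebra_simps)
  qed
  obtain c' where c': "ray c'" "c' 0 = p"
      "\<And>s. 0 \<le> s \<Longrightarrow> (\<lambda>n. d (pt p (c (real n)) s) (c' s)) \<longlonglongrightarrow> 0"
    using limit_ray [OF far_seq lim] by blast
  \<comment> \<open>\<open>c s\<close> is within \<open>D\<close> of a point \<open>w\<close> of the
    geodesic from \<open>p\<close> to \<open>c n\<close>, and the distance of \<open>w\<close> from
    \<open>p\<close> differs from \<open>s\<close> by at most \<open>2 * D\<close>.\<close>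
  have "d (c s) (c' s) \<le> 3 * D" if s: "0 \<le> s" for s
  proof (rule tendsto_upperbound)
    show "(\<lambda>n. d (c s) (pt p (c (real n)) s)) \<longlonglongrightarrow> d (c s) (c' s)"
      by (rule tendsto_dist_const [OF c'(3) [OF s]])
    have "eventually (\<lambda>n. s \<le> d p (c (real n))) sequentially"
      using far_seq unfolding filterlim_at_top by blast
    moreover have "eventually (\<lambda>n. s \<le> real n) sequentially"
      using filterlim_real_sequentially unfolding filterlim_at_top by blast
    ultimately show "\<forall>\<^sub>F n in sequentially. d (c s) (pt p (c (real n)) s) \<le> 3 * D"
    proof eventually_elim
      case (elim n)
      have "btw (c (real n)) (c s) (c 0)"
        using rayD [OF c] s elim by (simp add: btw_def)
      then obtain w where w: "btw (c (real n)) w p" "d (c s) w \<le> D"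
        using btw_near [of "c (real n)" "c s" "c 0" p] sym [of p] unfolding D_def by metis
      have w2: "\<bar>d p w - s\<bar> \<le> 2 * D"
        using tri [of p w "c s"] tri [of "c 0" "c s" w] tri [of "c 0" w p] tri [of p "c s" "c 0"]
          w(2) rayD [OF c, of 0 s] s sym [of w "c s"] sym [of w p] sym [of p "c 0"]
        unfolding D_def by (simp add: abs_le_iff)
      have w3: "d p w \<le> d p (c (real n))"
        using w(1) sym [of "c (real n)" p] sym [of w p] nonneg [of "c (real n)" w]
        unfolding btw_def by linarith
      have "d w (pt p (c (real n)) (d p w)) = 0"
        using w(1) w3 sym [of "c (real n)" p] sym [of w p] sym [of w "c (real n)"]
        unfolding btw_def by (intro pt_unique) auto
      moreover have "d (pt p (c (real n)) (d p w)) (pt p (c (real n)) s) = \<bar>d p w - s\<bar>"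
        using w3 elim s by (intro dist_pt_pt) auto
      ultimately have "d w (pt p (c (real n)) s) \<le> 2 * D"
        using w2 d0_left [of w "pt p (c (real n)) (d p w)" "pt p (c (real n)) s"] by linarith
      then show ?case
        using w(2) tri [of "c s" "pt p (c (real n)) s" w] by linarith
    qed
  qed simp
  then have "asym c c'"
    unfolding asym_def by blast
  then show ?thesis
    using that c' by blast
qed

text \<open>Contraction from a late time makes the radius at time \<open>s\<close> as small as
  desired, so the single radius 1 in \<open>N\<close> captures pointwise convergence of the
  geodesics.\<close>

lemma filterlim_nb_iff:
  assumes c: "ray c"
  shows "filterlim Y (nb c) F \<longleftrightarrow> filterlim (\<lambda>n. d (c 0) (Y n)) at_top F \<and>
    (\<forall>s\<ge>0. ((\<lambda>n. d (pt (c 0) (Y n) s) (c s)) \<longlongrightarrow> 0) F)"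
proof (intro iffI conjI allI impI)
  assume Y: "filterlim Y (nb c) F"
  then have ev: "eventually (\<lambda>n. Y n \<in> N c T) F" if "T > 0" for T
    using eventually_N [OF c that] unfolding filterlim_iff by blast
  show "filterlim (\<lambda>n. d (c 0) (Y n)) at_top F"
    unfolding filterlim_at_top
  proof
    fix Z :: real
    have "eventually (\<lambda>n. Y n \<in> N c (\<bar>Z\<bar> + 1)) F"
      by (rule ev) simp
    then show "eventually (\<lambda>n. Z \<le> d (c 0) (Y n)) F"
      by eventually_elim (auto simp: N_def)
  qed
  fix s :: real assume s: "0 \<le> s"
  show "((\<lambda>n. d (pt (c 0) (Y n) s) (c s)) \<longlongrightarrow> 0) F"
  proof (rule order_tendstoI)
    fix e :: real assume "e < 0"
    then show "eventually (\<lambda>n. e < d (pt (c 0) (Y n) s) (c s)) F"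
      using nonneg by (intro always_eventually allI) (metis less_le_trans)
  next
    fix e :: real assume e: "0 < e"
    define S where "S = s + s / e + 1"
    have S: "0 < S" "s \<le> S" "s / S < e"
      using s e by (auto simp: S_def field_simps add_pos_nonneg)
    show "eventually (\<lambda>n. d (pt (c 0) (Y n) s) (c s) < e) F"
      using ev [OF S(1)]
    proof eventually_elim
      case (elim n)
      have "d (pt (c 0) (Y n) s) (c s) \<le> s / S * d (pt (c 0) (Y n) S) (c S)"
        using elim s S c by (intro ray_contract) (auto simp: N_def)
      also have "\<dots> \<le> s / S * 1"
        using elim s S by (intro mult_left_mono) (auto simp: N_def)
      finally show ?case
        using S by linarith
    qed
  qed
next
  assume Y: "filterlim (\<lambda>n. d (c 0) (Y n)) at_top F \<and>
    (\<forall>s\<ge>0. ((\<lambda>n. d (pt (c 0) (Y n) s) (c s)) \<longlongrightarrow> 0) F)"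
  show "filterlim Y (nb c) F"
    unfolding filterlim_iff
  proof (intro allI impI)
    fix P assume "eventually P (nb c)"
    then obtain T where T: "T > 0" "\<forall>y\<in>N c T. P y"
      using eventually_nb c by blast
    have "eventually (\<lambda>n. T \<le> d (c 0) (Y n)) F"
      using Y unfolding filterlim_at_top by blast
    moreover have "eventually (\<lambda>n. d (pt (c 0) (Y n) T) (c T) < 1) F"
      using Y T(1) by (intro order_tendstoD(2) [where y = 0]) auto
    ultimately show "eventually (\<lambda>n. P (Y n)) F"
      by eventually_elim (use T in \<open>auto simp: N_def\<close>)
  qed
qed

lemma asym_of_near:
  assumes "ray c" "ray e" and near: "\<And>T. T > 0 \<Longrightarrow> eventually (\<lambda>y. y \<in> N c T) (nb e)"
  shows "asym e c"
proof -
  obtain e' where e': "ray e'" "e' 0 = c 0" "asym e e'"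
    using ray_from [OF assms(2)] by blast
  have "d (c T) (e' T) < 1" if "T > 0" for T
    using near [OF that] nb_cong [OF assms(2) e'(1,3)] assms that e'
    by (intro nearD) auto
  then have "d (e' T) (c T) \<le> 1" if "T \<ge> 0" for T
    using that sym [of "e' T" "c T"] e'(2) by (cases "T = 0") (auto intro: less_imp_le)
  then have "asym e' c"
    unfolding asym_def by blast
  then show ?thesis
    using e' asym_trans by blast
qed

text \<open>Rays that are not asymptotic are somewhere more than 2 apart, which is twice the radius
  of the neighbourhoods.\<close>

lemma N_disjoint:
  assumes c: "ray c" "ray c'" "c 0 = c' 0" "\<not> asym c c'"
  obtains T where "T > 0" "N c T \<inter> N c' T = {}"
proof -
  obtain T where T: "T \<ge> 0" "d (c T) (c' T) > 2"
    using assms(4) unfolding asym_def by (meson not_le)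
  have "y \<notin> N c' T" if "y \<in> N c T" for y
    using that T(2) c(3) tri [of "c T" "c' T" "pt (c 0) y T"] sym [of "c T" "pt (c 0) y T"]
    unfolding N_def by auto
  moreover have "T \<noteq> 0"
    using T c(3) by auto
  ultimately show ?thesis
    using that [of T] T(1) by fastforce
qed

end

text \<open>Convergence is expressed by a distance \<open>f k n l\<close> tending to 0, since the
  points carry a pseudometric and no topology.\<close>

lemma diagonal_subsequence:
  fixes f :: "nat \<Rightarrow> nat \<Rightarrow> 'b \<Rightarrow> real"
  assumes sub: "\<And>k (q::nat \<Rightarrow> nat). strict_mono q \<Longrightarrow> \<exists>r l. strict_mono r \<and> (\<lambda>n. f k (q (r n)) l) \<longlonglongrightarrow> 0"
  obtains q where "strict_mono q" "\<And>k. \<exists>l. (\<lambda>n. f k (q n) l) \<longlonglongrightarrow> 0"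
proof -
  define P where "P k q \<longleftrightarrow> (\<exists>l. (\<lambda>n. f k (q n) l) \<longlonglongrightarrow> 0)" for k and q :: "nat \<Rightarrow> nat"
  interpret subseqs P
  proof
    fix k and q :: "nat \<Rightarrow> nat" assume "strict_mono q"
    then show "\<exists>r. strict_mono r \<and> P k (q \<circ> r)"
      using sub [of q k] unfolding P_def o_def by blast
  qed
  have "\<exists>l. (\<lambda>n. f k (diagseq n) l) \<longlonglongrightarrow> 0" for k
  proof -
    have "P k (diagseq \<circ> ((+) (Suc k)))"
    proof (rule diagseq_holds)
      fix r q :: "nat \<Rightarrow> nat" and k assume r: "strict_mono r" and "P k q"
      then obtain l where "(\<lambda>n. f k (q n) l) \<longlonglongrightarrow> 0"
        unfolding P_def by blast
      then have "(\<lambda>n. f k (q (r n)) l) \<longlonglongrightarrow> 0"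
        using LIMSEQ_subseq_LIMSEQ [OF _ r] unfolding o_def by blast
      then show "P k (q \<circ> r)"
        unfolding P_def o_def by blast
    qed
    then obtain l where "(\<lambda>n. f k (diagseq (n + Suc k)) l) \<longlonglongrightarrow> 0"
      unfolding P_def o_def by (auto simp: add.commute)
    then show ?thesis
      using LIMSEQ_offset [of "\<lambda>n. f k (diagseq n) l"] by blast
  qed
  then show ?thesis
    using that subseq_diagseq by blast
qed

context hadamard_pseudometric
begin

section \<open>Flat half planes and visibility\<close>

text \<open>Only an isometric parametrisation is recorded, with \<sigma> itself as boundary up to
  distance 0; closedness and convexity of the image are derived in
  \<open>half_plane_imp_bounds\<close>.\<close>

definition half_plane :: "(real \<Rightarrow> 'a) \<Rightarrow> bool" where
  "half_plane \<sigma> \<longleftrightarrow> (\<exists>F. (\<forall>v\<ge>0. \<forall>v'\<ge>0. \<forall>u u'. d (F v u) (F v' u') = sqrt ((v - v')\<^sup>2 + (u - u')\<^sup>2)) \<and>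
     (\<forall>u. d (F 0 u) (\<sigma> u) = 0))"

text \<open>Geodesics between points close to the two ends pass through a fixed ball: a substitute for
  a line joining the ends that does not bound a flat half plane.\<close>

definition vis :: "(real \<Rightarrow> 'a) \<Rightarrow> (real \<Rightarrow> 'a) \<Rightarrow> bool" where
  "vis c c' \<longleftrightarrow> (\<exists>R T. T > 0 \<and> (\<forall>x\<in>N c T. \<forall>y\<in>N c' T. \<exists>w. btw x w y \<and> d (c 0) w \<le> R))"

text \<open>The limit of \<open>gp_cn\<close> for the point at distance \<open>s\<close> on the
  geodesic from \<open>c 0\<close> to \<open>Y n\<close>. It is a law of cosines with a vertex at
  infinity: \<open>b\<close> bounds the Busemann function at \<open>z\<close>, normalised to 0 at
  \<open>c 0\<close>, and equality holds in the Euclidean plane when \<open>b\<close> is its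
  value.\<close>

lemma cosine_bound:
  assumes c: "ray c" and Y: "filterlim Y (nb c) sequentially" and s: "0 \<le> s"
    and b: "\<And>e. e > 0 \<Longrightarrow> eventually (\<lambda>n. d z (Y n) \<le> d (c 0) (Y n) + b + e) sequentially"
  shows "(d z (c s))\<^sup>2 \<le> (d z (c 0))\<^sup>2 + s\<^sup>2 + 2 * s * b"
proof -
  define A where "A n = d (c 0) (Y n)" for n
  have A: "filterlim A at_top sequentially"
    and lim: "(\<lambda>n. d (pt (c 0) (Y n) s) (c s)) \<longlonglongrightarrow> 0"
    using Y s unfolding filterlim_nb_iff [OF c] A_def by auto
  have main: "(d z (c s))\<^sup>2 \<le> (d z (c 0))\<^sup>2 + s\<^sup>2 + 2 * s * (b + e)" if e: "e > 0" for e
  proof (rule tendsto_le)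
    show "(\<lambda>n. (d z (pt (c 0) (Y n) s))\<^sup>2) \<longlonglongrightarrow> (d z (c s))\<^sup>2"
      by (intro tendsto_power tendsto_dist_const(2) lim)
    have inv: "(\<lambda>n. s / A n) \<longlonglongrightarrow> 0"
      by (intro tendsto_divide_0 [OF tendsto_const] filterlim_at_top_imp_at_infinity A)
    have "(\<lambda>n. (1 - s / A n) * (d z (c 0))\<^sup>2 + s\<^sup>2 + 2 * s * (b + e) + s / A n * (b + e)\<^sup>2) \<longlonglongrightarrow>
        (1 - 0) * (d z (c 0))\<^sup>2 + s\<^sup>2 + 2 * s * (b + e) + 0 * (b + e)\<^sup>2"
      by (intro tendsto_intros inv)
    then show "(\<lambda>n. (1 - s / A n) * (d z (c 0))\<^sup>2 + s\<^sup>2 + 2 * s * (b + e) + s / A n * (b + e)\<^sup>2) \<longlonglongrightarrow>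
        (d z (c 0))\<^sup>2 + s\<^sup>2 + 2 * s * (b + e)"
      by simp
    have "eventually (\<lambda>n. s + 1 \<le> A n) sequentially"
      using A unfolding filterlim_at_top by blast
    with b [OF e] show "\<forall>\<^sub>F n in sequentially. (d z (pt (c 0) (Y n) s))\<^sup>2 \<le>
        (1 - s / A n) * (d z (c 0))\<^sup>2 + s\<^sup>2 + 2 * s * (b + e) + s / A n * (b + e)\<^sup>2"
    proof eventually_elim
      case (elim n)
      have A: "s < A n" "0 < A n" "0 \<le> s / A n" "s / A n \<le> 1"
        using elim s by auto
      have "pt (c 0) (Y n) s = gp (c 0) (Y n) (s / A n)"
        using A by (simp add: pt_def A_def)
      then have "(d z (pt (c 0) (Y n) s))\<^sup>2 \<le>
          (1 - s / A n) * (d z (c 0))\<^sup>2 + s / A n * (d z (Y n))\<^sup>2 - s / A n * (1 - s / A n) * (A n)\<^sup>2"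
        using gp_cn [OF A(3,4), of z "c 0" "Y n"] by (simp add: A_def)
      also have "s / A n * (d z (Y n))\<^sup>2 \<le> s / A n * (A n + (b + e))\<^sup>2"
        using A elim nonneg [of z "Y n"] by (intro mult_left_mono power_mono) (auto simp: A_def)
      also have "(1 - s / A n) * (d z (c 0))\<^sup>2 + s / A n * (A n + (b + e))\<^sup>2 -
            s / A n * (1 - s / A n) * (A n)\<^sup>2 =
          (1 - s / A n) * (d z (c 0))\<^sup>2 + s\<^sup>2 + 2 * s * (b + e) + s / A n * (b + e)\<^sup>2"
        using A by (simp add: field_simps power2_eq_square)
      finally show ?case
        by simp
    qed
  qed simp
  have "(d z (c s))\<^sup>2 \<le> (d z (c 0))\<^sup>2 + s\<^sup>2 + 2 * s * b + e" if e: "e > 0" for e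
  proof -
    have "(d z (c s))\<^sup>2 \<le> (d z (c 0))\<^sup>2 + s\<^sup>2 + 2 * s * (b + e / (2 * s + 1))"
      using e s by (intro main) auto
    moreover have "2 * s * (e / (2 * s + 1)) \<le> e"
      using e s by (simp add: field_simps)
    ultimately show ?thesis
      by (simp add: distrib_left)
  qed
  then show ?thesis
    by (rule field_le_epsilon)
qed

text \<open>With slope -1, the value \<open>b = - s\<close> makes the right-hand side of
  \<open>cosine_bound\<close> zero.\<close>

lemma end_of_affine:
  assumes l: "line \<sigma>" and c: "ray c" "c 0 = \<sigma> 0" and Y: "filterlim Y (nb c) sequentially"
    and aff: "\<And>t. (\<lambda>n. d (\<sigma> t) (Y n) - d (\<sigma> 0) (Y n)) \<longlonglongrightarrow> - t" and s: "0 \<le> s"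
  shows "d (c s) (\<sigma> s) = 0"
proof -
  have "(d (\<sigma> s) (c s))\<^sup>2 \<le> (d (\<sigma> s) (c 0))\<^sup>2 + s\<^sup>2 + 2 * s * (- s)"
  proof (rule cosine_bound [OF c(1) Y s])
    fix e :: real assume "e > 0"
    then have "eventually (\<lambda>n. d (\<sigma> s) (Y n) - d (\<sigma> 0) (Y n) < - s + e) sequentially"
      using aff [of s] by (intro order_tendstoD) auto
    then show "eventually (\<lambda>n. d (\<sigma> s) (Y n) \<le> d (c 0) (Y n) + - s + e) sequentially"
      by eventually_elim (simp add: c)
  qed
  also have "\<dots> = 0"
    using s c lineD [OF l] by (simp add: power2_eq_square)
  finally show ?thesis
    by (simp add: sym)
qed

lemma midpoint_bound:
  assumes l: "line \<sigma>"
  shows "(d z (\<sigma> t))\<^sup>2 \<le> ((d z (\<sigma> (t - u)))\<^sup>2 + (d z (\<sigma> (t + u)))\<^sup>2) / 2 - u\<^sup>2"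
proof -
  have "d (\<sigma> t) (gp (\<sigma> (t - u)) (\<sigma> (t + u)) (1 / 2)) = 0"
    by (rule gp_unique) (auto simp: lineD [OF l])
  then have "d z (\<sigma> t) = d z (gp (\<sigma> (t - u)) (\<sigma> (t + u)) (1 / 2))"
    by (rule d0_right)
  moreover have "\<bar>t - u - (t + u)\<bar>\<^sup>2 = 4 * u\<^sup>2"
    by (simp add: power2_eq_square algebra_simps)
  ultimately show ?thesis
    using gp_cn [of "1 / 2" z "\<sigma> (t - u)" "\<sigma> (t + u)"] lineD [OF l, of "t - u" "t + u"]
    by (simp add: field_simps)
qed

lemma line_convex:
  assumes l: "line \<sigma>"
  shows "2 * d z (\<sigma> t) \<le> d z (\<sigma> (t - u)) + d z (\<sigma> (t + u))"
proof -
  have "d (\<sigma> t) (gp (\<sigma> (t - u)) (\<sigma> (t + u)) (1 / 2)) = 0"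
    by (rule gp_unique) (auto simp: lineD [OF l])
  then have "d z (\<sigma> t) = d z (gp (\<sigma> (t - u)) (\<sigma> (t + u)) (1 / 2))"
    by (rule d0_right)
  then show ?thesis
    using gp_convex_point [of "1 / 2" z "\<sigma> (t - u)" "\<sigma> (t + u)"] by simp
qed

text \<open>Comparison gives upper bounds for all distances, but exact values only from the points
  of the boundary line; this supplies the missing lower bounds.\<close>

lemma planar_map_isometric:
  fixes F :: "real \<Rightarrow> real \<Rightarrow> 'a"
  assumes up: "\<And>v v' u u'. 0 \<le> v \<Longrightarrow> 0 \<le> v' \<Longrightarrow> (d (F v u) (F v' u'))\<^sup>2 \<le> (v - v')\<^sup>2 + (u - u')\<^sup>2"
    and bd: "\<And>v u u'. 0 \<le> v \<Longrightarrow> (d (F 0 u') (F v u))\<^sup>2 = v\<^sup>2 + (u - u')\<^sup>2"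
    and v: "0 \<le> v" "0 \<le> v'"
  shows "d (F v u) (F v' u') = sqrt ((v - v')\<^sup>2 + (u - u')\<^sup>2)"
proof -
  have up': "d (F v u) (F v' u') \<le> sqrt ((v - v')\<^sup>2 + (u - u')\<^sup>2)" if "0 \<le> v" "0 \<le> v'" for v v' u u'
    using up [OF that] by (simp add: real_le_rsqrt)
  have bd': "d (F 0 u') (F v u) = sqrt (v\<^sup>2 + (u - u')\<^sup>2)" if "0 \<le> v" for v u u'
    using bd [OF that, of u' u] by (metis nonneg real_sqrt_unique)
  \<comment> \<open>The line through two points of different heights meets the boundary, from where distances are exact.\<close>
  have lo: "sqrt ((v - v')\<^sup>2 + (u - u')\<^sup>2) \<le> d (F v u) (F v' u')" if v: "0 \<le> v'" "v' < v" for v v' u u'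
  proof -
    define m where "m = v' / (v - v')"
    define b where "b = u' + (u' - u) * m"
    define \<rho> where "\<rho> = sqrt ((v - v')\<^sup>2 + (u - u')\<^sup>2)"
    have m: "0 \<le> m" "v' = m * (v - v')" "v = (1 + m) * (v - v')"
      using v by (auto simp: m_def field_simps)
    have "u - b = (1 + m) * (u - u')"
      by (simp add: b_def algebra_simps)
    moreover have "v\<^sup>2 = (1 + m)\<^sup>2 * (v - v')\<^sup>2"
      using m(3) by (metis power_mult_distrib)
    ultimately have "v\<^sup>2 + (u - b)\<^sup>2 = (1 + m)\<^sup>2 * ((v - v')\<^sup>2 + (u - u')\<^sup>2)"
      by (simp only: power_mult_distrib distrib_left)
    then have 1: "d (F 0 b) (F v u) = (1 + m) * \<rho>"
      using bd' [of v b u] v m(1) by (simp add: real_sqrt_mult \<rho>_def)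
    have "u' - b = m * (u - u')"
      by (simp add: b_def algebra_simps)
    moreover have "v'\<^sup>2 = m\<^sup>2 * (v - v')\<^sup>2"
      using m(2) by (metis power_mult_distrib)
    ultimately have "v'\<^sup>2 + (u' - b)\<^sup>2 = m\<^sup>2 * ((v - v')\<^sup>2 + (u - u')\<^sup>2)"
      by (simp only: power_mult_distrib distrib_left)
    then have 2: "d (F 0 b) (F v' u') = m * \<rho>"
      using bd' [of v' b u'] v m(1) by (simp add: real_sqrt_mult \<rho>_def)
    show ?thesis
      using tri [of "F 0 b" "F v u" "F v' u'"] 1 2 sym [of "F v' u'" "F v u"]
      by (simp add: algebra_simps \<rho>_def)
  qed
  have "sqrt ((v - v')\<^sup>2 + (u - u')\<^sup>2) \<le> d (F v u) (F v' u')"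
  proof (cases "v = v'")
    case False
    then show ?thesis
      using lo [of v' v u u'] lo [of v v' u' u] v sym [of "F v u" "F v' u'"]
      by (cases "v' < v") (auto simp: power2_commute)
  next
    case True
    \<comment> \<open>Points of equal height: raise one of them by \<open>e\<close>.\<close>
    have "sqrt ((v - v')\<^sup>2 + (u - u')\<^sup>2) \<le> d (F v u) (F v' u') + e" if e: "e > 0" for e
    proof -
      have "sqrt ((v - v')\<^sup>2 + (u - u')\<^sup>2) \<le> sqrt ((v + e - v')\<^sup>2 + (u - u')\<^sup>2)"
        using True e by simp
      also have "\<dots> \<le> d (F (v + e) u) (F v' u')"
        using v True e by (intro lo) auto
      also have "\<dots> \<le> d (F (v + e) u) (F v u) + d (F v u) (F v' u')"
        by (rule tri)
      also have "d (F (v + e) u) (F v u) \<le> e"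
        using up' [of "v + e" v u u] v e by simp
      finally show ?thesis
        by simp
    qed
    then show ?thesis
      by (rule field_le_epsilon)
  qed
  with up' [OF v, of u u'] show ?thesis
    by (rule antisym)
qed

end

locale proper_hadamard_pseudometric = hadamard_pseudometric +
  assumes proper: "(\<And>n::nat. d p (s n) \<le> B) \<Longrightarrow> \<exists>r l. strict_mono r \<and> (\<lambda>n. d (s (r n)) l) \<longlonglongrightarrow> 0"
begin

text \<open>Properness and a diagonal subsequence give convergence of the geodesics at integer
  times; contraction towards \<open>p\<close> gives it at all other times.\<close>

lemma compactify:
  assumes Y: "filterlim (\<lambda>n::nat. d p (Y n)) at_top sequentially"
  obtains r c where "strict_mono r" "ray c" "c 0 = p" "filterlim (\<lambda>n. Y (r n)) (nb c) sequentially"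
proof -
  have "\<exists>r l. strict_mono r \<and> (\<lambda>n. d (pt p (Y (q (r n))) (real k)) l) \<longlonglongrightarrow> 0" for k and q :: "nat \<Rightarrow> nat"
    using proper [of p "\<lambda>n. pt p (Y (q n)) (real k)" "real k"] by (simp add: dist_pt)
  then obtain q where q: "strict_mono q" "\<And>k. \<exists>l. (\<lambda>n. d (pt p (Y (q n)) (real k)) l) \<longlonglongrightarrow> 0"
    using diagonal_subsequence [of "\<lambda>k n l. d (pt p (Y n) (real k)) l"] by blast
  define Z where "Z n = Y (q n)" for n
  have far: "filterlim (\<lambda>n. d p (Z n)) at_top sequentially"
    unfolding Z_def by (rule filterlim_compose [OF Y filterlim_subseq [OF q(1)]])
  have Zk: "\<exists>l. (\<lambda>n. d (pt p (Z n) (real k)) l) \<longlonglongrightarrow> 0" for k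
    using q(2) by (simp add: Z_def)
  have "\<exists>l. (\<lambda>n. d (pt p (Z n) s) l) \<longlonglongrightarrow> 0" if s: "0 \<le> s" for s
  proof (rule complete)
    fix e :: real assume e: "e > 0"
    define k where "k = Suc (nat \<lceil>s\<rceil>)"
    have k: "s \<le> real k" "0 < real k"
      unfolding k_def by linarith+
    obtain l where l: "(\<lambda>n. d (pt p (Z n) (real k)) l) \<longlonglongrightarrow> 0"
      using Zk by blast
    have "eventually (\<lambda>n. real k \<le> d p (Z n)) sequentially"
      using far unfolding filterlim_at_top by blast
    moreover have "eventually (\<lambda>n. d (pt p (Z n) (real k)) l < e / 2) sequentially"
      using l e by (intro order_tendstoD) auto
    ultimately have "eventually (\<lambda>n. real k \<le> d p (Z n) \<and> d (pt p (Z n) (real k)) l < e / 2) sequentially"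
      by (rule eventually_conj)
    then obtain M where M: "\<And>n. n \<ge> M \<Longrightarrow> real k \<le> d p (Z n) \<and> d (pt p (Z n) (real k)) l < e / 2"
      unfolding eventually_sequentially by blast
    show "\<exists>M. \<forall>m\<ge>M. \<forall>n\<ge>M. d (pt p (Z m) s) (pt p (Z n) s) < e"
    proof (intro exI allI impI)
      fix m n assume mn: "m \<ge> M" "n \<ge> M"
      have "d (pt p (Z m) s) (pt p (Z n) s) \<le> s / real k * d (pt p (Z m) (real k)) (pt p (Z n) (real k))"
        using M mn s k by (intro pt_contract) auto
      also have "\<dots> \<le> 1 * d (pt p (Z m) (real k)) (pt p (Z n) (real k))"
        using k by (intro mult_right_mono) auto
      also have "\<dots> < e"
        using M [OF mn(1)] M [OF mn(2)] tri [of "pt p (Z m) (real k)" "pt p (Z n) (real k)" l]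
          sym [of l "pt p (Z n) (real k)"] by linarith
      finally show "d (pt p (Z m) s) (pt p (Z n) s) < e" .
    qed
  qed
  then obtain c where c: "ray c" "c 0 = p" "\<And>s. 0 \<le> s \<Longrightarrow> (\<lambda>n. d (pt p (Z n) s) (c s)) \<longlonglongrightarrow> 0"
    using limit_ray [OF far] by blast
  then have "filterlim Z (nb c) sequentially"
    using far by (simp add: filterlim_nb_iff)
  then show ?thesis
    using that [OF q(1) c(1,2)] by (simp add: Z_def [abs_def])
qed

text \<open>If the distance to points going to infinity is asymptotically affine along a line, then the
  rays from the points of the line to a limit of these points span a flat half plane.\<close>

lemma half_plane_of_affine:
  assumes l: "line \<sigma>" and far: "filterlim (\<lambda>n::nat. d (\<sigma> 0) (Y n)) at_top sequentially"
    and aff: "\<And>t. (\<lambda>n. d (\<sigma> t) (Y n) - d (\<sigma> 0) (Y n)) \<longlonglongrightarrow> - k * t" and k: "\<bar>k\<bar> < 1"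
  shows "half_plane \<sigma>"
proof -
  obtain r c0 where r: "strict_mono r" and c0: "ray c0" "c0 0 = \<sigma> 0"
      "filterlim (\<lambda>n. Y (r n)) (nb c0) sequentially"
    using compactify [OF far] by blast
  define Z where "Z n = Y (r n)" for n
  have aff0: "(\<lambda>n. d (\<sigma> t) (Z n) - d (\<sigma> 0) (Z n)) \<longlonglongrightarrow> - k * t" for t
    using LIMSEQ_subseq_LIMSEQ [OF aff r] by (simp add: Z_def o_def)
  have aff': "(\<lambda>n. d (\<sigma> t') (Z n) - d (\<sigma> t) (Z n)) \<longlonglongrightarrow> k * (t - t')" for t t'
    using tendsto_diff [OF aff0 [of t'] aff0 [of t]] by (simp add: algebra_simps)
  have "\<exists>c'. ray c' \<and> c' 0 = \<sigma> t \<and> asym c0 c'" for t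
    using ray_from [OF c0(1)] by metis
  then obtain c where c: "\<And>t. ray (c t)" "\<And>t. c t 0 = \<sigma> t" "\<And>t. asym c0 (c t)"
    by metis
  have Z: "filterlim Z (nb (c t)) sequentially" for t
    using c0(3) nb_cong [OF c0(1) c(1,3)] by (simp add: Z_def [abs_def])
  have ev: "eventually (\<lambda>n. d (\<sigma> t') (Z n) \<le> d (\<sigma> t) (Z n) + k * (t - t') + e) sequentially"
    if "e > 0" for e t t'
  proof -
    have "eventually (\<lambda>n. d (\<sigma> t') (Z n) - d (\<sigma> t) (Z n) < k * (t - t') + e) sequentially"
      using aff' that by (intro order_tendstoD) auto
    then show ?thesis
      by eventually_elim simp
  qed
  have up1: "(d (\<sigma> t') (c t s))\<^sup>2 \<le> (t - t')\<^sup>2 + s\<^sup>2 + 2 * s * (k * (t - t'))" if "0 \<le> s" for t t' s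
    using cosine_bound [OF c(1) [of t] Z that, where z = "\<sigma> t'" and b = "k * (t - t')"]
      ev [of _ t' t] c(2) [of t] lineD [OF l, of t' t] by (simp add: power2_commute)
  \<comment> \<open>The upper bounds at \<open>t'\<close> and at its mirror image
    \<open>2 * t - t'\<close> leave no room in the midpoint inequality at \<open>t\<close>.\<close>
  have eq1: "(d (\<sigma> t') (c t s))\<^sup>2 = (t - t')\<^sup>2 + s\<^sup>2 + 2 * s * (k * (t - t'))" if s: "0 \<le> s" for t t' s
  proof -
    define a b where "a = d (\<sigma> t') (c t s)" and "b = d (\<sigma> (t + (t - t'))) (c t s)"
    have "s\<^sup>2 = (d (c t s) (\<sigma> t))\<^sup>2"
      using rayD [OF c(1), of s 0 t] s c(2) by simp
    also have "\<dots> \<le> ((d (c t s) (\<sigma> (t - (t - t'))))\<^sup>2 + (d (c t s) (\<sigma> (t + (t - t'))))\<^sup>2) / 2 - (t - t')\<^sup>2"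
      by (rule midpoint_bound [OF l])
    finally have "s\<^sup>2 \<le> (a\<^sup>2 + b\<^sup>2) / 2 - (t - t')\<^sup>2"
      using sym [of "c t s" "\<sigma> t'"] sym [of "c t s" "\<sigma> (t + (t - t'))"] by (simp add: a_def b_def)
    moreover have "b\<^sup>2 \<le> (t - t')\<^sup>2 + s\<^sup>2 - 2 * s * (k * (t - t'))"
      using up1 [OF s, of "t + (t - t')" t] unfolding b_def by (simp add: power2_commute algebra_simps)
    ultimately have "(t - t')\<^sup>2 + s\<^sup>2 + 2 * s * (k * (t - t')) \<le> (d (\<sigma> t') (c t s))\<^sup>2"
      unfolding a_def [symmetric] by argo
    with up1 [OF s, of t' t] show ?thesis
      by (rule antisym)
  qed
  \<comment> \<open>\<open>cosine_bound\<close> along \<open>c t\<close> with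
    \<open>z = c t' s'\<close>: walking along \<open>c t'\<close> for the time \<open>s'\<close>
    lowers the Busemann function by \<open>s'\<close>.\<close>
  have up2: "(d (c t' s') (c t s))\<^sup>2 \<le> (t - t')\<^sup>2 + (s - s')\<^sup>2 + 2 * k * (t - t') * (s - s')"
    if s: "0 \<le> s" "0 \<le> s'" for t t' s s'
  proof -
    have "(d (c t' s') (c t s))\<^sup>2 \<le> (d (c t' s') (c t 0))\<^sup>2 + s\<^sup>2 + 2 * s * (k * (t - t') - s')"
    proof (rule cosine_bound [OF c(1) Z s(1)])
      fix e :: real assume e: "e > 0"
      have "(\<lambda>n. d (pt (\<sigma> t') (Z n) s') (c t' s')) \<longlonglongrightarrow> 0" "filterlim (\<lambda>n. d (\<sigma> t') (Z n)) at_top sequentially"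
        using Z [of t'] s(2) unfolding filterlim_nb_iff [OF c(1)] by (auto simp: c(2))
      then have "eventually (\<lambda>n. d (pt (\<sigma> t') (Z n) s') (c t' s') < e / 2) sequentially"
        "eventually (\<lambda>n. s' \<le> d (\<sigma> t') (Z n)) sequentially"
        using e order_tendstoD(2) [of _ 0 sequentially "e / 2"] unfolding filterlim_at_top by auto
      moreover have "eventually (\<lambda>n. d (\<sigma> t') (Z n) \<le> d (\<sigma> t) (Z n) + k * (t - t') + e / 2) sequentially"
        using e by (intro ev) simp
      ultimately show "eventually (\<lambda>n. d (c t' s') (Z n) \<le> d (c t 0) (Z n) + (k * (t - t') - s') + e) sequentially"
      proof eventually_elim
        case (elim n)
        have "d (c t' s') (Z n) \<le> d (pt (\<sigma> t') (Z n) s') (c t' s') + d (pt (\<sigma> t') (Z n) s') (Z n)"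
          using tri [of "c t' s'" "Z n" "pt (\<sigma> t') (Z n) s'"] sym [of "c t' s'"] by simp
        also have "d (pt (\<sigma> t') (Z n) s') (Z n) = d (\<sigma> t') (Z n) - s'"
          using elim s by (simp add: dist_pt)
        finally show ?case
          using elim c(2) by simp
      qed
    qed
    also have "(d (c t' s') (c t 0))\<^sup>2 = (t - t')\<^sup>2 + s'\<^sup>2 - 2 * s' * (k * (t - t'))"
      using eq1 [OF s(2), of t t'] c(2) sym [of "c t' s'"] by (simp add: power2_commute algebra_simps)
    finally show ?thesis
      by (simp add: power2_eq_square algebra_simps)
  qed
  \<comment> \<open>The rays leave the line at an angle with cosine \<open>k\<close> and sine
    \<open>w\<close>: in the plane, \<open>c t s\<close> has the coordinate \<open>t + k * s\<close>
    along the line and the height \<open>w * s\<close>. \<open>F\<close> inverts this change of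
    coordinates.\<close>
  define w where "w = sqrt (1 - k\<^sup>2)"
  have "k\<^sup>2 < 1"
    using k by (simp add: abs_square_less_1)
  then have w: "w > 0" "w\<^sup>2 = 1 - k\<^sup>2"
    by (auto simp: w_def)
  define F where "F v u = c (u - k * (v / w)) (v / w)" for v u
  have "d (F v u) (F v' u') = sqrt ((v - v')\<^sup>2 + (u - u')\<^sup>2)" if "0 \<le> v" "0 \<le> v'" for v v' u u'
  proof (rule planar_map_isometric)
    have id: "(u - k * S - (u' - k * S'))\<^sup>2 + (S - S')\<^sup>2 + 2 * k * (u - k * S - (u' - k * S')) * (S - S')
        = w\<^sup>2 * (S - S')\<^sup>2 + (u - u')\<^sup>2" for u u' S S'
      unfolding w(2) by (simp add: power2_eq_square algebra_simps)
    have ww: "w\<^sup>2 * (v / w - v' / w)\<^sup>2 = (v - v')\<^sup>2" for v v'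
      using w(1) by (simp add: power_mult_distrib [symmetric] right_diff_distrib)
    show "(d (F v u) (F v' u'))\<^sup>2 \<le> (v - v')\<^sup>2 + (u - u')\<^sup>2" if "0 \<le> v" "0 \<le> v'" for v v' u u'
      using up2 [of "v' / w" "v / w" "u - k * (v / w)" "u' - k * (v' / w)"] that w(1)
        id [of u' "v' / w" u "v / w"] ww [of v' v] unfolding F_def
      by (simp add: power2_commute)
    show "(d (F 0 u') (F v u))\<^sup>2 = v\<^sup>2 + (u - u')\<^sup>2" if "0 \<le> v" for v u u'
      using eq1 [of "v / w" u' "u - k * (v / w)"] that w(1) c(2)
        id [of u "v / w" u' 0] ww [of v 0] unfolding F_def
      by (simp add: algebra_simps)
  qed fact+
  moreover have "d (F 0 u) (\<sigma> u) = 0" for u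
    by (simp add: F_def c(2))
  ultimately show ?thesis
    unfolding half_plane_def by blast
qed

section \<open>Nearest points on a segment, and visibility along a line\<close>

lemma exists_nearest:
  obtains p where "btw x p y" "\<And>w. btw x w y \<Longrightarrow> d z p \<le> d z w"
proof -
  have "continuous_on {0..d x y} (\<lambda>s. d z (pt x y s))"
  proof (rule continuous_on_iff [THEN iffD2], intro ballI allI impI)
    fix s e assume s: "s \<in> {0..d x y}" and e: "(0::real) < e"
    have "dist (d z (pt x y s')) (d z (pt x y s)) < e" if "s' \<in> {0..d x y}" "dist s' s < e" for s'
      using that s dist_pt_pt [of s' x y s] abs_dist_diff [of "pt x y s'" z "pt x y s"]
        sym [of z "pt x y s"] sym [of z "pt x y s'"] by (auto simp: dist_real_def)
    then show "\<exists>\<delta>>0. \<forall>s'\<in>{0..d x y}. dist s' s < \<delta> \<longrightarrow> dist (d z (pt x y s')) (d z (pt x y s)) < e"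
      using e by blast
  qed
  then obtain s where s: "s \<in> {0..d x y}" "\<And>s'. s' \<in> {0..d x y} \<Longrightarrow> d z (pt x y s) \<le> d z (pt x y s')"
    using continuous_attains_inf [of "{0..d x y}" "\<lambda>s. d z (pt x y s)"] by auto
  show ?thesis
  proof (rule that)
    show "btw x (pt x y s) y"
      using s by (intro btw_pt) auto
    fix w assume w: "btw x w y"
    have xw: "d x w \<in> {0..d x y}"
      using w nonneg [of w y] nonneg [of x w] unfolding btw_def atLeastAtMost_iff by linarith
    have "d w (pt x y (d x w)) = 0"
      using w xw unfolding btw_def by (intro pt_unique) auto
    then show "d z (pt x y s) \<le> d z w"
      using s(2) [OF xw] d0_right [of w "pt x y (d x w)" z] by simp
  qed
qed

text \<open>The angle at the nearest point is not acute: otherwise a small step from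
  \<open>p\<close> towards \<open>y\<close> would come closer to \<open>z\<close>.\<close>

lemma nearest_obtuse:
  assumes p: "btw x p y" "\<And>w. btw x w y \<Longrightarrow> d z p \<le> d z w"
  shows "(d z p)\<^sup>2 + (d p y)\<^sup>2 \<le> (d z y)\<^sup>2"
proof (rule ccontr)
  define X where "X = (d z p)\<^sup>2 + (d p y)\<^sup>2 - (d z y)\<^sup>2"
  assume "\<not> ?thesis"
  then have X: "X > 0"
    by (simp add: X_def)
  have le: "X \<le> t * (d p y)\<^sup>2" if t: "0 < t" "t < 1" for t
  proof -
    let ?q = "gp p y t"
    have "btw x ?q y"
      using p(1) tri [of x ?q p] tri [of x y ?q] t gp_left [of t p y] gp_right [of t p y]
      unfolding btw_def by (auto simp: algebra_simps)
    then have "(d z p)\<^sup>2 \<le> (d z ?q)\<^sup>2"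
      using p(2) by (intro power_mono) auto
    also have "\<dots> \<le> (1 - t) * (d z p)\<^sup>2 + t * (d z y)\<^sup>2 - t * (1 - t) * (d p y)\<^sup>2"
      using t by (intro gp_cn) auto
    finally have "t * X \<le> t * (t * (d p y)\<^sup>2)"
      by (simp add: X_def algebra_simps power2_eq_square)
    then show ?thesis
      using t by simp
  qed
  define Q where "Q = (d p y)\<^sup>2"
  have "X \<le> Q / 2"
    using le [of "1/2"] by (simp add: Q_def)
  then have Q: "Q > 0"
    using X by linarith
  \<comment> \<open>The step size \<open>X / (2 * Q)\<close> yields
    \<open>X \<le> X / 2\<close>.\<close>
  have "X \<le> X / (2 * Q) * Q"
    using le [of "X / (2 * Q)"] X Q \<open>X \<le> Q / 2\<close> by (auto simp: Q_def field_simps)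
  then show False
    using X Q by simp
qed

text \<open>As the angle at \<open>p\<close> is not acute, the one at \<open>z\<close> is at most a
  right angle, so walking \<open>t\<close> from \<open>z\<close> towards \<open>y\<close> raises the
  squared distance to \<open>p\<close> by at most \<open>t\<^sup>2\<close>. The resulting error
  vanishes when the nearest points go to infinity.\<close>

lemma nearest_dist_bound:
  assumes p: "btw x p y" "\<And>w. btw x w y \<Longrightarrow> d z p \<le> d z w" and t: "0 \<le> t" "t \<le> d z y" "0 < d z p"
  shows "d p (pt z y t) \<le> d z p + t\<^sup>2 / (2 * d z p)"
proof -
  define P A m where "P = d z p" and "A = d z y" and "m = t / A"
  have ob: "P\<^sup>2 + (d p y)\<^sup>2 \<le> A\<^sup>2"
    using nearest_obtuse [OF p] by (simp add: P_def A_def)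
  have "P\<^sup>2 \<le> A\<^sup>2"
    using ob zero_le_power2 [of "d p y"] by linarith
  then have A: "A > 0"
    using t(3) nonneg [of z y] unfolding P_def A_def
    by (metis less_eq_real_def power2_eq_iff_nonneg power_zero_numeral not_le zero_less_power2 order_antisym)
  have m: "0 \<le> m" "m \<le> 1" "m * A = t"
    using t A by (auto simp: m_def A_def)
  have "d (pt z y t) (gp z y m) = 0"
    using t m A dist_pt [of t z y] unfolding A_def by (intro gp_unique) (auto simp: algebra_simps)
  then have "(d p (pt z y t))\<^sup>2 = (d p (gp z y m))\<^sup>2"
    using d0_right by metis
  also have "\<dots> \<le> (1 - m) * P\<^sup>2 + m * (d p y)\<^sup>2 - m * (1 - m) * A\<^sup>2"
    using gp_cn [OF m(1,2), of p z y] sym [of p z] by (simp add: P_def A_def)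
  also have "\<dots> \<le> (1 - m) * P\<^sup>2 + m * (A\<^sup>2 - P\<^sup>2) - m * (1 - m) * A\<^sup>2"
    using m ob by (intro diff_right_mono add_left_mono mult_left_mono) auto
  also have "\<dots> = (1 - 2 * m) * P\<^sup>2 + (m * A)\<^sup>2"
    by (simp add: algebra_simps power2_eq_square)
  also have "\<dots> \<le> P\<^sup>2 + t\<^sup>2"
    using m by (simp add: algebra_simps)
  also have "\<dots> \<le> (P + t\<^sup>2 / (2 * P))\<^sup>2"
    using t(3) by (simp add: power2_sum P_def)
  finally show ?thesis
    using t(3) by (auto intro: power2_le_imp_le simp: P_def)
qed

text \<open>If visibility fails, there are geodesics between points tending to the two ends that
  leave every ball. Their points nearest to \<open>\<sigma> 0\<close> go to infinity, and up to a
  vanishing error the distance to them does not grow in either direction along \<sigma>; being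
  convex, it is asymptotically constant, and slope 0 yields a half plane.\<close>

lemma vis_line:
  assumes l: "line \<sigma>" and nh: "\<not> half_plane \<sigma>"
  shows "vis (\<lambda>t. \<sigma> (- t)) \<sigma>"
proof (rule ccontr)
  let ?\<sigma>' = "\<lambda>t. \<sigma> (- t)"
  have r: "ray \<sigma>" "ray ?\<sigma>'"
    using l line_ray line_reverse by blast+
  assume "\<not> ?thesis"
  then have "\<exists>x\<in>N ?\<sigma>' (real n + 1). \<exists>y\<in>N \<sigma> (real n + 1). \<forall>w. btw x w y \<longrightarrow> d (\<sigma> 0) w > real n + 1" for n
    unfolding vis_def not_ex not_all de_Morgan_conj Bex_def Ball_def
    by (metis add.commute add_pos_nonneg minus_zero not_le of_nat_0_le_iff zero_less_one)
  then obtain x y where xy: "\<And>n. x n \<in> N ?\<sigma>' (real n + 1)" "\<And>n. y n \<in> N \<sigma> (real n + 1)"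
      "\<And>n w. btw (x n) w (y n) \<Longrightarrow> d (\<sigma> 0) w > real n + 1"
    by metis
  have "\<exists>p. btw (x n) p (y n) \<and> (\<forall>w. btw (x n) w (y n) \<longrightarrow> d (\<sigma> 0) p \<le> d (\<sigma> 0) w)" for n
    using exists_nearest by metis
  then obtain p where p: "\<And>n. btw (x n) (p n) (y n)"
      "\<And>n w. btw (x n) w (y n) \<Longrightarrow> d (\<sigma> 0) (p n) \<le> d (\<sigma> 0) w"
    by metis
  have P: "real n + 1 < d (\<sigma> 0) (p n)" for n
    by (rule xy(3) [OF p(1)])
  \<comment> \<open>The term \<open>t\<^sup>2 / 2\<close> comes from
    \<open>nearest_dist_bound\<close>, the term \<open>\<bar>t\<bar>\<close> from replacing the
    geodesic towards \<open>y n\<close> or \<open>x n\<close> by the line.\<close>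
  define E where "E t n = (t\<^sup>2 / 2 + \<bar>t\<bar>) / (real n + 1)" for t n
  have bound: "d (c t) (q n) - d (c 0) (q n) \<le> E t n"
    if c: "ray c" "z n \<in> N c (real n + 1)" and t: "0 \<le> t" "t \<le> real n + 1"
      and q: "btw (z' n) (q n) (z n)" "\<And>w. btw (z' n) w (z n) \<Longrightarrow> d (c 0) (q n) \<le> d (c 0) w"
        "real n + 1 < d (c 0) (q n)" for c z z' q n t
  proof -
    have zt: "t \<le> d (c 0) (z n)"
      using c t by (auto simp: N_def)
    have "d (q n) (pt (c 0) (z n) t) \<le> d (c 0) (q n) + t\<^sup>2 / (2 * d (c 0) (q n))"
      using q t zt by (intro nearest_dist_bound [of "z' n" "q n" "z n" "c 0"]) auto
    also have "t\<^sup>2 / (2 * d (c 0) (q n)) \<le> t\<^sup>2 / (2 * (real n + 1))"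
      using q(3) by (intro divide_left_mono mult_pos_pos mult_left_mono) auto
    finally have 1: "d (q n) (pt (c 0) (z n) t) \<le> d (c 0) (q n) + t\<^sup>2 / (2 * (real n + 1))"
      by simp
    have "d (pt (c 0) (z n) t) (c t) \<le> t / (real n + 1) * d (pt (c 0) (z n) (real n + 1)) (c (real n + 1))"
      using c t by (intro ray_contract) (auto simp: N_def)
    also have "\<dots> \<le> t / (real n + 1) * 1"
      using c t by (intro mult_left_mono) (auto simp: N_def)
    finally have 2: "d (pt (c 0) (z n) t) (c t) \<le> t / (real n + 1)"
      by simp
    have "d (c t) (q n) \<le> d (pt (c 0) (z n) t) (c t) + d (q n) (pt (c 0) (z n) t)"
      using tri [of "c t" "q n" "pt (c 0) (z n) t"] sym [of "c t" "pt (c 0) (z n) t"]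
        sym [of "q n" "pt (c 0) (z n) t"] by linarith
    then have "d (c t) (q n) - d (c 0) (q n) \<le> t\<^sup>2 / (2 * (real n + 1)) + t / (real n + 1)"
      using 1 2 by linarith
    also have "\<dots> = E t n"
      using t by (simp add: E_def add_divide_distrib)
    finally show ?thesis .
  qed
  have up: "d (\<sigma> t) (p n) - d (\<sigma> 0) (p n) \<le> E t n" if "\<bar>t\<bar> \<le> real n + 1" for t n
  proof (cases "0 \<le> t")
    case True
    then show ?thesis
      using bound [where c = \<sigma> and z = y and n = n and t = t and z' = x and q = p] r xy p P that by simp
  next
    case False
    have "btw (y n) (p n) (x n)" "\<And>w. btw (y n) w (x n) \<Longrightarrow> d (\<sigma> 0) (p n) \<le> d (\<sigma> 0) w"
      using p by (auto simp: btw_sym)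
    then show ?thesis
      using bound [where c = ?\<sigma>' and z = x and n = n and t = "- t" and z' = y and q = p] r xy P that False by (simp add: E_def)
  qed
  have E0: "E t \<longlonglongrightarrow> 0" for t
  proof -
    have "filterlim (\<lambda>n. 1 + real n) at_top sequentially"
      by (intro filterlim_tendsto_add_at_top [OF tendsto_const] filterlim_real_sequentially)
    then show ?thesis
      unfolding E_def by (intro tendsto_divide_0 [OF tendsto_const] filterlim_at_top_imp_at_infinity)
        (simp add: add.commute)
  qed
  have "half_plane \<sigma>"
  proof (rule half_plane_of_affine [OF l, where k = 0])
    have "real n \<le> d (\<sigma> 0) (p n)" for n
      using P [of n] by linarith
    then show "filterlim (\<lambda>n. d (\<sigma> 0) (p n)) at_top sequentially"
      by (intro filterlim_at_top_mono [OF filterlim_real_sequentially] always_eventually) blast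
    show "(\<lambda>n. d (\<sigma> t) (p n) - d (\<sigma> 0) (p n)) \<longlonglongrightarrow> - 0 * t" for t
    proof -
      have "(\<lambda>n. d (\<sigma> t) (p n) - d (\<sigma> 0) (p n)) \<longlonglongrightarrow> 0"
      proof (rule Lim_null_comparison [OF _ E0 [of t]])
        have "eventually (\<lambda>n. \<bar>t\<bar> \<le> real n) sequentially"
          using filterlim_real_sequentially unfolding filterlim_at_top by blast
        then show "eventually (\<lambda>n. norm (d (\<sigma> t) (p n) - d (\<sigma> 0) (p n)) \<le> E t n) sequentially"
        proof eventually_elim
          case (elim n)
          \<comment> \<open>Convexity turns the upper bound at \<open>- t\<close> into a lower bound
            at \<open>t\<close>.\<close>
          have "2 * d (p n) (\<sigma> 0) \<le> d (p n) (\<sigma> (0 - t)) + d (p n) (\<sigma> (0 + t))"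
            by (rule line_convex [OF l])
          moreover have "E (- t) n = E t n"
            by (simp add: E_def)
          ultimately show ?case
            using up [of t n] up [of "- t" n] elim sym [of "p n"] by (simp add: abs_le_iff)
        qed
      qed
      then show ?thesis
        by simp
    qed
  qed simp
  with nh show False
    by blast
qed

end

section \<open>Asymptotic slope of a convex Lipschitz function\<close>

lemma convex_asymptotic_slope:
  fixes B :: "real \<Rightarrow> real"
  assumes cv: "convex_on UNIV B" and lip: "\<And>s t. \<bar>B s - B t\<bar> \<le> \<bar>s - t\<bar>"
  obtains k where "\<bar>k\<bar> \<le> 1" "\<And>t. ((\<lambda>a. B (a + t) - B a) \<longlongrightarrow> k * t) at_top"
proof -
  have slope: "(B b - B a) / (b - a) \<le> (B d - B c) / (d - c)" if "a < b" "b \<le> c" "c < d" for a b c d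
  proof -
    have s: "(B y - B x) / (y - x) \<le> (B z - B y) / (z - y)" if "x < y" "y < z" for x y z
    proof -
      have "(B x - B y) / (x - y) \<le> (B y - B z) / (y - z)"
        using convex_on_slope_le [OF cv, of x z y] that by simp
      then show ?thesis
        using minus_divide_divide [of "B x - B y" "x - y"] minus_divide_divide [of "B y - B z" "y - z"]
        by simp
    qed
    show ?thesis
    proof (cases "b = c")
      case False
      then show ?thesis
        using s [of a b c] s [of b c d] that by (auto intro: order_trans)
    qed (use s that in auto)
  qed
  \<comment> \<open>Increments over unit intervals are monotone and bounded, so they converge to
    their supremum.\<close>
  define D where "D a = B (a + 1) - B a" for a
  have D_mono: "D a \<le> D b" if "a \<le> b" for a b
  proof (cases "a + 1 \<le> b")
    case True
    then show ?thesis
      using slope [of a "a + 1" b "b + 1"] by (simp add: D_def)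
  next
    case False
    show ?thesis
    proof (cases "a = b")
      case False
      have 1: "(B b - B a) / (b - a) \<le> (B (b + 1) - B (a + 1)) / (b - a)"
        using slope [of a b "a + 1" "b + 1"] \<open>\<not> a + 1 \<le> b\<close> False that by simp
      then have "B b - B a \<le> B (b + 1) - B (a + 1)"
        using False that by (simp add: divide_le_cancel)
      then show ?thesis
        by (simp add: D_def)
    qed simp
  qed
  have D_bound: "\<bar>D a\<bar> \<le> 1" for a
    using lip [of "a + 1" a] by (simp add: D_def)
  define k where "k = (SUP a. D a)"
  have bdd: "bdd_above (range D)"
    using D_bound by (intro bdd_aboveI [of _ 1]) (auto simp: abs_le_iff)
  have Dk: "D a \<le> k" for a
    unfolding k_def by (intro cSUP_upper bdd) auto
  have lim: "(D \<longlongrightarrow> k) at_top"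
  proof (rule order_tendstoI)
    fix y assume "y < k"
    then obtain a where "y < D a"
      unfolding k_def using less_cSUP_iff [OF _ bdd] by auto
    then show "eventually (\<lambda>x. y < D x) at_top"
      using D_mono by (intro eventually_at_top_linorderI [of a]) (auto intro: less_le_trans)
  next
    fix y assume "k < y"
    then show "eventually (\<lambda>x. D x < y) at_top"
      using Dk by (intro always_eventually allI) (auto intro: le_less_trans)
  qed
  have limt: "((\<lambda>a. D (a + t)) \<longlongrightarrow> k) at_top" for t
  proof -
    have "filterlim (\<lambda>a. t + a) at_top at_top"
      by (rule filterlim_tendsto_add_at_top [OF tendsto_const filterlim_ident])
    then show ?thesis
      using filterlim_compose [OF lim] by (simp add: add.commute)
  qed
  have "\<bar>k\<bar> \<le> 1"
  proof -
    have "D a \<le> 1" for a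
      using D_bound [of a] by linarith
    then have "k \<le> 1"
      unfolding k_def by (intro cSUP_least) auto
    then show ?thesis
      using Dk [of 0] D_bound [of 0] by linarith
  qed
  moreover have "((\<lambda>a. B (a + t) - B a) \<longlongrightarrow> k * t) at_top" for t
  proof (cases "t = 0")
    case False
    have "((\<lambda>a. (B (a + t) - B a) / t) \<longlongrightarrow> k) at_top"
    proof (rule tendsto_sandwich)
      show "((\<lambda>a. D (a + (- \<bar>t\<bar> - 1))) \<longlongrightarrow> k) at_top" "((\<lambda>a. D (a + \<bar>t\<bar>)) \<longlongrightarrow> k) at_top"
        by (rule limt)+
      \<comment> \<open>The left unit interval ends before \<open>a\<close> and
        \<open>a + t\<close>, the right one starts after both (or touches them), so convexity
        squeezes the slope in between.\<close>
      have "D (a + (- \<bar>t\<bar> - 1)) \<le> (B (a + t) - B a) / t \<and> (B (a + t) - B a) / t \<le> D (a + \<bar>t\<bar>)" for a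
      proof (cases "t > 0")
        case True
        then show ?thesis
          using slope [of "a - t - 1" "a - t" a "a + t"] slope [of a "a + t" "a + t" "a + t + 1"]
          by (simp add: D_def algebra_simps)
      next
        case neg: False
        have "(B a - B (a + t)) / (- t) = (B (a + t) - B a) / t"
          using minus_divide_divide [of "B (a + t) - B a" t] by simp
        then show ?thesis
          using neg False slope [of "a + t - 1" "a + t" "a + t" a] slope [of "a + t" a "a - t" "a - t + 1"]
          by (simp add: D_def algebra_simps)
      qed
      then show "\<forall>\<^sub>F a in at_top. D (a + (- \<bar>t\<bar> - 1)) \<le> (B (a + t) - B a) / t"
        "\<forall>\<^sub>F a in at_top. (B (a + t) - B a) / t \<le> D (a + \<bar>t\<bar>)"
        by auto
    qed
    then have "((\<lambda>a. (B (a + t) - B a) / t * t) \<longlongrightarrow> k * t) at_top"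
      by (intro tendsto_intros)
    then show ?thesis
      using False by simp
  qed simp
  ultimately show ?thesis
    using that by blast
qed

context hadamard_pseudometric
begin

section \<open>Visibility under change of base point and ray; Busemann functions\<close>

lemma N_cong: "y \<in> N c T \<Longrightarrow> d y y' = 0 \<Longrightarrow> 0 \<le> T \<Longrightarrow> y' \<in> N c T"
  using pt_cong [of "c 0" "c 0" y y' T] d0_left [of "pt (c 0) y T" "pt (c 0) y' T" "c T"]
    d0_right [of y y' "c 0"] by (simp add: N_def)

lemma btw_cong: "btw x w y \<Longrightarrow> d x x' = 0 \<Longrightarrow> d w w' = 0 \<Longrightarrow> d y y' = 0 \<Longrightarrow> btw x' w' y'"
  unfolding btw_def using d0_cong [of x x' w w'] d0_cong [of w w' y y'] d0_cong [of x x' y y'] by simp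

lemma asym_of_zero: "(\<And>t. 0 \<le> t \<Longrightarrow> d (c t) (c' t) = 0) \<Longrightarrow> asym c c'"
  unfolding asym_def by (intro exI [of _ 0]) auto

lemma visD:
  assumes "vis c c'"
  shows "\<exists>R T. T > 0 \<and> (\<forall>x\<in>N c T. \<forall>y\<in>N c' T. \<exists>w. btw x w y \<and> d p w \<le> R)"
proof -
  obtain R T where T: "T > 0" "\<forall>x\<in>N c T. \<forall>y\<in>N c' T. \<exists>w. btw x w y \<and> d (c 0) w \<le> R"
    using assms unfolding vis_def by blast
  have "\<exists>w. btw x w y \<and> d p w \<le> d p (c 0) + R" if xy: "x \<in> N c T" "y \<in> N c' T" for x y
  proof -
    obtain w where w: "btw x w y" "d (c 0) w \<le> R"
      using T(2) xy by blast
    have "d p w \<le> d p (c 0) + R"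
      using tri [of p w "c 0"] w(2) by linarith
    with w(1) show ?thesis
      by blast
  qed
  with T(1) show ?thesis
    by blast
qed

lemma visI:
  assumes "ray c" "ray c'" and PQ: "eventually P (nb c)" "eventually Q (nb c')"
    and w: "\<And>x y. P x \<Longrightarrow> Q y \<Longrightarrow> \<exists>w. btw x w y \<and> d p w \<le> R"
  shows "vis c c'"
proof -
  obtain T T' where T: "T > 0" "\<forall>x\<in>N c T. P x" "T' > 0" "\<forall>y\<in>N c' T'. Q y"
    using PQ eventually_nb assms(1,2) by metis
  have "\<exists>w. btw x w y \<and> d (c 0) w \<le> d (c 0) p + R" if "x \<in> N c (max T T')" "y \<in> N c' (max T T')" for x y
  proof -
    have "P x" "Q y"
      using that N_mono [OF assms(1) T(1), of "max T T'"] N_mono [OF assms(2) T(3), of "max T T'"] T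
      by auto
    then obtain w where "btw x w y" "d p w \<le> R"
      using w by blast
    then show ?thesis
      using tri [of "c 0" w p] by (intro exI [of _ w]) simp
  qed
  moreover have "max T T' > 0"
    using T by simp
  ultimately show ?thesis
    unfolding vis_def by blast
qed

lemma vis_sym: assumes "vis c c'" "ray c" "ray c'" shows "vis c' c"
proof -
  obtain R T where T: "T > 0"
    "\<forall>x\<in>N c T. \<forall>y\<in>N c' T. \<exists>w. btw x w y \<and> d (c 0) w \<le> R"
    using assms(1) unfolding vis_def by blast
  show ?thesis
  proof (rule visI [OF assms(3,2) eventually_N [OF assms(3) T(1)] eventually_N [OF assms(2) T(1)]])
    show "\<exists>w. btw x w y \<and> d (c 0) w \<le> R" if "x \<in> N c' T" "y \<in> N c T" for x y
      using T(2) that btw_sym [of x _ y] by auto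
  qed
qed

lemma vis_cong:
  assumes "vis c c'" "ray c" "ray c'" "ray e" "asym c e"
  shows "vis e c'"
proof -
  obtain R T where T: "T > 0"
    "\<forall>x\<in>N c T. \<forall>y\<in>N c' T. \<exists>w. btw x w y \<and> d (c 0) w \<le> R"
    using assms(1) unfolding vis_def by blast
  have ev: "eventually (\<lambda>x. x \<in> N c T) (nb e)"
    using eventually_N [OF assms(2) T(1)] nb_cong [OF assms(2,4,5)] by simp
  show ?thesis
    by (rule visI [OF assms(4,3) ev eventually_N [OF assms(3) T(1)], where p = "c 0" and R = R])
      (use T(2) in blast)
qed

text \<open>The convergence of Busemann functions is uniform in the ray.\<close>

lemma busemann_estimate:
  assumes u: "d z p < u" "u \<le> d p y"
  shows "d z y - d p y \<le> d z (pt p y u) - u"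
    and "d z (pt p y u) - u \<le> d z y - d p y + (d z p)\<^sup>2 / (2 * (u - d z p))"
proof -
  define r t b m where "r = d z p" and "t = d p y" and "b = d z y - t" and "m = u / t"
  have r: "0 \<le> r" "r < u"
    using u by (auto simp: r_def)
  have u0: "0 \<le> u"
    using r by linarith
  have "d (pt p y u) y = d p y - u"
    using u u0 by (simp add: dist_pt)
  then show "d z y - d p y \<le> d z (pt p y u) - u"
    using tri [of z y "pt p y u"] by linarith
  have b: "\<bar>b\<bar> \<le> r"
    using abs_dist_diff [of z y p] by (simp add: b_def r_def t_def)
  have m: "0 \<le> m" "m \<le> 1" "m * t = u"
    using u u0 r by (auto simp: m_def t_def)
  have "d (pt p y u) (gp p y m) = 0"
    using u u0 m dist_pt [of u p y] unfolding t_def by (intro gp_unique) (auto simp: algebra_simps)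
  then have "(d z (pt p y u))\<^sup>2 = (d z (gp p y m))\<^sup>2"
    using d0_right by metis
  also have "\<dots> \<le> (1 - m) * r\<^sup>2 + m * (t + b)\<^sup>2 - m * (1 - m) * t\<^sup>2"
    using gp_cn [OF m(1,2), of z p y] by (simp add: r_def b_def t_def)
  also have "\<dots> = (1 - m) * r\<^sup>2 + m * b\<^sup>2 + (2 * (m * t) * b + (m * t)\<^sup>2)"
    by (simp add: algebra_simps power2_eq_square)
  also have "\<dots> = (1 - m) * r\<^sup>2 + m * b\<^sup>2 + (2 * u * b + u\<^sup>2)"
    unfolding m(3) ..
  also have "m * b\<^sup>2 \<le> m * r\<^sup>2"
    using m b r by (intro mult_left_mono) (auto simp: abs_le_square_iff [symmetric])
  also have "(1 - m) * r\<^sup>2 + m * r\<^sup>2 + (2 * u * b + u\<^sup>2) \<le> (u + b)\<^sup>2 + r\<^sup>2"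
    by (simp add: algebra_simps power2_eq_square)
  \<comment> \<open>Linearisation of the square root. The correction is bounded below in terms of
    \<open>u\<close> and \<open>r\<close> alone, and not of \<open>y\<close>; this is the
    uniformity.\<close>
  also have "\<dots> \<le> (u + b + r\<^sup>2 / (2 * (u + b)))\<^sup>2"
    using b r by (simp add: power2_sum)
  finally have "d z (pt p y u) \<le> u + b + r\<^sup>2 / (2 * (u + b))"
    using b r by (auto intro: power2_le_imp_le)
  also have "r\<^sup>2 / (2 * (u + b)) \<le> r\<^sup>2 / (2 * (u - r))"
    using b r by (intro divide_left_mono mult_pos_pos) auto
  finally show "d z (pt p y u) - u \<le> d z y - d p y + (d z p)\<^sup>2 / (2 * (u - d z p))"
    by (simp add: b_def t_def r_def)
qed

text \<open>\<open>d z (e u) - u\<close> does not increase with \<open>u\<close>, so the infimum is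
  the limit, see \<open>busemann_tendsto\<close>; as an infimum it is defined before convergence is
  proved.\<close>

definition busemann :: "(real \<Rightarrow> 'a) \<Rightarrow> 'a \<Rightarrow> real" where
  "busemann e z = (INF u\<in>{0..}. d z (e u) - u)"

lemma busemann_bounds:
  assumes e: "ray e"
  shows "0 \<le> u \<Longrightarrow> busemann e z \<le> d z (e u) - u"
    and "d z (e 0) < u \<Longrightarrow> d z (e u) - u \<le> busemann e z + (d z (e 0))\<^sup>2 / (2 * (u - d z (e 0)))"
proof -
  have dec: "d z (e u) - u \<le> d z (e v) - v" if "0 \<le> v" "v \<le> u" for u v
    using tri [of z "e u" "e v"] rayD [OF e, of v u] that by simp
  have low: "- d z (e 0) \<le> d z (e u) - u" if "0 \<le> u" for u
    using tri [of "e 0" "e u" z] rayD [OF e, of 0 u] that sym [of "e 0" z] by simp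
  show "busemann e z \<le> d z (e u) - u" if "0 \<le> u"
    unfolding busemann_def using low that by (intro cINF_lower bdd_belowI2 [of _ "- d z (e 0)"]) auto
  assume u: "d z (e 0) < u"
  then have u0: "0 < u"
    using nonneg [of z "e 0"] by linarith
  define E where "E = (d z (e 0))\<^sup>2 / (2 * (u - d z (e 0)))"
  have E: "0 \<le> E"
    using u by (simp add: E_def)
  have "d z (e u) - u \<le> d z (e v) - v + E" if v: "0 \<le> v" for v
  proof (cases "v \<le> u")
    case True
    then show ?thesis
      using dec [OF v True] E by linarith
  next
    case False
    have "d z (pt (e 0) (e v) u) - u \<le> d z (e v) - d (e 0) (e v) + E"
      unfolding E_def using u False u0 rayD [OF e, of 0 v] v by (intro busemann_estimate) auto
    moreover have "d z (pt (e 0) (e v) u) = d z (e u)"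
      using False u0 by (intro d0_right ray_pt e) auto
    ultimately show ?thesis
      using rayD [OF e, of 0 v] v by simp
  qed
  then have "d z (e u) - u - E \<le> busemann e z"
    unfolding busemann_def by (intro cINF_greatest) (auto simp: algebra_simps)
  then show "d z (e u) - u \<le> busemann e z + E"
    by simp
qed

text \<open>The geodesic from \<open>e 0\<close> to a point \<open>x\<close> of \<open>N e S\<close>
  follows the ray up to a time at which Busemann functions have nearly converged on the whole ball
  of radius \<open>R\<close>.\<close>

lemma busemann_uniform:
  assumes e: "ray e" and R: "0 \<le> R" and \<epsilon>: "0 < \<epsilon>"
  obtains S where "S > 0"
    "\<And>x z. x \<in> N e S \<Longrightarrow> d z (e 0) \<le> R \<Longrightarrow> \<bar>d z x - d (e 0) x - busemann e z\<bar> \<le> \<epsilon>"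
proof -
  \<comment> \<open>\<open>u\<close> makes the error of \<open>busemann_estimate\<close> on the ball
    at most \<open>\<epsilon> / 2\<close>; \<open>S\<close> makes the geodesic to \<open>x\<close>
    and the ray at most \<open>\<epsilon> / 2\<close> apart at time \<open>u\<close>.\<close>
  define u where "u = R + R\<^sup>2 / \<epsilon> + 1"
  define S where "S = u + 2 * u / \<epsilon>"
  have u: "R < u" "0 < u" "R\<^sup>2 \<le> \<epsilon> * (u - R)"
    using R \<epsilon> by (auto simp: u_def distrib_left add_nonneg_pos)
  have S: "0 < S" "u \<le> S" "u / S \<le> \<epsilon> / 2"
    using u \<epsilon> by (auto simp: S_def field_simps add_pos_pos)
  have "\<bar>d z x - d (e 0) x - busemann e z\<bar> \<le> \<epsilon>" if x: "x \<in> N e S" and z: "d z (e 0) \<le> R" for x z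
  proof -
    define E where "E = (d z (e 0))\<^sup>2 / (2 * (u - d z (e 0)))"
    have "E \<le> R\<^sup>2 / (2 * (u - R))"
      unfolding E_def using z u by (intro frac_le power_mono) auto
    also have "\<dots> \<le> \<epsilon> / 2"
      using u by (simp add: field_simps)
    finally have E: "E \<le> \<epsilon> / 2" .
    have xu: "u \<le> d (e 0) x"
      using x S by (simp add: N_def)
    have "d (pt (e 0) x u) (e u) \<le> u / S * d (pt (e 0) x S) (e S)"
      using x u S e by (intro ray_contract) (auto simp: N_def)
    also have "\<dots> \<le> u / S * 1"
      using x u S by (intro mult_left_mono) (auto simp: N_def)
    finally have near: "d (pt (e 0) x u) (e u) \<le> \<epsilon> / 2"
      using S by linarith
    have "\<bar>d z (pt (e 0) x u) - d z (e u)\<bar> \<le> \<epsilon> / 2"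
      using abs_dist_diff [of "pt (e 0) x u" z "e u"] near sym [of z "e u"] sym [of z "pt (e 0) x u"] by simp
    moreover have "d z x - d (e 0) x \<le> d z (pt (e 0) x u) - u"
      "d z (pt (e 0) x u) - u \<le> d z x - d (e 0) x + E"
      unfolding E_def using busemann_estimate [of z "e 0" u x] z u xu by linarith+
    moreover have "busemann e z \<le> d z (e u) - u" "d z (e u) - u \<le> busemann e z + E"
      unfolding E_def using busemann_bounds [OF e, where u = u and z = z] z u by linarith+
    ultimately show ?thesis
      using E by linarith
  qed
  then show ?thesis
    using that S(1) by blast
qed

lemma busemann_tendsto:
  assumes e: "ray e"
  shows "((\<lambda>u. d z (e u) - u) \<longlongrightarrow> busemann e z) at_top"
proof (rule tendsto_sandwich [of "\<lambda>_. busemann e z"])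
  let ?f = "\<lambda>u. busemann e z + (d z (e 0))\<^sup>2 / (2 * (u - d z (e 0)))"
  show "\<forall>\<^sub>F u in at_top. busemann e z \<le> d z (e u) - u"
    using eventually_ge_at_top [of 0] by eventually_elim (rule busemann_bounds [OF e])
  show "\<forall>\<^sub>F u in at_top. d z (e u) - u \<le> ?f u"
    using eventually_gt_at_top [of "d z (e 0)"] by eventually_elim (rule busemann_bounds [OF e])
  have "filterlim (\<lambda>u. 2 * (- d z (e 0) + u)) at_top at_top"
    by (intro filterlim_tendsto_pos_mult_at_top [OF tendsto_const] filterlim_ident
        filterlim_tendsto_add_at_top [OF tendsto_const]) simp
  then have "filterlim (\<lambda>u. 2 * (u - d z (e 0))) at_top at_top"
    by simp
  then have "((\<lambda>u. (d z (e 0))\<^sup>2 / (2 * (u - d z (e 0)))) \<longlongrightarrow> 0) at_top"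
    by (intro tendsto_divide_0 [OF tendsto_const] filterlim_at_top_imp_at_infinity)
  from tendsto_add [OF tendsto_const this] show "(?f \<longlongrightarrow> busemann e z) at_top"
    by simp
qed auto

text \<open>Both properties hold for the distance to \<open>e u\<close> and pass to the limit; they
  are the hypotheses of \<open>convex_asymptotic_slope\<close>.\<close>

lemma busemann_line:
  assumes e: "ray e" and l: "line \<sigma>"
  shows "convex_on UNIV (\<lambda>t. busemann e (\<sigma> t))" and "\<bar>busemann e (\<sigma> s) - busemann e (\<sigma> t)\<bar> \<le> \<bar>s - t\<bar>"
proof -
  show "convex_on UNIV (\<lambda>t. busemann e (\<sigma> t))"
  proof (rule convex_onI)
    fix t x y :: real assume t: "0 < t" "t < 1"
    have "d (\<sigma> ((1 - t) * x + t * y)) (gp (\<sigma> x) (\<sigma> y) t) = 0"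
    proof (rule gp_unique)
      have "x - ((1 - t) * x + t * y) = t * (x - y)" "(1 - t) * x + t * y - y = (1 - t) * (x - y)"
        by (simp_all add: algebra_simps)
      then show "d (\<sigma> x) (\<sigma> ((1 - t) * x + t * y)) \<le> t * d (\<sigma> x) (\<sigma> y)"
        "d (\<sigma> ((1 - t) * x + t * y)) (\<sigma> y) \<le> (1 - t) * d (\<sigma> x) (\<sigma> y)"
        using t unfolding lineD [OF l] by (simp_all add: abs_mult)
    qed (use t in auto)
    then have "d (\<sigma> ((1 - t) * x + t * y)) (e u) \<le> (1 - t) * d (\<sigma> x) (e u) + t * d (\<sigma> y) (e u)" for u
      using gp_convex_point [of t "e u" "\<sigma> x" "\<sigma> y"] t sym [of "e u" "\<sigma> x"] sym [of "e u" "\<sigma> y"]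
        sym [of "e u" "gp (\<sigma> x) (\<sigma> y) t"]
        d0_left [of "\<sigma> ((1 - t) * x + t * y)" "gp (\<sigma> x) (\<sigma> y) t" "e u"] by simp
    then have le: "d (\<sigma> ((1 - t) * x + t * y)) (e u) - u \<le>
        (1 - t) * (d (\<sigma> x) (e u) - u) + t * (d (\<sigma> y) (e u) - u)" for u
      by (simp add: algebra_simps)
    have "busemann e (\<sigma> ((1 - t) * x + t * y)) \<le> (1 - t) * busemann e (\<sigma> x) + t * busemann e (\<sigma> y)"
    proof (rule tendsto_le [OF trivial_limit_at_top_linorder])
      show "((\<lambda>u. d (\<sigma> ((1 - t) * x + t * y)) (e u) - u) \<longlongrightarrow> busemann e (\<sigma> ((1 - t) * x + t * y))) at_top"
        by (rule busemann_tendsto [OF e])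
      show "((\<lambda>u. (1 - t) * (d (\<sigma> x) (e u) - u) + t * (d (\<sigma> y) (e u) - u)) \<longlongrightarrow>
          (1 - t) * busemann e (\<sigma> x) + t * busemann e (\<sigma> y)) at_top"
        by (intro tendsto_intros busemann_tendsto e)
    qed (use le in auto)
    then show "busemann e (\<sigma> ((1 - t) *\<^sub>R x + t *\<^sub>R y)) \<le> (1 - t) * busemann e (\<sigma> x) + t * busemann e (\<sigma> y)"
      by simp
  qed simp
  show "\<bar>busemann e (\<sigma> s) - busemann e (\<sigma> t)\<bar> \<le> \<bar>s - t\<bar>"
  proof (rule tendsto_le [OF trivial_limit_at_top_linorder tendsto_const])
    show "((\<lambda>u. \<bar>(d (\<sigma> s) (e u) - u) - (d (\<sigma> t) (e u) - u)\<bar>) \<longlongrightarrow> \<bar>busemann e (\<sigma> s) - busemann e (\<sigma> t)\<bar>) at_top"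
      by (intro tendsto_intros busemann_tendsto e)
    show "\<forall>\<^sub>F u in at_top. \<bar>(d (\<sigma> s) (e u) - u) - (d (\<sigma> t) (e u) - u)\<bar> \<le> \<bar>s - t\<bar>"
      using abs_dist_diff [of "\<sigma> s" _ "\<sigma> t"] by (simp add: lineD [OF l])
  qed
qed

lemma btw_le: "btw x w y \<Longrightarrow> d x w \<le> d x y"
  using nonneg [of w y] unfolding btw_def by linarith

lemma half_plane_reverse:
  assumes "half_plane (\<lambda>t. \<sigma> (- t))"
  shows "half_plane \<sigma>"
proof -
  obtain F where F: "\<forall>v\<ge>0. \<forall>v'\<ge>0. \<forall>u u'. d (F v u) (F v' u') = sqrt ((v - v')\<^sup>2 + (u - u')\<^sup>2)"
      "\<forall>u. d (F 0 u) (\<sigma> (- u)) = 0"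
    using assms unfolding half_plane_def by blast
  have "d (F 0 (- u)) (\<sigma> u) = 0" for u
    using F(2) [rule_format, of "- u"] by simp
  moreover have "\<forall>v\<ge>0. \<forall>v'\<ge>0. \<forall>u u'. d (F v (- u)) (F v' (- u')) = sqrt ((v - v')\<^sup>2 + (u - u')\<^sup>2)"
    using F(1) by (simp add: power2_commute)
  ultimately show ?thesis
    unfolding half_plane_def by (intro exI [of _ "\<lambda>v u. F v (- u)"]) blast
qed

end

section \<open>Isometries with an axis that bounds no flat half plane\<close>

text \<open>The identity acts up to distance 0 only: in the application it retracts the type onto
  the space.\<close>

locale isometric_action = proper_hadamard_pseudometric d + group G
  for d :: "'a \<Rightarrow> 'a \<Rightarrow> real" and G :: "('g, 'm) monoid_scheme" (structure) +
  fixes \<alpha> :: "'g \<Rightarrow> 'a \<Rightarrow> 'a"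
  assumes iso: "g \<in> carrier G \<Longrightarrow> d (\<alpha> g x) (\<alpha> g y) = d x y"
    and mult: "g \<in> carrier G \<Longrightarrow> h \<in> carrier G \<Longrightarrow> \<alpha> (g \<otimes> h) x = \<alpha> g (\<alpha> h x)"
    and one: "d (\<alpha> \<one> x) x = 0"
begin

lemma inv_left: "g \<in> carrier G \<Longrightarrow> d (\<alpha> (inv g) (\<alpha> g x)) x = 0"
  using one by (simp flip: mult)

lemma inv_right: "g \<in> carrier G \<Longrightarrow> d (\<alpha> g (\<alpha> (inv g) x)) x = 0"
  using one by (simp flip: mult)

lemma dist_move:
  assumes "g \<in> carrier G"
  shows "d (\<alpha> g x) y = d x (\<alpha> (inv g) y)" and "d (\<alpha> (inv g) x) y = d x (\<alpha> g y)"
  using iso [of "inv g" "\<alpha> g x" y] d0_left [OF inv_left [OF assms], of x "\<alpha> (inv g) y"]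
    iso [of g "\<alpha> (inv g) x" y] d0_left [OF inv_right [OF assms], of x "\<alpha> g y"] assms by auto

lemma ray_act: "g \<in> carrier G \<Longrightarrow> ray c \<Longrightarrow> ray (\<lambda>t. \<alpha> g (c t))"
  and line_act: "g \<in> carrier G \<Longrightarrow> line c \<Longrightarrow> line (\<lambda>t. \<alpha> g (c t))"
  and asym_act: "g \<in> carrier G \<Longrightarrow> asym c c' \<Longrightarrow> asym (\<lambda>t. \<alpha> g (c t)) (\<lambda>t. \<alpha> g (c' t))"
  and btw_act: "g \<in> carrier G \<Longrightarrow> btw x w y \<Longrightarrow> btw (\<alpha> g x) (\<alpha> g w) (\<alpha> g y)"
  by (simp_all add: ray_def line_def asym_def btw_def iso)

lemma pt_act:
  assumes g: "g \<in> carrier G" and s: "0 \<le> s"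
  shows "d (\<alpha> g (pt x y s)) (pt (\<alpha> g x) (\<alpha> g y) s) = 0"
proof (cases "s \<le> d x y")
  case True
  then show ?thesis
    using g s dist_pt [OF s, of x y] by (intro pt_unique) (auto simp: iso)
next
  case False
  then show ?thesis
    using g by (simp add: pt_def iso)
qed

lemma N_act:
  assumes g: "g \<in> carrier G" and T: "0 \<le> T"
  shows "\<alpha> g x \<in> N (\<lambda>t. \<alpha> g (c t)) T \<longleftrightarrow> x \<in> N c T"
  using d0_left [OF pt_act [OF g T, of "c 0" x], of "\<alpha> g (c T)"] g by (simp add: N_def iso)

lemma eventually_nb_act:
  assumes g: "g \<in> carrier G" and c: "ray c" and T: "0 \<le> T"
    and ev: "eventually (\<lambda>x. \<alpha> g x \<in> N e T) (nb c)"
  shows "eventually (\<lambda>x. x \<in> N e T) (nb (\<lambda>t. \<alpha> g (c t)))"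
proof -
  obtain S where S: "S > 0" "\<forall>x\<in>N c S. \<alpha> g x \<in> N e T"
    using ev eventually_nb [OF c] by blast
  have "y \<in> N e T" if y: "y \<in> N (\<lambda>t. \<alpha> g (c t)) S" for y
  proof -
    let ?x = "\<alpha> (inv g) y"
    have 0: "d y (\<alpha> g ?x) = 0"
      using inv_right [OF g, of y] sym [of y "\<alpha> g ?x"] by simp
    have "\<alpha> g ?x \<in> N (\<lambda>t. \<alpha> g (c t)) S"
      using N_cong [OF y 0] S(1) by simp
    then have "\<alpha> g ?x \<in> N e T"
      using S N_act [OF g, of S ?x c] by simp
    then show ?thesis
      using N_cong [of "\<alpha> g ?x" e T y] 0 sym [of y "\<alpha> g ?x"] T by simp
  qed
  then show ?thesis
    using eventually_nb [OF ray_act [OF g c]] S(1) by blast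
qed

lemma filterlim_act:
  assumes g: "g \<in> carrier G" and c: "ray c"
  shows "filterlim (\<alpha> g) (nb (\<lambda>t. \<alpha> g (c t))) (nb c)"
  unfolding filterlim_iff
proof (intro allI impI)
  fix P assume "eventually P (nb (\<lambda>t. \<alpha> g (c t)))"
  then obtain T where T: "T > 0" "\<forall>y\<in>N (\<lambda>t. \<alpha> g (c t)) T. P y"
    using eventually_nb [OF ray_act [OF g c]] by blast
  have "P (\<alpha> g x)" if "x \<in> N c T" for x
    using T that N_act [OF g, of T x c] by simp
  then show "eventually (\<lambda>x. P (\<alpha> g x)) (nb c)"
    using eventually_nb [OF c] T(1) by blast
qed

lemma half_plane_act:
  assumes g: "g \<in> carrier G" and hp: "half_plane (\<lambda>t. \<alpha> g (\<sigma> t))"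
  shows "half_plane \<sigma>"
proof -
  obtain F where F: "\<forall>v\<ge>0. \<forall>v'\<ge>0. \<forall>u u'. d (F v u) (F v' u') = sqrt ((v - v')\<^sup>2 + (u - u')\<^sup>2)"
      "\<forall>u. d (F 0 u) (\<alpha> g (\<sigma> u)) = 0"
    using hp unfolding half_plane_def by blast
  have "d (\<alpha> (inv g) (F 0 u)) (\<sigma> u) = 0" for u
    using F(2) g by (simp add: dist_move)
  moreover have "\<forall>v\<ge>0. \<forall>v'\<ge>0. \<forall>u u'. d (\<alpha> (inv g) (F v u)) (\<alpha> (inv g) (F v' u')) =
      sqrt ((v - v')\<^sup>2 + (u - u')\<^sup>2)"
    using F(1) g by (simp add: iso)
  ultimately show ?thesis
    unfolding half_plane_def by (intro exI [of _ "\<lambda>v u. \<alpha> (inv g) (F v u)"]) blast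
qed

section \<open>Axes, and the dynamics of their translations on the boundary\<close>

definition axis :: "'g \<Rightarrow> (real \<Rightarrow> 'a) \<Rightarrow> real \<Rightarrow> bool" where
  "axis g \<sigma> l \<longleftrightarrow> line \<sigma> \<and> 0 < l \<and> (\<forall>t. d (\<alpha> g (\<sigma> t)) (\<sigma> (t + l)) = 0)"

lemma axis_shift:
  assumes g: "g \<in> carrier G" and ax: "axis g \<sigma> l"
  shows "d (\<alpha> (g [^] n) (\<sigma> t)) (\<sigma> (t + real n * l)) = 0"
proof (induction n arbitrary: t)
  case 0
  then show ?case
    using one by simp
next
  case (Suc n)
  have "\<alpha> (g [^] Suc n) (\<sigma> t) = \<alpha> (g [^] n) (\<alpha> g (\<sigma> t))"
    using g by (simp add: mult)
  moreover have "d (\<alpha> (g [^] n) (\<alpha> g (\<sigma> t))) (\<alpha> (g [^] n) (\<sigma> (t + l))) = 0"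
    using g ax by (simp add: iso axis_def)
  ultimately have "d (\<alpha> (g [^] Suc n) (\<sigma> t)) (\<sigma> (t + l + real n * l)) = 0"
    using Suc.IH [of "t + l"] d0_left [of "\<alpha> (g [^] n) (\<alpha> g (\<sigma> t))"] by simp
  then show ?case
    by (simp add: algebra_simps)
qed

lemma axis_pow: "g \<in> carrier G \<Longrightarrow> axis g \<sigma> l \<Longrightarrow> 0 < n \<Longrightarrow> axis (g [^] n) \<sigma> (real n * l)"
  using axis_shift [of g \<sigma> l n] by (simp add: axis_def)

lemma axis_inv: assumes "g \<in> carrier G" "axis g \<sigma> l" shows "axis (inv g) (\<lambda>t. \<sigma> (- t)) l"
proof -
  have "d (\<alpha> (inv g) (\<sigma> (- t))) (\<sigma> (- (t + l))) = 0" for t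
  proof -
    have "d (\<alpha> g (\<sigma> (- (t + l)))) (\<sigma> (- (t + l) + l)) = 0"
      using assms(2) unfolding axis_def by blast
    moreover have "- (t + l) + l = - t"
      by simp
    ultimately show ?thesis
      using assms(1) sym [of "\<sigma> (- t)" "\<alpha> g (\<sigma> (- (t + l)))"] by (simp only: dist_move)
  qed
  then show ?thesis
    using assms line_reverse by (simp add: axis_def)
qed

lemma axis_conj:
  assumes "g \<in> carrier G" "k \<in> carrier G" "axis g \<sigma> l"
  shows "axis (k \<otimes> g \<otimes> inv k) (\<lambda>t. \<alpha> k (\<sigma> t)) l"
proof -
  have "d (\<alpha> (k \<otimes> g \<otimes> inv k) (\<alpha> k (\<sigma> t))) (\<alpha> k (\<sigma> (t + l))) = 0" for t
  proof -
    have "d (\<alpha> k (\<alpha> g (\<alpha> (inv k) (\<alpha> k (\<sigma> t))))) (\<alpha> k (\<alpha> g (\<sigma> t))) = 0"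
      using assms inv_left [of k "\<sigma> t"] by (simp add: iso)
    moreover have "d (\<alpha> k (\<alpha> g (\<sigma> t))) (\<alpha> k (\<sigma> (t + l))) = 0"
      using assms by (simp add: iso axis_def)
    ultimately show ?thesis
      using assms d0_left [of "\<alpha> k (\<alpha> g (\<alpha> (inv k) (\<alpha> k (\<sigma> t))))" "\<alpha> k (\<alpha> g (\<sigma> t))"] by (simp add: mult)
  qed
  then show ?thesis
    using assms line_act by (simp add: axis_def)
qed

lemma asym_axis_pow:
  fixes n :: nat
  assumes g: "g \<in> carrier G" and ax: "axis g \<sigma> l"
  shows "asym (\<lambda>t. \<alpha> (inv (g [^] n)) (\<sigma> t)) \<sigma>"
  unfolding asym_def
proof (intro exI allI impI)
  fix t :: real
  have "d (\<alpha> (inv (g [^] n)) (\<sigma> t)) (\<sigma> t) = d (\<sigma> t) (\<sigma> (t + real n * l))"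
    using g d0_right [OF axis_shift [OF g ax, of n t], of "\<sigma> t"] by (simp add: dist_move)
  then show "d (\<alpha> (inv (g [^] n)) (\<sigma> t)) (\<sigma> t) \<le> real n * l"
    using ax by (simp add: axis_def line_def)
qed

text \<open>Along the axis, the Busemann function of the ray is asymptotically affine with some slope
  \<open>\<kappa>\<close>. Pulling the ray back by large powers, the three cases \<open>\<bar>\<kappa>\<bar> < 1\<close>, \<open>\<kappa> = 1\<close> and
  \<open>\<kappa> = -1\<close> give a flat half plane, convergence to the repelling end, and a ray asymptotic to the axis.\<close>

lemma attract_backward:
  assumes g: "g \<in> carrier G" and ax: "axis g \<sigma> l" and nh: "\<not> half_plane \<sigma>"
    and e: "ray e" "\<not> asym e \<sigma>" and T: "T > 0"
  shows "\<exists>n::nat. eventually (\<lambda>x. \<alpha> (inv (g [^] n)) x \<in> N (\<lambda>t. \<sigma> (- t)) T) (nb e)"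
proof (rule ccontr)
  let ?\<sigma>' = "\<lambda>t. \<sigma> (- t)"
  have l: "line \<sigma>" "0 < l"
    using ax by (auto simp: axis_def)
  have r: "ray \<sigma>" "ray ?\<sigma>'"
    using l line_ray line_reverse by blast+
  obtain f where f: "ray f" "f 0 = \<sigma> 0" "asym e f"
    using ray_from [OF e(1)] by blast
  have nb: "nb e = nb f"
    by (rule nb_cong [OF e(1) f(1,3)])
  have nf: "\<not> asym f \<sigma>"
    using e(2) f(3) asym_trans by blast
  assume "\<not> ?thesis"
  then have no: "\<exists>x\<in>N f S. \<alpha> (inv (g [^] n)) x \<notin> N ?\<sigma>' T" if "S > 0" for n :: nat and S
    unfolding nb eventually_nb [OF f(1)] using that by blast
  \<comment> \<open>At stage \<open>n\<close> the estimate has to cover a window of width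
    \<open>n\<close> around \<open>\<sigma> (n * l)\<close>, which the inverse of the
    \<open>n\<close>-th power of \<open>g\<close> moves to \<open>\<sigma> 0\<close>.\<close>
  define Q where "Q n S \<longleftrightarrow> S > 0 \<and> (\<forall>x\<in>N f S. \<forall>z. d z (f 0) \<le> real n * l + real n \<longrightarrow>
      \<bar>d z x - d (f 0) x - busemann f z\<bar> \<le> 1 / (real n + 1))" for n :: nat and S
  have "\<exists>S. Q n S" for n
  proof -
    have "0 \<le> real n * l + real n" "0 < 1 / (real n + 1)"
      using l(2) by auto
    then show ?thesis
      unfolding Q_def by (rule busemann_uniform [OF f(1)]) blast
  qed
  then obtain S where Q: "\<And>n. Q n (S n)"
    by metis
  have S: "S n > 0" "x \<in> N f (S n) \<Longrightarrow> d z (f 0) \<le> real n * l + real n \<Longrightarrow>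
      \<bar>d z x - d (f 0) x - busemann f z\<bar> \<le> 1 / (real n + 1)" for n x z
    using Q [of n] unfolding Q_def by blast+
  \<comment> \<open>The second bound sends the pulled back points to infinity: \<open>x n\<close> is
    farther from \<open>\<sigma> 0\<close> than \<open>\<sigma> (n * l)\<close> is, by at least
    \<open>n + 1\<close>.\<close>
  define S' where "S' n = max (S n) (real n * l + real n + 1)" for n
  have S': "S' n > 0" "S n \<le> S' n" "real n * l + real n + 1 \<le> S' n" for n
    using S(1) [of n] by (auto simp: S'_def less_max_iff_disj)
  have "\<exists>x. x \<in> N f (S' n) \<and> \<alpha> (inv (g [^] n)) x \<notin> N ?\<sigma>' T" for n
    using no [OF S'(1)] by blast
  then obtain x where x: "\<And>n. x n \<in> N f (S' n)" "\<And>n. \<alpha> (inv (g [^] n)) (x n) \<notin> N ?\<sigma>' T"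
    by metis
  have xS: "x n \<in> N f (S n)" for n
    using x(1) N_mono [OF f(1) S(1) S'(2)] by blast
  define p where "p n = \<alpha> (inv (g [^] n)) (x n)" for n
  define B where "B t = busemann f (\<sigma> t)" for t
  have dp: "d (\<sigma> t) (p n) = d (\<sigma> (t + real n * l)) (x n)" for t n
    using g d0_left [OF axis_shift [OF g ax, of n t], of "x n"] sym [of "\<sigma> t" "p n"] sym [of "x n"]
    by (simp add: p_def dist_move)
  have near: "\<bar>d (\<sigma> t) (x n) - d (f 0) (x n) - B t\<bar> \<le> 1 / (real n + 1)" if "\<bar>t\<bar> \<le> real n * l + real n" for t n
    unfolding B_def using that lineD [OF l(1), of t 0] f(2) by (intro S(2) xS) simp
  obtain k where k: "\<bar>k\<bar> \<le> 1" "\<And>t. ((\<lambda>a. B (a + t) - B a) \<longlongrightarrow> k * t) at_top"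
    using convex_asymptotic_slope [of B] busemann_line [OF f(1) l(1)] unfolding B_def by blast
  have seq: "filterlim (\<lambda>n. real n * l) at_top sequentially"
    by (intro filterlim_at_top_mult_tendsto_pos [OF tendsto_const l(2)] filterlim_real_sequentially)
  \<comment> \<open>Distances to \<open>p n\<close> near \<open>\<sigma> 0\<close> are distances to
    \<open>x n\<close> near \<open>\<sigma> (n * l)\<close>, hence governed by the Busemann function
    far out on the axis.\<close>
  have aff: "(\<lambda>n. d (\<sigma> t) (p n) - d (\<sigma> 0) (p n)) \<longlonglongrightarrow> k * t" for t
  proof -
    have 1: "(\<lambda>n. B (real n * l + t) - B (real n * l)) \<longlonglongrightarrow> k * t"
      by (rule filterlim_compose [OF k(2) seq])
    have 2: "(\<lambda>n. (d (\<sigma> t) (p n) - d (\<sigma> 0) (p n)) - (B (real n * l + t) - B (real n * l))) \<longlonglongrightarrow> 0"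
    proof (rule Lim_null_comparison)
      have "eventually (\<lambda>n. \<bar>t\<bar> \<le> real n) sequentially"
        using filterlim_real_sequentially unfolding filterlim_at_top by blast
      then show "eventually (\<lambda>n. norm ((d (\<sigma> t) (p n) - d (\<sigma> 0) (p n)) -
          (B (real n * l + t) - B (real n * l))) \<le> 2 * (1 / (real n + 1))) sequentially"
      proof eventually_elim
        case (elim n)
        have nl: "0 \<le> real n * l"
          using l by simp
        have "\<bar>d (\<sigma> (real n * l + t)) (x n) - d (f 0) (x n) - B (real n * l + t)\<bar> \<le> 1 / (real n + 1)"
          "\<bar>d (\<sigma> (real n * l)) (x n) - d (f 0) (x n) - B (real n * l)\<bar> \<le> 1 / (real n + 1)"
          using elim nl by (intro near; linarith)+
        then show ?case
          unfolding dp real_norm_def by (simp add: add.commute)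
      qed
      have "(\<lambda>n. 1 / (real n + 1)) \<longlonglongrightarrow> 0"
        using LIMSEQ_inverse_real_of_nat by (simp add: inverse_eq_divide add.commute)
      then show "(\<lambda>n. 2 * (1 / (real n + 1))) \<longlonglongrightarrow> 0"
        using tendsto_mult_left [of _ 0 sequentially "2 :: real"] by fastforce
    qed
    show ?thesis
      using tendsto_add [OF 2 1] by simp
  qed
  have far: "filterlim (\<lambda>n. d (\<sigma> 0) (p n)) at_top sequentially"
  proof (rule filterlim_at_top_mono [OF filterlim_real_sequentially], intro always_eventually allI)
    fix n
    have "S' n \<le> d (\<sigma> 0) (x n)"
      using x(1) [of n] f(2) by (simp add: N_def)
    moreover have "d (\<sigma> 0) (\<sigma> (real n * l)) = real n * l"
      using lineD [OF l(1)] l(2) by simp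
    ultimately show "real n \<le> d (\<sigma> 0) (p n)"
      using S'(3) [of n] tri [of "\<sigma> 0" "x n" "\<sigma> (real n * l)"] dp [of 0 n] by simp
  qed
  obtain q c where q: "strict_mono q" and c: "ray c" "c 0 = \<sigma> 0" "filterlim (\<lambda>n. p (q n)) (nb c) sequentially"
    using compactify [OF far] by blast
  have affq: "(\<lambda>n. d (\<sigma> t) (p (q n)) - d (\<sigma> 0) (p (q n))) \<longlonglongrightarrow> k * t" for t
    using LIMSEQ_subseq_LIMSEQ [OF aff q] by (simp add: o_def)
  consider "\<bar>k\<bar> < 1" | "k = 1" | "k = - 1"
    using k(1) by linarith
  then show False
  proof cases
    case 1
    then have "half_plane \<sigma>"
      using half_plane_of_affine [OF l(1) far, of "- k"] aff by simp
    with nh show False ..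
  next
    case 2
    have "d (c s) (?\<sigma>' s) = 0" if "0 \<le> s" for s
      using that c 2 affq by (intro end_of_affine [OF line_reverse [OF l(1)] c(1) _ c(3)]) auto
    then have "nb c = nb ?\<sigma>'"
      by (intro nb_cong c r asym_of_zero)
    then have "eventually (\<lambda>n. p (q n) \<in> N ?\<sigma>' T) sequentially"
      using c(3) eventually_compose_filterlim [OF eventually_N [OF r(2) T], of "\<lambda>n. p (q n)"] by simp
    then show False
      using x(2) unfolding p_def by simp
  next
    case 3
    have "d (c s) (\<sigma> s) = 0" if "0 \<le> s" for s
      using that c 3 affq by (intro end_of_affine [OF l(1) c(1) _ c(3)]) auto
    then have "nb c = nb \<sigma>"
      by (intro nb_cong c r asym_of_zero)
    then have lim: "filterlim (\<lambda>n. p (q n)) (nb \<sigma>) sequentially"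
      using c(3) by simp
    obtain R T0 where T0: "T0 > 0" and vis: "\<forall>x\<in>N ?\<sigma>' T0. \<forall>y\<in>N \<sigma> T0. \<exists>w. btw x w y \<and> d (\<sigma> 0) w \<le> R"
      using visD [OF vis_line [OF l(1) nh]] by blast
    \<comment> \<open>Visibility of the two ends of the axis gives a point \<open>w\<close> near
      \<open>\<sigma> 0\<close> between \<open>\<sigma> (- L)\<close> and \<open>p n\<close>. The
      \<open>n\<close>-th power of \<open>g\<close> moves it near \<open>\<sigma> L\<close>, onto a
      geodesic from \<open>\<sigma> 0\<close> to \<open>x n\<close>, and this geodesic passes near
      \<open>f L\<close>.\<close>
    have "d (f s) (\<sigma> s) \<le> 2 * R + 1" if s: "0 \<le> s" for s
    proof -
      have "eventually (\<lambda>n. p (q n) \<in> N \<sigma> T0) sequentially"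
        by (rule eventually_compose_filterlim [OF eventually_N [OF r(1) T0] lim])
      moreover have "eventually (\<lambda>n. max (s + 1) T0 \<le> real (q n) * l) sequentially"
        using filterlim_compose [OF seq filterlim_subseq [OF q]] unfolding filterlim_at_top by blast
      ultimately have "eventually (\<lambda>n. p (q n) \<in> N \<sigma> T0 \<and> max (s + 1) T0 \<le> real (q n) * l) sequentially"
        by (rule eventually_conj)
      then obtain j where j: "p (q j) \<in> N \<sigma> T0" "max (s + 1) T0 \<le> real (q j) * l"
        using eventually_happens' [OF sequentially_bot] by blast
      define n L where "n = q j" and "L = real n * l"
      have L: "s + 1 \<le> L" "T0 \<le> L" "0 < L"
        using j T0 by (auto simp: n_def L_def)
      have "?\<sigma>' L \<in> N ?\<sigma>' T0"
        using ray_in_N [OF r(2) T0 L(2)] .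
      then obtain w where w: "btw (\<sigma> (- L)) w (p n)" "d (\<sigma> 0) w \<le> R"
        using vis j(1) unfolding n_def by blast
      let ?w = "\<alpha> (g [^] n) w"
      have w': "btw (\<sigma> 0) ?w (x n)"
      proof (rule btw_cong)
        show "btw (\<alpha> (g [^] n) (\<sigma> (- L))) ?w (\<alpha> (g [^] n) (p n))"
          using g w by (intro btw_act) auto
        show "d (\<alpha> (g [^] n) (\<sigma> (- L))) (\<sigma> 0) = 0"
          using axis_shift [OF g ax, of n "- L"] by (simp add: L_def)
        show "d (\<alpha> (g [^] n) (p n)) (x n) = 0"
          unfolding p_def using g by (intro inv_right) auto
      qed simp
      have wL: "d ?w (\<sigma> L) \<le> R"
      proof -
        have "d (\<alpha> (g [^] n) (\<sigma> 0)) (\<sigma> L) = 0"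
          using axis_shift [OF g ax, of n 0] by (simp add: L_def)
        then have "d ?w (\<alpha> (g [^] n) (\<sigma> 0)) = d ?w (\<sigma> L)"
          by (rule d0_right)
        then show ?thesis
          using w(2) g iso [of "g [^] n" w "\<sigma> 0"] sym [of w "\<sigma> 0"] by simp
      qed
      have "d ?w (pt (\<sigma> 0) (x n) (d (\<sigma> 0) ?w)) = 0"
        using w' btw_le [OF w'] unfolding btw_def by (intro pt_unique) auto
      moreover have xf: "x n \<in> N f L"
        using x(1) [of n] N_mono [OF f(1) L(3), of "S' n"] S'(3) [of n] by (auto simp: L_def)
      moreover have "\<bar>d (\<sigma> 0) ?w - L\<bar> \<le> R"
        using abs_dist_diff [of ?w "\<sigma> 0" "\<sigma> L"] wL lineD [OF l(1), of L 0] L sym [of "\<sigma> 0" ?w] by simp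
      moreover have "d (pt (\<sigma> 0) (x n) (d (\<sigma> 0) ?w)) (pt (\<sigma> 0) (x n) L) = \<bar>d (\<sigma> 0) ?w - L\<bar>"
        using xf f(2) L btw_le [OF w'] by (intro dist_pt_pt) (auto simp: N_def)
      ultimately have "d ?w (pt (\<sigma> 0) (x n) L) \<le> R"
        using d0_left [of ?w "pt (\<sigma> 0) (x n) (d (\<sigma> 0) ?w)" "pt (\<sigma> 0) (x n) L"] by simp
      moreover have "d (pt (\<sigma> 0) (x n) L) (f L) \<le> 1"
        using xf f(2) by (simp add: N_def)
      ultimately have *: "d (f L) (\<sigma> L) \<le> 2 * R + 1"
        using wL tri [of "f L" "\<sigma> L" "pt (\<sigma> 0) (x n) L"] tri [of "pt (\<sigma> 0) (x n) L" "\<sigma> L" ?w]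
          sym [of "f L" "pt (\<sigma> 0) (x n) L"] sym [of "pt (\<sigma> 0) (x n) L" ?w] by linarith
      have "d (f s) (\<sigma> s) \<le> s / L * d (f L) (\<sigma> L)"
        using r f s L by (intro rays_contract) auto
      also have "\<dots> \<le> 1 * d (f L) (\<sigma> L)"
        using L s by (intro mult_right_mono) auto
      finally show ?thesis
        using * by simp
    qed
    then have "asym f \<sigma>"
      unfolding asym_def by blast
    with nf show False ..
  qed
qed

text \<open>A negative power of \<open>g\<close> moves points near the end of \<open>e\<close> close
  to the repelling end of the axis and fixes the attracting end. There visibility is that of the two
  ends of the axis, by \<open>vis_line\<close>; it is then transported back.\<close>

lemma vis_axis:
  assumes g: "g \<in> carrier G" and ax: "axis g \<sigma> l" and nh: "\<not> half_plane \<sigma>"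
    and e: "ray e" "\<not> asym e \<sigma>"
  shows "vis e \<sigma>"
proof -
  have l: "line \<sigma>"
    using ax by (auto simp: axis_def)
  have r: "ray \<sigma>"
    using l line_ray by blast
  obtain R T where T: "T > 0" and vis: "\<forall>x\<in>N (\<lambda>t. \<sigma> (- t)) T. \<forall>y\<in>N \<sigma> T. \<exists>w. btw x w y \<and> d (\<sigma> 0) w \<le> R"
    using visD [OF vis_line [OF l nh]] by blast
  obtain n :: nat where n: "eventually (\<lambda>x. \<alpha> (inv (g [^] n)) x \<in> N (\<lambda>t. \<sigma> (- t)) T) (nb e)"
    using attract_backward [OF g ax nh e T] by blast
  define h where "h = inv (g [^] n)"
  have h: "h \<in> carrier G"
    using g by (simp add: h_def)
  have "nb (\<lambda>t. \<alpha> h (\<sigma> t)) = nb \<sigma>"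
    unfolding h_def using g by (intro nb_cong ray_act r asym_axis_pow [OF g ax]) auto
  then have m: "eventually (\<lambda>y. \<alpha> h y \<in> N \<sigma> T) (nb \<sigma>)"
    using filterlim_act [OF h r] eventually_compose_filterlim [OF eventually_N [OF r T], of "\<alpha> h"] by simp
  show ?thesis
  proof (rule visI [OF e(1) r n m])
    fix x y assume "\<alpha> (inv (g [^] n)) x \<in> N (\<lambda>t. \<sigma> (- t)) T" "\<alpha> h y \<in> N \<sigma> T"
    then obtain w where w: "btw (\<alpha> h x) w (\<alpha> h y)" "d (\<sigma> 0) w \<le> R"
      using vis h_def by blast
    have "btw x (\<alpha> (inv h) w) y"
      by (rule btw_cong [OF btw_act [OF _ w(1), of "inv h"]]) (use h inv_left in auto)
    moreover have "d (\<alpha> (inv h) (\<sigma> 0)) (\<alpha> (inv h) w) \<le> R"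
      using w(2) h by (simp add: iso)
    ultimately show "\<exists>w. btw x w y \<and> d (\<alpha> (inv h) (\<sigma> 0)) w \<le> R"
      by blast
  qed
qed

lemma asym_act_pow:
  fixes n :: nat
  assumes g: "g \<in> carrier G" and e: "asym (\<lambda>t. \<alpha> g (e t)) e"
  shows "asym (\<lambda>t. \<alpha> (inv (g [^] n)) (e t)) e"
proof -
  have "asym (\<lambda>t. \<alpha> (g [^] n) (e t)) e" for n :: nat
  proof (induction n)
    case 0
    show ?case
      using one by (intro asym_of_zero) simp
  next
    case (Suc n)
    have "asym (\<lambda>t. \<alpha> (g [^] Suc n) (e t)) (\<lambda>t. \<alpha> (g [^] n) (e t))"
      using asym_act [OF _ e, of "g [^] n"] g by (simp add: mult)
    with Suc.IH show ?case
      using asym_trans by blast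
  qed
  then have "asym (\<lambda>t. \<alpha> (inv (g [^] n)) (\<alpha> (g [^] n) (e t))) (\<lambda>t. \<alpha> (inv (g [^] n)) (e t))"
    using g by (intro asym_act) auto
  moreover have "asym (\<lambda>t. \<alpha> (inv (g [^] n)) (\<alpha> (g [^] n) (e t))) e"
    using g by (intro asym_of_zero inv_left) auto
  ultimately show ?thesis
    using asym_trans asym_sym by blast
qed

text \<open>Unless it is the attracting end, a boundary point is moved by negative powers into every
  neighbourhood of the repelling end; if it is fixed, it lies in all of them.\<close>

lemma axis_fixed_end:
  assumes g: "g \<in> carrier G" and ax: "axis g \<sigma> l" and nh: "\<not> half_plane \<sigma>"
    and e: "ray e" "asym (\<lambda>t. \<alpha> g (e t)) e"
  shows "asym e \<sigma> \<or> asym e (\<lambda>t. \<sigma> (- t))"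
proof (rule disjCI)
  assume ne: "\<not> asym e (\<lambda>t. \<sigma> (- t))"
  have r: "ray (\<lambda>t. \<sigma> (- t))"
    using ax line_ray line_reverse unfolding axis_def by blast
  show "asym e \<sigma>"
  proof (rule ccontr)
    assume e\<sigma>: "\<not> asym e \<sigma>"
    have "eventually (\<lambda>y. y \<in> N (\<lambda>t. \<sigma> (- t)) T) (nb e)" if T: "T > 0" for T
    proof -
      obtain n :: nat where n: "eventually (\<lambda>x. \<alpha> (inv (g [^] n)) x \<in> N (\<lambda>t. \<sigma> (- t)) T) (nb e)"
        using attract_backward [OF g ax nh e(1) e\<sigma> T] by blast
      have "eventually (\<lambda>x. x \<in> N (\<lambda>t. \<sigma> (- t)) T) (nb (\<lambda>t. \<alpha> (inv (g [^] n)) (e t)))"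
        using g T by (intro eventually_nb_act [OF _ e(1) _ n]) auto
      moreover have "nb (\<lambda>t. \<alpha> (inv (g [^] n)) (e t)) = nb e"
        using g e by (intro nb_cong ray_act asym_act_pow) auto
      ultimately show ?thesis
        by simp
    qed
    then have "asym e (\<lambda>t. \<sigma> (- t))"
      by (rule asym_of_near [OF r e(1)])
    with ne show False ..
  qed
qed

lemma gp_gp_dist:
  assumes "0 \<le> s" "s \<le> 1" "0 \<le> t" "t \<le> 1"
  shows "d (gp x y s) (gp x y t) \<le> \<bar>s - t\<bar> * d x y"
proof -
  have *: "d (gp x y s) (gp x y t) \<le> (t - s) * d x y" if st: "0 \<le> s" "s \<le> t" "t \<le> 1" for s t
  proof (cases "t = 0")
    case True
    then have "s = t"
      using st by linarith
    then show ?thesis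
      by simp
  next
    case False
    then have q: "0 \<le> s / t" "s / t \<le> 1"
      using st by auto
    have xt: "d x (gp x y t) = t * d x y" "d (gp x y t) y = (1 - t) * d x y"
      using st by (auto intro: gp_left gp_right)
    let ?w = "gp x (gp x y t) (s / t)"
    have w: "d x ?w = s * d x y" "d ?w (gp x y t) = (t - s) * d x y"
    proof -
      have "s / t * (t * d x y) = s * d x y" "(1 - s / t) * (t * d x y) = (t - s) * d x y"
        using False by (simp_all add: field_simps)
      then show "d x ?w = s * d x y" "d ?w (gp x y t) = (t - s) * d x y"
        using gp_left [OF q, of x "gp x y t"] gp_right [OF q, of x "gp x y t"] xt(1) by simp_all
    qed
    have "d ?w y \<le> (1 - s) * d x y"
      using tri [of ?w y "gp x y t"] w xt by (simp add: algebra_simps)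
    then have "d ?w (gp x y s) = 0"
      using st w by (intro gp_unique) auto
    then show ?thesis
      using w(2) d0_left [of ?w "gp x y s" "gp x y t"] by simp
  qed
  show ?thesis
    using *[of s t] *[of t s] assms sym [of "gp x y s" "gp x y t"] by (cases "s \<le> t") auto
qed

text \<open>At time \<open>S\<close> both rays are within 1 of the geodesic to the common point, so
  less than 2 apart; as \<open>S > 2 * T\<close>, they are less than 1 apart at time
  \<open>T\<close>.\<close>

lemma near_of_common_points:
  assumes r: "ray c" "ray e" "c 0 = e 0" and T: "0 < T" "2 * T < S"
    and y: "y \<in> N c S" "y \<in> N e S"
  shows "eventually (\<lambda>y. y \<in> N c T) (nb e)"
proof (rule nearI)
  have "d (c S) (e S) < 2"
    using y r(3) tri [of "c S" "e S" "pt (c 0) y S"] sym [of "c S" "pt (c 0) y S"] unfolding N_def by auto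
  then have "d (e S) (c S) < 2"
    using sym [of "e S" "c S"] by simp
  then have "T / S * d (e S) (c S) \<le> T / S * 2"
    using T by (intro mult_left_mono) auto
  moreover have "T / S * 2 < 1"
    using T by simp
  moreover have "d (e T) (c T) \<le> T / S * d (e S) (c S)"
    using r T by (intro rays_contract) auto
  ultimately show "d (c T) (e T) < 1"
    using sym [of "c T" "e T"] by linarith
qed (use r T in auto)

text \<open>In a flat half plane the points at height \<open>H\<close> above
  \<open>\<sigma> (- n)\<close> and \<open>\<sigma> n\<close> still converge to the two ends, but
  the geodesic between them stays at height \<open>H\<close>, outside the ball when \<open>H\<close>
  is large.\<close>

lemma vis_not_half_plane:
  assumes l: "line \<sigma>" and "eventually (\<lambda>y. y \<in> A) (nb \<sigma>)" "eventually (\<lambda>x. x \<in> B) (nb (\<lambda>t. \<sigma> (- t)))"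
    and vis: "\<forall>x\<in>B. \<forall>y\<in>A. \<exists>w. btw x w y \<and> d p w \<le> R"
  shows "\<not> half_plane \<sigma>"
proof
  assume "half_plane \<sigma>"
  then obtain F where F: "\<forall>v\<ge>0. \<forall>v'\<ge>0. \<forall>u u'. d (F v u) (F v' u') = sqrt ((v - v')\<^sup>2 + (u - u')\<^sup>2)"
      "\<forall>u. d (F 0 u) (\<sigma> u) = 0"
    unfolding half_plane_def by blast
  define H where "H = \<bar>R\<bar> + d p (\<sigma> 0) + 1"
  have H: "0 \<le> H"
    by (simp add: H_def)
  have height: "d (\<sigma> u) (F H u) = H" for u
    using F(1) [rule_format, of 0 H u u] H F(2) d0_left [of "F 0 u" "\<sigma> u" "F H u"] by simp
  have r: "ray \<sigma>" "ray (\<lambda>t. \<sigma> (- t))"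
    using l line_ray line_reverse by blast+
  have "filterlim (\<lambda>n. F H (real n)) (nb \<sigma>) sequentially"
    by (rule filterlim_nb_perturb [OF r(1) filterlim_ray_nat [OF r(1)], of _ H]) (simp add: height)
  then have 1: "eventually (\<lambda>n. F H (real n) \<in> A) sequentially"
    by (rule eventually_compose_filterlim [OF assms(2)])
  have "filterlim (\<lambda>n. F H (- real n)) (nb (\<lambda>t. \<sigma> (- t))) sequentially"
    by (rule filterlim_nb_perturb [OF r(2) filterlim_ray_nat [OF r(2)], of _ H]) (simp add: height)
  then have 2: "eventually (\<lambda>n. F H (- real n) \<in> B) sequentially"
    by (rule eventually_compose_filterlim [OF assms(3)])
  obtain n where n: "F H (real n) \<in> A" "F H (- real n) \<in> B"
    using eventually_happens' [OF sequentially_bot eventually_conj [OF 1 2]] by blast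
  then obtain w where w: "btw (F H (- real n)) w (F H (real n))" "d p w \<le> R"
    using vis by blast
  obtain t where t: "0 \<le> t" "t \<le> 1" "d w (gp (F H (- real n)) (F H (real n)) t) = 0"
    using btw_gpE [OF w(1)] by blast
  define u where "u = (2 * t - 1) * real n"
  have "d (F H (- real n)) (F H u) = \<bar>- real n - u\<bar>" "d (F H u) (F H (real n)) = \<bar>u - real n\<bar>"
    "d (F H (- real n)) (F H (real n)) = 2 * real n"
  proof -
    have "d (F H a) (F H b) = \<bar>a - b\<bar>" for a b
      using F(1) H by simp
    then show "d (F H (- real n)) (F H u) = \<bar>- real n - u\<bar>" "d (F H u) (F H (real n)) = \<bar>u - real n\<bar>"
      "d (F H (- real n)) (F H (real n)) = 2 * real n"
      by simp_all
  qed
  moreover have "- real n - u = - (t * (2 * real n))" "u - real n = - ((1 - t) * (2 * real n))"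
    by (simp_all add: u_def algebra_simps)
  ultimately have "d (F H u) (gp (F H (- real n)) (F H (real n)) t) = 0"
    using t by (intro gp_unique) (auto simp: abs_mult)
  then have "d (F H u) w = 0"
    using t(3) sym [of "F H u" w] d0_cong [of w "gp (F H (- real n)) (F H (real n)) t" "F H u"
        "gp (F H (- real n)) (F H (real n)) t"] by simp
  then have "d (\<sigma> 0) (F H u) = d (\<sigma> 0) w"
    by (rule d0_right)
  moreover have "H \<le> d (F 0 0) (F H u)"
    using F(1) [rule_format, of 0 H 0 u] H by simp
  moreover have "d (F 0 0) (F H u) = d (\<sigma> 0) (F H u)"
    using F(2) by (intro d0_left) simp
  ultimately show False
    using w(2) tri [of "\<sigma> 0" w p] sym [of p "\<sigma> 0"] unfolding H_def by linarith
qed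

section \<open>Displacement and the existence of axes\<close>

lemma act_int_pow:
  assumes "g \<in> carrier G"
  shows "\<alpha> (g [^] (i + j :: int)) x = \<alpha> (g [^] i) (\<alpha> (g [^] j) x)"
  using assms int_pow_mult [OF assms, of i j] mult [of "g [^] i" "g [^] j" x] by simp

lemma orbit_tendsto:
  assumes g: "g \<in> carrier G" and ax: "axis g \<sigma> l"
  shows "filterlim (\<lambda>n::nat. \<alpha> (g [^] n) p) (nb \<sigma>) sequentially"
proof (rule filterlim_nb_perturb)
  show r: "ray \<sigma>"
    using ax line_ray by (auto simp: axis_def)
  have "filterlim (\<lambda>n. real n * l) at_top sequentially"
    using ax by (intro filterlim_at_top_mult_tendsto_pos [OF tendsto_const] filterlim_real_sequentially)
      (auto simp: axis_def)
  then show "filterlim (\<lambda>n. \<sigma> (real n * l)) (nb \<sigma>) sequentially"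
    by (rule filterlim_compose [OF filterlim_ray [OF r]])
  show "d (\<sigma> (real n * l)) (\<alpha> (g [^] n) p) \<le> d (\<sigma> 0) p" for n
    using d0_left [OF axis_shift [OF g ax, of n 0], of "\<alpha> (g [^] n) p"] g by (simp add: iso)
qed

lemma displacement_orbit:
  assumes "g \<in> carrier G"
  shows "d (\<alpha> (g [^] (i::int)) x) (\<alpha> g (\<alpha> (g [^] i) x)) = d x (\<alpha> g x)"
proof -
  have "\<alpha> g (\<alpha> (g [^] i) x) = \<alpha> (g [^] i) (\<alpha> g x)"
    using act_int_pow [OF assms, of 1 i x] act_int_pow [OF assms, of i 1 x] assms
    by (simp add: add.commute)
  then show ?thesis
    using assms by (simp add: iso)
qed

text \<open>\<open>g\<close> maps the midpoint of \<open>z\<close> and its image to the midpoint of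
  the next two orbit points, and these midpoints are at most half as far apart as \<open>z\<close>
  and its second image.\<close>

lemma displacement_square:
  assumes g: "g \<in> carrier G" and L: "\<And>z. L \<le> d z (\<alpha> g z)"
  shows "2 * L \<le> d z (\<alpha> g (\<alpha> g z))"
proof -
  let ?y = "\<alpha> g z"
  let ?m = "gp z ?y (1 / 2)"
  have "d (\<alpha> g ?m) (gp ?y (\<alpha> g ?y) (1 / 2)) = 0"
    using g by (intro gp_unique) (auto simp: iso gp_left gp_right)
  then have "d ?m (\<alpha> g ?m) = d ?m (gp ?y (\<alpha> g ?y) (1 / 2))"
    by (rule d0_right)
  also have "d ?m (gp ?y (\<alpha> g ?y) (1 / 2)) = d (gp ?y z (1 / 2)) (gp ?y (\<alpha> g ?y) (1 / 2))"
    using gp_swap [of "1 / 2" z ?y] by (intro d0_left) simp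
  also have "\<dots> \<le> 1 / 2 * d z (\<alpha> g ?y)"
    by (intro gp_near_left) auto
  finally show ?thesis
    using L [of ?m] by simp
qed

text \<open>Doubling gives the lower bound for exponents that are powers of 2. Any \<open>n\<close>
  is compared with the larger exponent \<open>2 ^ n\<close>, where the remaining steps are bounded
  from above by the triangle inequality.\<close>

lemma displacement_pow:
  assumes g: "g \<in> carrier G" and min: "\<And>z. d y (\<alpha> g y) \<le> d z (\<alpha> g z)"
  shows "d y (\<alpha> (g [^] (n::nat)) y) = real n * d y (\<alpha> g y)"
proof -
  define L where "L = d y (\<alpha> g y)"
  have le: "d y (\<alpha> (g [^] (n::nat)) y) \<le> real n * L" for n
  proof (induction n)
    case 0
    then show ?case
      using one sym [of y "\<alpha> \<one> y"] by simp
  next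
    case (Suc n)
    have "d (\<alpha> (g [^] n) y) (\<alpha> (g [^] Suc n) y) = L"
      using g by (simp add: mult iso L_def)
    then show ?case
      using Suc.IH tri [of y "\<alpha> (g [^] Suc n) y" "\<alpha> (g [^] n) y"] by (simp add: algebra_simps)
  qed
  have low: "2 ^ k * L \<le> d z (\<alpha> (g [^] ((2::nat) ^ k)) z)" for k z
  proof (induction k arbitrary: z)
    case 0
    then show ?case
      using min g by (simp add: L_def)
  next
    case (Suc k)
    have "2 * (2 ^ k * L) \<le> d z (\<alpha> (g [^] ((2::nat) ^ k)) (\<alpha> (g [^] ((2::nat) ^ k)) z))"
      using g Suc.IH by (intro displacement_square) auto
    also have "\<alpha> (g [^] ((2::nat) ^ k)) (\<alpha> (g [^] ((2::nat) ^ k)) z) = \<alpha> (g [^] ((2::nat) ^ Suc k)) z"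
      using g by (simp add: nat_pow_mult mult_2 flip: mult)
    finally show ?case
      by simp
  qed
  have "n \<le> 2 ^ n"
    using less_exp [of n] by simp
  have "g [^] ((2::nat) ^ n) = g [^] n \<otimes> g [^] (2 ^ n - n)"
    using g \<open>n \<le> 2 ^ n\<close> by (simp add: nat_pow_mult)
  then have "d (\<alpha> (g [^] n) y) (\<alpha> (g [^] ((2::nat) ^ n)) y) = d y (\<alpha> (g [^] (2 ^ n - n)) y)"
    using g by (simp add: mult iso)
  also have "\<dots> \<le> real (2 ^ n - n) * L"
    by (rule le)
  finally have "2 ^ n * L \<le> d y (\<alpha> (g [^] n) y) + real (2 ^ n - n) * L"
    using low [of n y] tri [of y "\<alpha> (g [^] ((2::nat) ^ n)) y" "\<alpha> (g [^] n) y"] by linarith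
  then have "real n * L \<le> d y (\<alpha> (g [^] n) y)"
    using \<open>n \<le> 2 ^ n\<close> by (simp add: of_nat_diff algebra_simps)
  then show ?thesis
    using le [of n] unfolding L_def by linarith
qed

text \<open>By \<open>displacement_pow\<close> the triangle inequality is an equality along the
  orbit of \<open>y\<close>, so the translates of the segment from \<open>y\<close> to its image fit
  together to a line.\<close>

lemma axis_of_minimal_displacement:
  assumes g: "g \<in> carrier G" and min: "\<And>z. d y (\<alpha> g y) \<le> d z (\<alpha> g z)" and pos: "0 < d y (\<alpha> g y)"
  obtains \<sigma> where "axis g \<sigma> (d y (\<alpha> g y))" "d (\<sigma> 0) y = 0"
proof -
  define l where "l = d y (\<alpha> g y)"
  have l: "0 < l"
    using pos by (simp add: l_def)
  have orb: "d (\<alpha> (g [^] (i::int)) y) (\<alpha> (g [^] j) y) = real_of_int (j - i) * l" if "i \<le> j" for i j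
  proof -
    define n where "n = nat (j - i)"
    have j: "j = i + int n"
      using that by (simp add: n_def)
    have "d (\<alpha> (g [^] i) y) (\<alpha> (g [^] j) y) = d y (\<alpha> (g [^] int n) y)"
      unfolding j act_int_pow [OF g] using g by (simp add: iso)
    also have "\<dots> = real n * l"
      using displacement_pow [OF g min, of n] by (simp add: int_pow_int l_def)
    finally show ?thesis
      using j by simp
  qed
  \<comment> \<open>\<open>k t\<close> is the number of the translate at time \<open>t\<close>, and
    \<open>f t\<close> is the position in it as a fraction of its length.\<close>
  define k where "k t = \<lfloor>t / l\<rfloor>" for t
  define f where "f t = t / l - k t" for t
  have f: "0 \<le> f t" "f t \<le> 1" "f t * l = t - k t * l" for t
  proof -
    show "0 \<le> f t" "f t \<le> 1"
      unfolding f_def k_def by linarith+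
    show "f t * l = t - k t * l"
      using l by (simp add: f_def left_diff_distrib)
  qed
  define \<sigma> where "\<sigma> t = \<alpha> (g [^] k t) (gp y (\<alpha> g y) (f t))" for t
  have left: "d (\<alpha> (g [^] k t) y) (\<sigma> t) = t - k t * l" for t
    unfolding \<sigma>_def using g f [of t] by (simp add: iso gp_left l_def)
  have right: "d (\<sigma> t) (\<alpha> (g [^] (k t + 1)) y) = (k t + 1) * l - t" for t
  proof -
    have "\<alpha> (g [^] (k t + 1)) y = \<alpha> (g [^] k t) (\<alpha> g y)"
      using act_int_pow [OF g, of "k t" 1 y] g by simp
    then have "d (\<sigma> t) (\<alpha> (g [^] (k t + 1)) y) = l - f t * l"
      unfolding \<sigma>_def using g f [of t] by (simp add: iso gp_right l_def left_diff_distrib)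
    then show ?thesis
      using f(3) [of t] by (simp add: algebra_simps)
  qed
  have dist: "d (\<sigma> s) (\<sigma> t) = t - s" if st: "s \<le> t" for s t
  proof (rule antisym)
    have k: "k s \<le> k t"
      unfolding k_def using st l by (intro floor_mono divide_right_mono) auto
    show "d (\<sigma> s) (\<sigma> t) \<le> t - s"
    proof (cases "k s = k t")
      case True
      have "d (\<sigma> s) (\<sigma> t) \<le> \<bar>f s - f t\<bar> * l"
        unfolding \<sigma>_def True using g f gp_gp_dist [of "f s" "f t" y "\<alpha> g y"] by (simp add: iso l_def)
      also have "\<dots> = \<bar>f s * l - f t * l\<bar>"
        using l by (simp add: abs_mult left_diff_distrib [symmetric])
      also have "\<dots> = t - s"
        using f(3) [of s] f(3) [of t] st True by simp
      finally show ?thesis .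
    next
      case False
      then have "d (\<alpha> (g [^] (k s + 1)) y) (\<alpha> (g [^] k t) y) = (k t - (k s + 1)) * l"
        using k by (intro orb) simp
      then show ?thesis
        using left [of t] right [of s] tri [of "\<sigma> s" "\<sigma> t" "\<alpha> (g [^] (k s + 1)) y"]
          tri [of "\<alpha> (g [^] (k s + 1)) y" "\<sigma> t" "\<alpha> (g [^] k t) y"]
        by (simp add: algebra_simps)
    qed
    have "d (\<alpha> (g [^] k s) y) (\<alpha> (g [^] (k t + 1)) y) = (k t + 1 - k s) * l"
      using k by (intro orb) simp
    then show "t - s \<le> d (\<sigma> s) (\<sigma> t)"
      using left [of s] right [of t] tri [of "\<alpha> (g [^] k s) y" "\<alpha> (g [^] (k t + 1)) y" "\<sigma> s"]
        tri [of "\<sigma> s" "\<alpha> (g [^] (k t + 1)) y" "\<sigma> t"]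
      by (simp add: algebra_simps)
  qed
  have "line \<sigma>"
    unfolding line_def
  proof (intro allI)
    fix s t
    show "d (\<sigma> s) (\<sigma> t) = \<bar>s - t\<bar>"
      using dist [of s t] dist [of t s] sym [of "\<sigma> s" "\<sigma> t"] by linarith
  qed
  moreover have "\<alpha> g (\<sigma> t) = \<sigma> (t + l)" for t
  proof -
    have "(t + l) / l = t / l + 1"
      using l by (simp add: field_simps)
    then have "k (t + l) = 1 + k t" "f (t + l) = f t"
      by (simp_all add: k_def f_def)
    then show ?thesis
      unfolding \<sigma>_def using act_int_pow [OF g, of 1 "k t"] g by simp
  qed
  ultimately have "axis g \<sigma> l"
    using l by (simp add: axis_def)
  moreover have "d (\<sigma> 0) y = 0"
    using left [of 0] one sym [of y "\<sigma> 0"] d0_left [of "\<alpha> \<one> y" y "\<sigma> 0"] by (simp add: k_def)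
  ultimately show ?thesis
    using that by (simp add: l_def)
qed

text \<open>Write h' for the inverse of \<open>h\<close>. Seen from \<open>p\<close>, the points
  \<open>Y\<close> and h'Y lie in nearly the same direction, so d(h'p, Y) - d(p, Y) nearly equals
  d(h'p, h'Y) - d(p, h'Y), which is d(p, Y) - d(hp, Y). Thus if the step from \<open>p\<close> back
  to h'p hardly comes closer to \<open>Y\<close>, the step forward to hp hardly recedes from
  it.\<close>

lemma far_point_shift:
  assumes h: "h \<in> carrier G" and D: "D = d p (\<alpha> h p)" and u: "u = D + 2 * D\<^sup>2 + 1"
    and Y: "d Y (\<alpha> h Y) \<le> \<Lambda>" "\<Lambda> + 4 * \<Lambda> * u + u + 1 \<le> d p Y"
      "d p Y \<le> d (\<alpha> (inv h) p) Y + 1 / 4"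
  shows "d (\<alpha> h p) Y \<le> d p Y + 1"
proof -
  have \<Lambda>: "0 \<le> \<Lambda>"
    using Y(1) nonneg [of Y "\<alpha> h Y"] by linarith
  have D0: "0 \<le> D"
    by (simp add: D)
  have u0: "D < u" "0 < u"
    using D0 by (auto simp: u add_nonneg_pos)
  let ?z = "\<alpha> (inv h) p" and ?Y = "\<alpha> (inv h) Y"
  have Du: "0 \<le> 4 * \<Lambda> * u"
    using \<Lambda> u0 by simp
  have zp: "d ?z p = D"
    using dist_move(2) [OF h, of p p] D by simp
  have YY: "d Y ?Y \<le> \<Lambda>"
    using Y(1) dist_move(1) [OF h, of Y Y] sym [of Y "\<alpha> h Y"] by simp
  have pY: "u \<le> d p Y" "u \<le> d p ?Y"
    using Y(2) Du \<Lambda> tri [of p Y ?Y] YY sym [of Y ?Y] by linarith+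
  have 1: "d ?z Y - d p Y \<le> d ?z (pt p Y u) - u"
    using u0 pY zp by (intro busemann_estimate) auto
  have 2: "d ?z (pt p ?Y u) - u \<le> d ?z ?Y - d p ?Y + D\<^sup>2 / (2 * (u - D))"
    using busemann_estimate(2) [of ?z p u ?Y] u0 pY zp by simp
  \<comment> \<open>The summand \<open>2 * D\<^sup>2\<close> of \<open>u\<close> serves this bound,
    and \<open>4 * \<Lambda> * u\<close> in the lower bound for \<open>d p Y\<close> serves the
    bound 1/2 below. With the 1/4 allowed in the last hypothesis the errors add up to 1.\<close>
  have 3: "D\<^sup>2 / (2 * (u - D)) \<le> 1 / 4"
    using D0 by (simp add: u field_simps add_pos_nonneg)
  have "d (pt p Y u) (pt p ?Y u) \<le> 2 * \<Lambda> * u / (d p Y - \<Lambda>)"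
    using u0 Y(2) Du YY by (intro pt_fellow) linarith+
  also have "\<dots> \<le> 1 / 2"
  proof -
    have "0 < d p Y - \<Lambda>" "4 * \<Lambda> * u \<le> d p Y - \<Lambda>"
      using Y(2) Du u0 by linarith+
    then show ?thesis
      by (simp add: field_simps)
  qed
  finally have 4: "d ?z (pt p Y u) \<le> d ?z (pt p ?Y u) + 1 / 2"
    using tri [of ?z "pt p Y u" "pt p ?Y u"] sym [of "pt p Y u" "pt p ?Y u"] by linarith
  have "d ?z ?Y = d p Y" "d p ?Y = d (\<alpha> h p) Y"
    using h iso [of "inv h" p Y] dist_move(1) [OF h, of p Y] by simp_all
  then show ?thesis
    using 1 2 3 4 Y(3) by linarith
qed

text \<open>Displacement is constant along orbits, so a minimising sequence can be moved into a
  fixed ball, where properness provides a limit.\<close>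

lemma minimal_displacement_exists:
  assumes g: "g \<in> carrier G"
    and bd: "\<And>Y. d Y (\<alpha> g Y) \<le> (INF z. d z (\<alpha> g z)) + 1 \<Longrightarrow> \<exists>i::int. d p (\<alpha> (g [^] i) Y) \<le> B"
  obtains y where "\<And>z. d y (\<alpha> g y) \<le> d z (\<alpha> g z)"
proof -
  define l where "l = (INF z. d z (\<alpha> g z))"
  have bdd: "bdd_below (range (\<lambda>z. d z (\<alpha> g z)))"
    by (intro bdd_belowI2 [of _ 0]) auto
  have low: "l \<le> d z (\<alpha> g z)" for z
    unfolding l_def by (intro cINF_lower bdd) auto
  have "\<exists>Y. d Y (\<alpha> g Y) \<le> l + 1 / (real n + 1) \<and> d p Y \<le> B" for n
  proof -
    have "l < l + 1 / (real n + 1)"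
      by simp
    then obtain Y where Y: "d Y (\<alpha> g Y) < l + 1 / (real n + 1)"
      using cINF_less_iff [OF UNIV_not_empty bdd, of "l + 1 / (real n + 1)"] unfolding l_def by auto
    moreover have "1 / (real n + 1) \<le> 1"
      by simp
    ultimately have "d Y (\<alpha> g Y) \<le> l + 1"
      by linarith
    then obtain i :: int where "d p (\<alpha> (g [^] i) Y) \<le> B"
      using bd unfolding l_def by blast
    then show ?thesis
      using Y displacement_orbit [OF g, of i Y] by (intro exI [of _ "\<alpha> (g [^] i) Y"]) simp
  qed
  then obtain Y where Y: "\<And>n. d (Y n) (\<alpha> g (Y n)) \<le> l + 1 / (real n + 1)" "\<And>n. d p (Y n) \<le> B"
    by metis
  obtain r y where r: "strict_mono r" and y: "(\<lambda>n. d (Y (r n)) y) \<longlonglongrightarrow> 0"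
    using proper [of p Y B] Y(2) by blast
  have "(\<lambda>n. d (\<alpha> g (Y (r n))) (\<alpha> g y)) \<longlonglongrightarrow> 0"
    using y g by (simp add: iso)
  then have lim: "(\<lambda>n. d (Y (r n)) (\<alpha> g (Y (r n)))) \<longlonglongrightarrow> d y (\<alpha> g y)"
    by (rule tendsto_dist [OF y])
  have "(\<lambda>n. 1 / (real n + 1)) \<longlonglongrightarrow> 0"
    using LIMSEQ_inverse_real_of_nat by (simp add: inverse_eq_divide add.commute)
  then have "(\<lambda>n. l + 1 / (real (r n) + 1)) \<longlonglongrightarrow> l + 0"
    using LIMSEQ_subseq_LIMSEQ [OF _ r] by (intro tendsto_intros) (auto simp: o_def)
  then have "d y (\<alpha> g y) \<le> l + 0"
    by (rule LIMSEQ_le [OF lim]) (use Y(1) in blast)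
  then show ?thesis
    using that low by (metis add.right_neutral order_trans)
qed

text \<open>The translates of a point by the powers of \<open>g\<close> lie uniformly close to the geodesics between
  them. A point moved by a bounded amount, but far from this orbit, would therefore see three
  consecutive points of the orbit at almost the same distance, and the geodesic between points
  slightly nearer to it would avoid the middle one.\<close>

lemma exists_axis:
  assumes c: "ray c" "ray c'" "c 0 = p" "c' 0 = p" and T: "T > 0" and R: "0 \<le> R"
    and vis: "\<forall>x\<in>N c' T. \<forall>y\<in>N c T. \<exists>w. btw x w y \<and> d p w \<le> R"
  shows "\<exists>S>0. \<forall>g\<in>carrier G. \<alpha> g p \<in> N c S \<longrightarrow> \<alpha> (inv g) p \<in> N c' S \<longrightarrow>
    (\<exists>\<sigma> l. axis g \<sigma> l \<and> \<not> half_plane \<sigma> \<and> eventually (\<lambda>y. y \<in> N c T) (nb \<sigma>) \<and>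
      eventually (\<lambda>y. y \<in> N c' T) (nb (\<lambda>t. \<sigma> (- t))))"
proof -
  \<comment> \<open>A walk of length \<open>s\<close> towards a far point gains more than the error
    1 of \<open>far_point_shift\<close> and the radius \<open>R\<close> together. \<open>T1\<close>
    allows for a perturbation by \<open>s\<close> and for \<open>near_of_common_points\<close>,
    \<open>S\<close> for a perturbation by \<open>R\<close>; moreover
    \<open>S \<ge> 2 * R + 1\<close> makes every power of \<open>g\<close> gain at least 1 in
    \<open>growth\<close>.\<close>
  define s where "s = R + 2"
  define T1 where "T1 = 2 * T + (s + 1) + 2 * (s + 1) * T + 1"
  define S where "S = T1 + (R + 1) + 2 * (R + 1) * T1 + 2 * R + 1"
  have s: "0 \<le> s" "0 \<le> 2 * (s + 1) * T"
    using R T by (auto simp: s_def)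
  have T1: "2 * T < T1" "0 < T1" "T \<le> T1" "T + (s + 1) + 2 * (s + 1) * T < T1"
    using s T unfolding T1_def by linarith+
  have R1: "0 \<le> 2 * (R + 1) * T1"
    using R T1 by simp
  have S: "T1 + (R + 1) + 2 * (R + 1) * T1 < S" "2 * R + 1 \<le> S" "T1 \<le> S" "0 < S" "T \<le> S"
    using R T1 R1 unfolding S_def by linarith+
  have main: "\<exists>\<sigma> l. axis g \<sigma> l \<and> \<not> half_plane \<sigma> \<and> eventually (\<lambda>y. y \<in> N c T) (nb \<sigma>) \<and>
      eventually (\<lambda>y. y \<in> N c' T) (nb (\<lambda>t. \<sigma> (- t)))"
    if g: "g \<in> carrier G" and gp: "\<alpha> g p \<in> N c S" "\<alpha> (inv g) p \<in> N c' S" for g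
  proof -
    \<comment> \<open>\<open>h\<close> carries a geodesic to \<open>y\<close> that starts at the
      preimage of \<open>p\<close> and passes near \<open>p\<close> to one that starts at
      \<open>p\<close> and passes near the image of \<open>p\<close>.\<close>
    have step: "\<alpha> h y \<in> N e T1"
      if e: "ray e" "e 0 = p" and h: "h \<in> carrier G" "\<alpha> h p \<in> N e S" and w: "btw (\<alpha> (inv h) p) w y" "d p w \<le> R"
      for e h y w
    proof -
      have "\<alpha> h w \<in> N e T1"
        using e(1) h(2)
      proof (rule N_perturb)
        show "d (\<alpha> h p) (\<alpha> h w) \<le> R"
          using h w by (simp add: iso)
      qed (use S T1 in auto)
      moreover have "btw (e 0) (\<alpha> h w) (\<alpha> h y)"
        using btw_cong [OF btw_act [OF h(1) w(1)] inv_right [OF h(1)], of "\<alpha> h w" "\<alpha> h y"] e(2) by simp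
      ultimately show ?thesis
        using N_btw [of "\<alpha> h w" e T1 "\<alpha> h y"] T1 by simp
    qed
    have gpT: "\<alpha> g p \<in> N c T" "\<alpha> (inv g) p \<in> N c' T" "\<alpha> g p \<in> N c T1" "\<alpha> (inv g) p \<in> N c' T1"
      using gp N_mono [OF c(1) T S(5)] N_mono [OF c(2) T S(5)] N_mono [OF c(1) T1(2) S(3)]
        N_mono [OF c(2) T1(2) S(3)] by blast+
    have fwd: "\<alpha> g y \<in> N c T1" if y: "y \<in> N c T" for y
    proof -
      obtain w where w: "btw (\<alpha> (inv g) p) w y" "d p w \<le> R"
        using vis gpT(2) y by blast
      show ?thesis
        by (rule step [OF c(1,3) g gp(1) w])
    qed
    have bwd: "\<alpha> (inv g) y \<in> N c' T1" if y: "y \<in> N c' T" for y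
    proof -
      obtain w where w: "btw y w (\<alpha> g p)" "d p w \<le> R"
        using vis gpT(1) y by blast
      show ?thesis
        using step [OF c(2,4), of "inv g" w y] g gp(2) w by (simp add: btw_sym)
    qed
    have orb: "\<alpha> (g [^] Suc n) p \<in> N c T1" for n
    proof (induction n)
      case (Suc n)
      have "\<alpha> (g [^] Suc (Suc n)) p = \<alpha> g (\<alpha> (g [^] Suc n) p)"
        using nat_pow_Suc2 [OF g, of "Suc n"] g by (simp add: mult del: nat_pow_Suc)
      then show ?case
        using fwd Suc N_mono [OF c(1) T T1(3)] by auto
    qed (use g gpT in simp)
    have orb': "\<alpha> (inv g [^] Suc n) p \<in> N c' T1" for n
    proof (induction n)
      case (Suc n)
      have "\<alpha> (inv g [^] Suc (Suc n)) p = \<alpha> (inv g) (\<alpha> (inv g [^] Suc n) p)"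
        using nat_pow_Suc2 [OF inv_closed [OF g], of "Suc n"] g by (simp add: mult del: nat_pow_Suc)
      then show ?case
        using bwd Suc N_mono [OF c(2) T T1(3)] by auto
    qed (use g gpT in simp)
    define D where "D = d p (\<alpha> g p)"
    have D: "2 * R + 1 \<le> D"
      using gp(1) S(2) c(3) by (simp add: D_def N_def)
    have Dinv: "d p (\<alpha> (inv g) p) = D"
      using dist_move(1) [OF g, of p p] sym [of p "\<alpha> g p"] by (simp add: D_def)
    \<comment> \<open>Each step adds at least \<open>D - 2 * R\<close>, since the geodesic from the
      preimage of \<open>p\<close> to the current orbit point passes within \<open>R\<close> of
      \<open>p\<close>.\<close>
    have growth: "real (Suc n) \<le> d p (\<alpha> (g [^] Suc n) p)" for n
    proof (induction n)
      case 0
      then show ?case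
        using D R g by (simp add: D_def)
    next
      case (Suc n)
      have "\<alpha> (g [^] Suc n) p \<in> N c T"
        using orb N_mono [OF c(1) T T1(3)] by blast
      then obtain w where w: "btw (\<alpha> (inv g) p) w (\<alpha> (g [^] Suc n) p)" "d p w \<le> R"
        using vis gpT(2) by blast
      have "\<alpha> (g [^] Suc (Suc n)) p = \<alpha> g (\<alpha> (g [^] Suc n) p)"
        using nat_pow_Suc2 [OF g, of "Suc n"] g by (simp add: mult del: nat_pow_Suc)
      then have "d p (\<alpha> (g [^] Suc (Suc n)) p) = d (\<alpha> (inv g) p) (\<alpha> (g [^] Suc n) p)"
        using g by (simp add: dist_move)
      also have "\<dots> = d (\<alpha> (inv g) p) w + d w (\<alpha> (g [^] Suc n) p)"
        using w(1) by (simp add: btw_def)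
      finally show ?case
        using Suc.IH w(2) D Dinv tri [of "\<alpha> (inv g) p" p w] tri [of p "\<alpha> (g [^] Suc n) p" w]
          sym [of w p] sym [of p "\<alpha> (inv g) p"] by simp
    qed
    define \<Lambda> where "\<Lambda> = (INF z. d z (\<alpha> g z)) + 1"
    define u where "u = D + 2 * D\<^sup>2 + 1"
    define B where "B = \<bar>\<Lambda> + 4 * \<Lambda> * u + u + 1\<bar> + D + s"
    have "\<exists>i::int. d p (\<alpha> (g [^] i) Y) \<le> B" if Y: "d Y (\<alpha> g Y) \<le> \<Lambda>" for Y
    proof (rule ccontr)
      assume "\<not> ?thesis"
      then have far: "B < d p (\<alpha> (g [^] i) Y)" for i :: int
        by (meson not_le)
      define f where "f i = d p (\<alpha> (g [^] i) Y)" for i :: int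
      have bdd: "bdd_below (range f)"
        unfolding f_def by (intro bdd_belowI2 [of _ 0]) auto
      \<comment> \<open>The infimum along the orbit of \<open>Y\<close> need not be attained; a
        value within 1/4 of it matches the tolerance in \<open>far_point_shift\<close>.\<close>
      obtain i where i: "f i < (INF j. f j) + 1 / 4"
        using cINF_less_iff [OF _ bdd, of "(INF j. f j) + 1 / 4"] by auto
      have near: "f i \<le> f j + 1 / 4" for j
        using i cINF_lower [OF bdd, of j] by simp
      define Z where "Z = \<alpha> (g [^] i) Y"
      have Z: "d Z (\<alpha> g Z) \<le> \<Lambda>"
        using Y displacement_orbit [OF g, of i Y] by (simp add: Z_def)
      have Z': "d Z (\<alpha> (inv g) Z) \<le> \<Lambda>"
        using Z dist_move(1) [OF g, of Z Z] sym [of Z "\<alpha> g Z"] by simp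
      have "d p (\<alpha> g Z) = f (1 + i)" "d p (\<alpha> (inv g) Z) = f (- 1 + i)"
        unfolding f_def Z_def act_int_pow [OF g] using g by (simp_all add: int_pow_neg)
      then have n1: "d p Z \<le> d (\<alpha> (inv g) p) Z + 1 / 4" "d p Z \<le> d (\<alpha> g p) Z + 1 / 4"
        using near [of "1 + i"] near [of "- 1 + i"] g by (simp_all add: f_def Z_def dist_move)
      have BZ: "\<Lambda> + 4 * \<Lambda> * u + u + 1 \<le> d p Z" "D + s \<le> d p Z"
        using far [of i] D R unfolding B_def Z_def s_def by linarith+
      have a1: "d (\<alpha> g p) Z \<le> d p Z + 1"
        by (rule far_point_shift [OF g D_def u_def Z BZ(1) n1(1)])
      have a2: "d (\<alpha> (inv g) p) Z \<le> d p Z + 1"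
      proof (rule far_point_shift [of "inv g" D p u Z \<Lambda>])
        show "d p Z \<le> d (\<alpha> (inv (inv g)) p) Z + 1 / 4"
          using n1(2) g by simp
      qed (use g Dinv u_def Z' BZ in simp_all)
      \<comment> \<open>Both points are at most \<open>d p Z + 1 - s\<close> away from
        \<open>Z\<close>. Balls are convex, so every point between them is that close to
        \<open>Z\<close>, also the one that visibility puts within \<open>R\<close> of
        \<open>p\<close>.\<close>
      let ?x = "pt (\<alpha> (inv g) p) Z s" and ?y = "pt (\<alpha> g p) Z s"
      have sx: "s \<le> d (\<alpha> (inv g) p) Z" "s \<le> d (\<alpha> g p) Z"
        using BZ(2) tri [of p Z "\<alpha> (inv g) p"] tri [of p Z "\<alpha> g p"] Dinv unfolding D_def by linarith+
      have "?x \<in> N c' T"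
        by (rule N_perturb [OF c(2) gpT(4), of _ s]) (use s T T1 sx in \<open>simp_all add: dist_pt\<close>)
      moreover have "?y \<in> N c T"
        by (rule N_perturb [OF c(1) gpT(3), of _ s]) (use s T T1 sx in \<open>simp_all add: dist_pt\<close>)
      ultimately obtain w where w: "btw ?x w ?y" "d p w \<le> R"
        using vis by blast
      have "d ?x Z = d (\<alpha> (inv g) p) Z - s" "d ?y Z = d (\<alpha> g p) Z - s"
        using s sx by (simp_all add: dist_pt)
      then have "d Z ?x \<le> d p Z + 1 - s" "d Z ?y \<le> d p Z + 1 - s"
        using a1 a2 sym [of Z ?x] sym [of Z ?y] by linarith+
      then have "d Z w \<le> d p Z + 1 - s"
        by (rule btw_convex [OF w(1)])
      then show False
        using w(2) tri [of p Z w] sym [of w Z] unfolding s_def by linarith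
    qed
    then obtain y where y: "\<And>z. d y (\<alpha> g y) \<le> d z (\<alpha> g z)"
      using minimal_displacement_exists [OF g] unfolding \<Lambda>_def by metis
    \<comment> \<open>A point moved by distance 0 would make the orbit of \<open>p\<close> bounded,
      against \<open>growth\<close>.\<close>
    have pos: "0 < d y (\<alpha> g y)"
    proof (rule ccontr)
      assume "\<not> ?thesis"
      then have 0: "d y (\<alpha> g y) = 0"
        using nonneg [of y "\<alpha> g y"] by linarith
      define n where "n = nat \<lceil>2 * d p y\<rceil>"
      have "d y (\<alpha> (g [^] Suc n) y) = 0"
        using displacement_pow [OF g y, of "Suc n"] 0 by simp
      moreover have "d (\<alpha> (g [^] Suc n) p) (\<alpha> (g [^] Suc n) y) = d p y"
        using g by (simp add: iso del: nat_pow_Suc)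
      ultimately have "d p (\<alpha> (g [^] Suc n) p) \<le> 2 * d p y"
        using tri [of p "\<alpha> (g [^] Suc n) p" y] tri [of y "\<alpha> (g [^] Suc n) p" "\<alpha> (g [^] Suc n) y"]
          sym [of "\<alpha> (g [^] Suc n) y" "\<alpha> (g [^] Suc n) p"] by linarith
      moreover have "2 * d p y \<le> real n"
        unfolding n_def by linarith
      ultimately show False
        using growth [of n] by simp
    qed
    obtain \<sigma> where ax: "axis g \<sigma> (d y (\<alpha> g y))"
      using axis_of_minimal_displacement [OF g y pos] by blast
    \<comment> \<open>A late orbit point lies both in the neighbourhood of the given ray and in that
      of the ray from \<open>p\<close> to the end of the axis.\<close>
    have near: "eventually (\<lambda>y. y \<in> N b T) (nb \<tau>)"
      if b: "ray b" "b 0 = p" and ax: "axis k \<tau> l" and k: "k \<in> carrier G"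
        and orb: "\<And>n. \<alpha> (k [^] Suc n) p \<in> N b T1" for b k \<tau> l
    proof -
      have \<tau>: "ray \<tau>"
        using ax line_ray by (auto simp: axis_def)
      obtain e where e: "ray e" "e 0 = p" "asym \<tau> e"
        using ray_from [OF \<tau>] by blast
      have "eventually (\<lambda>n. \<alpha> (k [^] n) p \<in> N e T1) sequentially"
        using orbit_tendsto [OF k ax, of p] unfolding nb_cong [OF \<tau> e(1,3)]
        by (rule eventually_compose_filterlim [OF eventually_N [OF e(1) T1(2)]])
      then have "eventually (\<lambda>n. \<alpha> (k [^] Suc n) p \<in> N e T1) sequentially"
        by (rule eventually_sequentially_Suc [THEN iffD2])
      then obtain n where "\<alpha> (k [^] Suc n) p \<in> N e T1"
        using eventually_happens' [OF sequentially_bot] by blast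
      then have "eventually (\<lambda>y. y \<in> N b T) (nb e)"
        using b e T T1 orb [of n] by (intro near_of_common_points [of b e T T1]) auto
      then show ?thesis
        using nb_cong [OF \<tau> e(1,3)] by simp
    qed
    have n1: "eventually (\<lambda>y. y \<in> N c T) (nb \<sigma>)"
      by (rule near [OF c(1,3) ax g orb])
    have n2: "eventually (\<lambda>y. y \<in> N c' T) (nb (\<lambda>t. \<sigma> (- t)))"
      by (rule near [OF c(2,4) axis_inv [OF g ax] _ orb']) (use g in simp)
    have "\<not> half_plane \<sigma>"
      using ax vis by (intro vis_not_half_plane [OF _ n1 n2]) (auto simp: axis_def)
    with ax n1 n2 show ?thesis
      by blast
  qed
  show ?thesis
    using S(4) main by blast
qed

section \<open>Ping-pong words and conjugates\<close>

lemma orbit_inv_tendsto: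
  assumes g: "g \<in> carrier G" and ax: "axis g \<sigma> l"
  shows "filterlim (\<lambda>n::nat. \<alpha> (inv (g [^] n)) p) (nb (\<lambda>t. \<sigma> (- t))) sequentially"
  using orbit_tendsto [OF _ axis_inv [OF g ax], of p] g by (simp add: nat_pow_inv)

text \<open>The mechanism by which visibility yields convergence: a geodesic from \<open>z\<close>
  to \<open>y\<close> that passes near \<open>p\<close> becomes one that starts at \<open>p\<close>,
  up to distance 0, and passes near the image of \<open>p\<close>.\<close>

lemma push_forward:
  assumes c: "ray c" "c 0 = p" and g: "g \<in> carrier G" "\<alpha> g p \<in> N c S" and w: "btw z w y" "d p w \<le> R"
    and z: "d (\<alpha> g z) p = 0" and T: "0 < T" "T + (R + 1) + 2 * (R + 1) * T < S"
  shows "\<alpha> g y \<in> N c T"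
proof -
  have "\<alpha> g w \<in> N c T"
    using c(1) g(2)
  proof (rule N_perturb)
    show "d (\<alpha> g p) (\<alpha> g w) \<le> R"
      using g w by (simp add: iso)
  qed (use T in auto)
  moreover have "btw (c 0) (\<alpha> g w) (\<alpha> g y)"
    using btw_cong [OF btw_act [OF g(1) w(1)] z, of "\<alpha> g w" "\<alpha> g y"] c(2) by simp
  ultimately show ?thesis
    using N_btw [of "\<alpha> g w" c T "\<alpha> g y"] T by simp
qed

text \<open>The repelling ends of \<open>a\<close> and \<open>b\<close> see each other, so the
  geodesic between the images of \<open>p\<close> under the inverse powers passes near
  \<open>p\<close>. The \<open>n\<close>-th power of \<open>a\<close> carries it to a geodesic from
  \<open>p\<close> to the point in question that passes near the image of \<open>p\<close> under
  that power.\<close>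

lemma pingpong_orbit:
  assumes a: "a \<in> carrier G" "axis a \<sigma> l" and b: "b \<in> carrier G" "axis b \<tau> m"
    and vis: "vis (\<lambda>t. \<sigma> (- t)) (\<lambda>t. \<tau> (- t))" and c: "ray c" "c 0 = p" "asym \<sigma> c" and T: "0 < T"
  shows "eventually (\<lambda>n::nat. \<alpha> (a [^] n \<otimes> inv (b [^] n)) p \<in> N c T) sequentially"
proof -
  have r: "ray \<sigma>" "ray (\<lambda>t. \<sigma> (- t))" "ray (\<lambda>t. \<tau> (- t))"
    using a b line_ray line_reverse unfolding axis_def by blast+
  obtain R T0 where T0: "T0 > 0"
    "\<forall>x\<in>N (\<lambda>t. \<sigma> (- t)) T0. \<forall>y\<in>N (\<lambda>t. \<tau> (- t)) T0. \<exists>w. btw x w y \<and> d p w \<le> R"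
    using visD [OF vis] by blast
  define S where "S = T + (\<bar>R\<bar> + 1) + 2 * (\<bar>R\<bar> + 1) * T + 1"
  have S: "0 < S"
    using T by (simp add: S_def add_pos_nonneg)
  have "eventually (\<lambda>n. \<alpha> (a [^] n) p \<in> N c S) sequentially"
    using orbit_tendsto [OF a, of p] unfolding nb_cong [OF r(1) c(1,3)]
    by (rule eventually_compose_filterlim [OF eventually_N [OF c(1) S]])
  moreover have "eventually (\<lambda>n. \<alpha> (inv (a [^] n)) p \<in> N (\<lambda>t. \<sigma> (- t)) T0) sequentially"
    by (rule eventually_compose_filterlim [OF eventually_N [OF r(2) T0(1)] orbit_inv_tendsto [OF a]])
  moreover have "eventually (\<lambda>n. \<alpha> (inv (b [^] n)) p \<in> N (\<lambda>t. \<tau> (- t)) T0) sequentially"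
    by (rule eventually_compose_filterlim [OF eventually_N [OF r(3) T0(1)] orbit_inv_tendsto [OF b]])
  ultimately show ?thesis
  proof eventually_elim
    case (elim n)
    then obtain w where w: "btw (\<alpha> (inv (a [^] n)) p) w (\<alpha> (inv (b [^] n)) p)" "d p w \<le> R"
      using T0(2) by blast
    have "\<alpha> (a [^] n) (\<alpha> (inv (b [^] n)) p) \<in> N c T"
    proof (rule push_forward [OF c(1,2) _ _ w(1)])
      show "d p w \<le> \<bar>R\<bar>"
        using w(2) by linarith
      show "d (\<alpha> (a [^] n) (\<alpha> (inv (a [^] n)) p)) p = 0"
        using a by (intro inv_right) auto
    qed (use a elim T in \<open>auto simp: S_def\<close>)
    then show ?case
      using a b by (simp add: mult)
  qed
qed

text \<open>The inverse of the word has the same form with \<open>a\<close> and \<open>b\<close>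
  exchanged, so \<open>pingpong_orbit\<close> controls both orbit points that
  \<open>exists_axis\<close> asks for. Visibility between the repelling ends drives the orbit;
  visibility between the attracting ends provides the axis.\<close>

lemma pingpong:
  assumes a: "a \<in> carrier G" "axis a \<sigma> l" "\<not> half_plane \<sigma>"
    and b: "b \<in> carrier G" "axis b \<tau> m" "\<not> half_plane \<tau>"
    and indep: "\<not> asym \<sigma> \<tau>" "\<not> asym (\<lambda>t. \<sigma> (- t)) (\<lambda>t. \<tau> (- t))"
    and P: "eventually P (nb \<sigma>)" and Q: "eventually Q (nb \<tau>)"
  shows "eventually (\<lambda>n::nat. \<exists>\<rho> k. axis (a [^] n \<otimes> inv (b [^] n)) \<rho> k \<and> \<not> half_plane \<rho> \<and>
    eventually P (nb \<rho>) \<and> eventually Q (nb (\<lambda>t. \<rho> (- t)))) sequentially"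
proof -
  define p where "p = \<sigma> 0"
  have r: "ray \<sigma>" "ray (\<lambda>t. \<sigma> (- t))" "ray \<tau>" "ray (\<lambda>t. \<tau> (- t))"
    using a b line_ray line_reverse unfolding axis_def by blast+
  obtain c where c: "ray c" "c 0 = p" "asym \<sigma> c"
    using ray_from [OF r(1)] by blast
  obtain c' where c': "ray c'" "c' 0 = p" "asym \<tau> c'"
    using ray_from [OF r(3)] by blast
  have "vis \<tau> \<sigma>"
    using indep(1) asym_sym by (intro vis_axis [OF a r(3)]) blast
  then have "vis c' \<sigma>"
    by (rule vis_cong [OF _ r(3,1) c'(1,3)])
  then have "vis \<sigma> c'"
    by (rule vis_sym [OF _ c'(1) r(1)])
  then have "vis c c'"
    by (rule vis_cong [OF _ r(1) c'(1) c(1,3)])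
  then have vis: "vis c' c"
    by (rule vis_sym [OF _ c(1) c'(1)])
  have nh: "\<not> half_plane (\<lambda>t. \<tau> (- t))"
    using half_plane_reverse b(3) by blast
  have vis_inv: "vis (\<lambda>t. \<sigma> (- t)) (\<lambda>t. \<tau> (- t))"
    by (rule vis_axis [OF _ axis_inv [OF b(1,2)] nh r(2) indep(2)]) (use b in simp)
  obtain R T0 where T0: "T0 > 0" "\<forall>x\<in>N c' T0. \<forall>y\<in>N c T0. \<exists>w. btw x w y \<and> d p w \<le> R"
    using visD [OF vis] by blast
  obtain T1 where T1: "T1 > 0" "\<forall>y\<in>N c T1. P y"
    using P eventually_nb [OF c(1)] unfolding nb_cong [OF r(1) c(1,3)] by blast
  obtain T2 where T2: "T2 > 0" "\<forall>y\<in>N c' T2. Q y"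
    using Q eventually_nb [OF c'(1)] unfolding nb_cong [OF r(3) c'(1,3)] by blast
  define T where "T = max T0 (max T1 T2)"
  have T: "T > 0" "T0 \<le> T" "T1 \<le> T" "T2 \<le> T"
    using T0 by (auto simp: T_def)
  have "\<forall>x\<in>N c' T. \<forall>y\<in>N c T. \<exists>w. btw x w y \<and> d p w \<le> \<bar>R\<bar>"
    using T0(2) N_mono [OF c'(1) T0(1) T(2)] N_mono [OF c(1) T0(1) T(2)]
    by (meson abs_ge_self order_trans subsetD)
  then have "\<exists>S>0. \<forall>g\<in>carrier G. \<alpha> g p \<in> N c S \<longrightarrow> \<alpha> (inv g) p \<in> N c' S \<longrightarrow>
    (\<exists>\<sigma> l. axis g \<sigma> l \<and> \<not> half_plane \<sigma> \<and> eventually (\<lambda>y. y \<in> N c T) (nb \<sigma>) \<and>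
      eventually (\<lambda>y. y \<in> N c' T) (nb (\<lambda>t. \<sigma> (- t))))"
    by (intro exists_axis [OF c(1) c'(1) c(2) c'(2) T(1)]) auto
  then obtain S where S: "S > 0" "\<forall>g\<in>carrier G. \<alpha> g p \<in> N c S \<longrightarrow> \<alpha> (inv g) p \<in> N c' S \<longrightarrow>
    (\<exists>\<sigma> l. axis g \<sigma> l \<and> \<not> half_plane \<sigma> \<and> eventually (\<lambda>y. y \<in> N c T) (nb \<sigma>) \<and>
      eventually (\<lambda>y. y \<in> N c' T) (nb (\<lambda>t. \<sigma> (- t))))"
    by blast
  have "eventually (\<lambda>n. \<alpha> (a [^] n \<otimes> inv (b [^] n)) p \<in> N c S) sequentially"
    by (rule pingpong_orbit [OF a(1,2) b(1,2) vis_inv c S(1)])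
  moreover have "eventually (\<lambda>n. \<alpha> (b [^] n \<otimes> inv (a [^] n)) p \<in> N c' S) sequentially"
    by (rule pingpong_orbit [OF b(1,2) a(1,2) vis_sym [OF vis_inv r(2,4)] c' S(1)])
  ultimately show ?thesis
  proof eventually_elim
    case (elim n)
    have "inv (a [^] n \<otimes> inv (b [^] n)) = b [^] n \<otimes> inv (a [^] n)"
      using a b by (simp add: inv_mult_group)
    then obtain \<rho> k where \<rho>: "axis (a [^] n \<otimes> inv (b [^] n)) \<rho> k" "\<not> half_plane \<rho>"
      "eventually (\<lambda>y. y \<in> N c T) (nb \<rho>)" "eventually (\<lambda>y. y \<in> N c' T) (nb (\<lambda>t. \<rho> (- t)))"
      using S(2) [rule_format, of "a [^] n \<otimes> inv (b [^] n)"] elim a b by auto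
    have "eventually P (nb \<rho>)" "eventually Q (nb (\<lambda>t. \<rho> (- t)))"
      using \<rho>(3,4) N_mono [OF c(1) T1(1) T(3)] N_mono [OF c'(1) T2(1) T(4)] T1(2) T2(2)
      by (auto elim!: eventually_mono)
    with \<rho> show ?case
      by blast
  qed
qed

text \<open>Geodesics from points near the end of \<open>z\<close> to points near the end of
  \<sigma> pass near \<open>p\<close>, in particular those from the images of \<open>p\<close> under
  the inverses of \<open>\<gamma> n\<close>. Applying \<open>\<gamma> n\<close>, they start at
  \<open>p\<close> and pass near its image, so a whole neighbourhood of the end of \<sigma> is
  carried close to the end of \<open>c\<close>.\<close>

lemma conj_near:
  assumes c: "ray c" and \<gamma>: "\<And>n::nat. \<gamma> n \<in> carrier G"
    and lim: "filterlim (\<lambda>n. \<alpha> (\<gamma> n) p) (nb c) sequentially"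
    and lim': "filterlim (\<lambda>n. \<alpha> (inv (\<gamma> n)) p) (nb z) sequentially"
    and z: "ray z" and \<sigma>: "ray \<sigma>" and vis: "vis z \<sigma>" and P: "eventually P (nb c)"
  shows "eventually (\<lambda>n. eventually P (nb (\<lambda>t. \<alpha> (\<gamma> n) (\<sigma> t)))) sequentially"
proof -
  obtain e where e: "ray e" "e 0 = p" "asym c e"
    using ray_from [OF c] by blast
  note nb = nb_cong [OF c e(1,3)]
  obtain T where T: "T > 0" "\<forall>y\<in>N e T. P y"
    using P eventually_nb [OF e(1)] unfolding nb by blast
  obtain R T0 where T0: "T0 > 0" "\<forall>x\<in>N z T0. \<forall>y\<in>N \<sigma> T0. \<exists>w. btw x w y \<and> d p w \<le> R"
    using visD [OF vis] by blast
  define S where "S = T + (\<bar>R\<bar> + 1) + 2 * (\<bar>R\<bar> + 1) * T + 1"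
  have S: "0 < S"
    using T by (simp add: S_def add_pos_nonneg)
  have "eventually (\<lambda>n. \<alpha> (\<gamma> n) p \<in> N e S) sequentially"
    using lim unfolding nb by (rule eventually_compose_filterlim [OF eventually_N [OF e(1) S]])
  moreover have "eventually (\<lambda>n. \<alpha> (inv (\<gamma> n)) p \<in> N z T0) sequentially"
    by (rule eventually_compose_filterlim [OF eventually_N [OF z T0(1)] lim'])
  ultimately show ?thesis
  proof eventually_elim
    case (elim n)
    have "\<alpha> (\<gamma> n) y \<in> N e T" if y: "y \<in> N \<sigma> T0" for y
    proof -
      obtain w where w: "btw (\<alpha> (inv (\<gamma> n)) p) w y" "d p w \<le> R"
        using T0(2) elim(2) y by blast
      show ?thesis
      proof (rule push_forward [OF e(1,2) \<gamma> elim(1) w(1)])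
        show "d p w \<le> \<bar>R\<bar>"
          using w(2) by linarith
        show "d (\<alpha> (\<gamma> n) (\<alpha> (inv (\<gamma> n)) p)) p = 0"
          by (intro inv_right \<gamma>)
      qed (use T in \<open>auto simp: S_def\<close>)
    qed
    then have "eventually (\<lambda>y. \<alpha> (\<gamma> n) y \<in> N e T) (nb \<sigma>)"
      using eventually_nb [OF \<sigma>] T0(1) by blast
    then have "eventually (\<lambda>y. y \<in> N e T) (nb (\<lambda>t. \<alpha> (\<gamma> n) (\<sigma> t)))"
      using T(1) by (intro eventually_nb_act \<gamma> \<sigma>) auto
    then show ?case
      by eventually_elim (use T(2) in blast)
  qed
qed

end

section \<open>Properness of locally compact Hadamard spaces\<close>

context hadamard_pseudometric
begin

definition seq_compact_ball :: "'a \<Rightarrow> real \<Rightarrow> bool" where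
  "seq_compact_ball p R \<longleftrightarrow> (\<forall>s::nat \<Rightarrow> 'a. (\<forall>n. d p (s n) \<le> R) \<longrightarrow>
     (\<exists>r l. strict_mono r \<and> (\<lambda>n. d (s (r n)) l) \<longlonglongrightarrow> 0))"

lemma seq_compact_ballD:
  assumes "seq_compact_ball p R" "\<And>n. d p (s n) \<le> R"
  obtains r :: "nat \<Rightarrow> nat" and l where "strict_mono r" "(\<lambda>n. d (s (r n)) l) \<longlonglongrightarrow> 0"
  using assms unfolding seq_compact_ball_def by meson

lemma seq_compact_ball_mono: "seq_compact_ball p R \<Longrightarrow> R' \<le> R \<Longrightarrow> seq_compact_ball p R'"
  unfolding seq_compact_ball_def by (meson order_trans)

lemma dist_pt_end: assumes "0 \<le> s" "d x y \<le> R" "s \<le> R" shows "d (pt x y s) y \<le> R - s"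
  using assms dist_pt(2) [of s x y] by auto

text \<open>Retracting radially to the balls of radius \<open>\<rho> k\<close> moves points by at
  most \<open>R - \<rho> k\<close>, which tends to 0. A subsequence whose retracts converge for
  every \<open>k\<close> is therefore Cauchy.\<close>

lemma seq_compact_ball_closed:
  assumes R: "0 < R" and less: "\<And>R'. 0 \<le> R' \<Longrightarrow> R' < R \<Longrightarrow> seq_compact_ball p R'"
  shows "seq_compact_ball p R"
  unfolding seq_compact_ball_def
proof (intro allI impI)
  fix s :: "nat \<Rightarrow> 'a" assume s: "\<forall>n. d p (s n) \<le> R"
  define \<rho> where "\<rho> k = R * (1 - 1 / (real k + 1))" for k :: nat
  have \<rho>: "0 \<le> \<rho> k" "\<rho> k < R" "R - \<rho> k = R / (real k + 1)" for k
  proof -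
    have "0 < 1 / (real k + 1)" "1 / (real k + 1) \<le> 1"
      by auto
    then show "0 \<le> \<rho> k" "\<rho> k < R"
      using R mult_strict_left_mono [of "1 - 1 / (real k + 1)" 1 R] unfolding \<rho>_def by simp_all
    show "R - \<rho> k = R / (real k + 1)"
      by (simp add: \<rho>_def right_diff_distrib)
  qed
  have "\<exists>r l. strict_mono r \<and> (\<lambda>n. d (pt p (s (q (r n))) (\<rho> k)) l) \<longlonglongrightarrow> 0" for k and q :: "nat \<Rightarrow> nat"
  proof -
    have "\<forall>n. d p (pt p (s (q n)) (\<rho> k)) \<le> \<rho> k"
      using \<rho>(1) by (simp add: dist_pt)
    then show ?thesis
      using less [OF \<rho>(1,2), of k, unfolded seq_compact_ball_def, rule_format, of "\<lambda>n. pt p (s (q n)) (\<rho> k)"] by blast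
  qed
  then obtain q where q: "strict_mono q" and conv: "\<And>k. \<exists>l. (\<lambda>n. d (pt p (s (q n)) (\<rho> k)) l) \<longlonglongrightarrow> 0"
    using diagonal_subsequence [of "\<lambda>k n l. d (pt p (s n) (\<rho> k)) l"] by blast
  have "\<exists>l. (\<lambda>n. d (s (q n)) l) \<longlonglongrightarrow> 0"
  proof (rule complete)
    fix e :: real assume e: "e > 0"
    define k where "k = nat \<lceil>4 * R / e\<rceil>"
    have "4 * R / e \<le> real k"
      unfolding k_def by linarith
    then have "4 * R < e * (real k + 1)"
      using e by (simp add: field_simps)
    then have k: "R - \<rho> k < e / 4"
      unfolding \<rho>(3) using e by (simp add: field_simps)
    obtain l where "(\<lambda>n. d (pt p (s (q n)) (\<rho> k)) l) \<longlonglongrightarrow> 0"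
      using conv by blast
    then have "eventually (\<lambda>n. d (pt p (s (q n)) (\<rho> k)) l < e / 4) sequentially"
      using e by (intro order_tendstoD) auto
    then obtain M where M: "\<And>n. n \<ge> M \<Longrightarrow> d (pt p (s (q n)) (\<rho> k)) l < e / 4"
      unfolding eventually_sequentially by blast
    have near: "d (s (q n)) l < e / 2" if "n \<ge> M" for n
    proof -
      have "d (pt p (s (q n)) (\<rho> k)) (s (q n)) \<le> R - \<rho> k"
        using s \<rho> [of k] by (intro dist_pt_end) auto
      then show ?thesis
        using M [OF that] k tri [of "s (q n)" l "pt p (s (q n)) (\<rho> k)"]
          sym [of "s (q n)" "pt p (s (q n)) (\<rho> k)"] by linarith
    qed
    show "\<exists>M. \<forall>m\<ge>M. \<forall>n\<ge>M. d (s (q m)) (s (q n)) < e"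
    proof (intro exI allI impI)
      fix m n assume "m \<ge> M" "n \<ge> M"
      then show "d (s (q m)) (s (q n)) < e"
        using near [of m] near [of n] tri [of "s (q m)" "s (q n)" l]
          sym [of l "s (q n)"] by linarith
    qed
  qed
  then show "\<exists>r l. strict_mono r \<and> (\<lambda>n. d (s (r n)) l) \<longlonglongrightarrow> 0"
    using q by blast
qed

text \<open>Otherwise balls of radii decreasing to \<open>R\<close> contain sequences without
  convergent subsequences. Retracted to radius \<open>R\<close> they accumulate at points
  \<open>x k\<close>, and these accumulate at some \<open>y\<close>; for a suitable large
  \<open>k\<close> a tail of the subsequence lies in a compact ball around \<open>y\<close>.\<close>

lemma seq_compact_ball_open:
  assumes R: "0 \<le> R" "seq_compact_ball p R" and loc: "\<And>x. \<exists>r>0. seq_compact_ball x r"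
  shows "\<exists>e>0. seq_compact_ball p (R + e)"
proof (rule ccontr)
  assume "\<not> ?thesis"
  then have "\<not> seq_compact_ball p (R + 1 / (real k + 1))" for k
    by (metis add_nonneg_pos divide_pos_pos of_nat_0_le_iff zero_less_one)
  then have "\<exists>s::nat \<Rightarrow> 'a. (\<forall>n. d p (s n) \<le> R + 1 / (real k + 1)) \<and>
      (\<forall>r l. strict_mono r \<longrightarrow> \<not> (\<lambda>n. d (s (r n)) l) \<longlonglongrightarrow> 0)" for k
    unfolding seq_compact_ball_def by blast
  then obtain s :: "nat \<Rightarrow> nat \<Rightarrow> 'a" where s: "\<And>k n. d p (s k n) \<le> R + 1 / (real k + 1)"
    "\<And>k r l. strict_mono r \<Longrightarrow> \<not> (\<lambda>n. d (s k (r n)) l) \<longlonglongrightarrow> 0"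
    by metis
  have "\<exists>q x. strict_mono q \<and> (\<lambda>n. d (pt p (s k (q n)) R) x) \<longlonglongrightarrow> 0" for k
    using R(2) [unfolded seq_compact_ball_def, rule_format, of "\<lambda>n. pt p (s k n) R"] R(1)
    by (auto simp: dist_pt)
  then obtain q x where q: "\<And>k. strict_mono (q k)" and x: "\<And>k. (\<lambda>n. d (pt p (s k (q k n)) R) (x k)) \<longlonglongrightarrow> 0"
    by metis
  have "d p (x k) \<le> R" for k
    using R(1) by (intro tendsto_upperbound [OF tendsto_dist_const(2) [OF x]]) (auto simp: dist_pt)
  then obtain j y where j: "strict_mono j" and y: "(\<lambda>n. d (x (j n)) y) \<longlonglongrightarrow> 0"
    using seq_compact_ballD [OF R(2), of x] by metis
  obtain r where r: "r > 0" "seq_compact_ball y r"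
    using loc by blast
  have "(\<lambda>n. 1 / (real n + 1)) \<longlonglongrightarrow> 0"
    using LIMSEQ_inverse_real_of_nat by (simp add: inverse_eq_divide add.commute)
  then have lim: "(\<lambda>n. 1 / (real (j n) + 1)) \<longlonglongrightarrow> 0"
    using LIMSEQ_subseq_LIMSEQ [OF _ j] by (auto simp: o_def)
  have "eventually (\<lambda>n. 1 / (real (j n) + 1) < r / 3) sequentially"
    "eventually (\<lambda>n. d (x (j n)) y < r / 3) sequentially"
    using order_tendstoD(2) [OF lim, of "r / 3"] order_tendstoD(2) [OF y, of "r / 3"] r(1) by simp_all
  then obtain n where n: "1 / (real (j n) + 1) < r / 3" "d (x (j n)) y < r / 3"
    using eventually_happens' [OF sequentially_bot eventually_conj] by blast
  define k where "k = j n"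
  have "eventually (\<lambda>m. d (pt p (s k (q k m)) R) (x k) < r / 3) sequentially"
    using r(1) x by (intro order_tendstoD) auto
  then obtain M where M: "\<And>m. m \<ge> M \<Longrightarrow> d (pt p (s k (q k m)) R) (x k) < r / 3"
    unfolding eventually_sequentially by blast
  define q' where "q' m = q k (m + M)" for m
  have q': "strict_mono q'"
    using q [of k] unfolding q'_def strict_mono_def by simp
  have "d y (s k (q' m)) \<le> r" for m
  proof -
    have "0 \<le> 1 / (real k + 1)"
      by simp
    then have "d (pt p (s k (q' m)) R) (s k (q' m)) \<le> R + 1 / (real k + 1) - R"
      using s(1) R(1) by (intro dist_pt_end) auto
    then show ?thesis
      using n M [of "m + M"] tri [of y "s k (q' m)" "x k"] tri [of "x k" "s k (q' m)" "pt p (s k (q' m)) R"]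
        sym [of y "x k"] sym [of "x k" "pt p (s k (q' m)) R"] unfolding k_def [symmetric] q'_def by simp
  qed
  then obtain i l where i: "strict_mono i" "(\<lambda>m. d (s k (q' (i m))) l) \<longlonglongrightarrow> 0"
    using seq_compact_ballD [OF r(2), of "\<lambda>m. s k (q' m)"] by metis
  then show False
    using s(2) [OF strict_mono_o [OF q' i(1)], of k l] by (simp add: o_def)
qed

text \<open>A finite supremum of the radii of compact balls would be attained by
  \<open>seq_compact_ball_closed\<close> and exceeded by
  \<open>seq_compact_ball_open\<close>.\<close>

lemma hopf_rinow:
  assumes loc: "\<And>x. \<exists>r>0. seq_compact_ball x r"
  shows "proper_hadamard_pseudometric d"
proof unfold_locales
  have all: "seq_compact_ball p R" for p R
  proof (rule ccontr)
    assume no: "\<not> ?thesis"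
    define A where "A = {R. 0 \<le> R \<and> seq_compact_ball p R}"
    obtain r where r: "r > 0" "seq_compact_ball p r"
      using loc by blast
    have bdd: "bdd_above A"
    proof (rule bdd_aboveI)
      fix a assume "a \<in> A"
      then show "a \<le> R"
        using no seq_compact_ball_mono [of p a R] by (auto simp: A_def not_le intro: ccontr)
    qed
    define M where "M = Sup A"
    have rA: "r \<in> A"
      using r by (simp add: A_def)
    then have "r \<le> M"
      unfolding M_def by (intro cSup_upper bdd)
    then have M: "0 < M"
      using r by linarith
    have "seq_compact_ball p M"
    proof (rule seq_compact_ball_closed [OF M])
      fix R' assume "R' < M"
      then obtain a where "a \<in> A" "R' < a"
        using less_cSup_iff [OF _ bdd] rA unfolding M_def by blast
      then show "seq_compact_ball p R'"
        using seq_compact_ball_mono by (auto simp: A_def)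
    qed
    then obtain e where e: "e > 0" "seq_compact_ball p (M + e)"
      using seq_compact_ball_open M loc by (meson less_imp_le)
    then have "M + e \<le> M"
      using M unfolding M_def by (intro cSup_upper bdd) (auto simp: A_def M_def)
    with e show False
      by simp
  qed
  show "\<exists>r l. strict_mono r \<and> (\<lambda>n. d (s (r n)) l) \<longlonglongrightarrow> 0" if "\<And>n::nat. d p (s n) \<le> B" for p s B
    using all [of p B] that unfolding seq_compact_ball_def by blast
qed

end

section \<open>From metric spaces to pseudometrics\<close>

text \<open>Retracting the type onto the space turns the metric into a pseudometric on the whole type.\<close>

definition retr :: "'a metric \<Rightarrow> 'a \<Rightarrow> 'a" where
  "retr M x = (if x \<in> mspace M then x else (SOME y. y \<in> mspace M))"

definition pd :: "'a metric \<Rightarrow> 'a \<Rightarrow> 'a \<Rightarrow> real" where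
  "pd M x y = mdist M (retr M x) (retr M y)"

lemma retr_in: "mspace M \<noteq> {} \<Longrightarrow> retr M x \<in> mspace M"
  by (auto simp: retr_def some_in_eq)

lemma retr_id [simp]: "x \<in> mspace M \<Longrightarrow> retr M x = x"
  by (simp add: retr_def)

lemma pd_mdist: "x \<in> mspace M \<Longrightarrow> y \<in> mspace M \<Longrightarrow> pd M x y = mdist M x y"
  by (simp add: pd_def)

lemma pd_retr: "mspace M \<noteq> {} \<Longrightarrow> pd M x (retr M x) = 0"
  by (simp add: pd_def retr_in)

lemma limitin_mtopology_of:
  "limitin (mtopology_of M) s l sequentially \<longleftrightarrow>
     l \<in> mspace M \<and> eventually (\<lambda>n. s n \<in> mspace M) sequentially \<and> (\<lambda>n. mdist M (s n) l) \<longlonglongrightarrow> 0"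
  unfolding mtopology_of_def by (rule Metric_space.limitin_metric_dist_null [OF Metric_space_mspace_mdist])

lemma complete_pd:
  assumes ne: "mspace M \<noteq> {}" and c: "mcomplete_of M"
    and s: "\<And>e. e > 0 \<Longrightarrow> \<exists>N. \<forall>m\<ge>N. \<forall>n\<ge>N. pd M (s m) (s n) < e"
  shows "\<exists>l\<in>mspace M. (\<lambda>n::nat. pd M (s n) l) \<longlonglongrightarrow> 0"
proof -
  have "Metric_space.MCauchy (mspace M) (mdist M) (\<lambda>n. retr M (s n))"
    unfolding Metric_space.MCauchy_def [OF Metric_space_mspace_mdist]
    using s retr_in [OF ne] unfolding pd_def by blast
  then obtain l where "limitin (mtopology_of M) (\<lambda>n. retr M (s n)) l sequentially"
    using c unfolding mcomplete_of_def Metric_space.mcomplete_def [OF Metric_space_mspace_mdist] mtopology_of_def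
    by blast
  then have "l \<in> mspace M" "(\<lambda>n. pd M (s n) l) \<longlonglongrightarrow> 0"
    unfolding limitin_mtopology_of pd_def by auto
  then show ?thesis
    by blast
qed

text \<open>\<open>CAT0_space\<close> quantifies over all comparison triangles, so using it requires
  that one exists. One vertex is the origin and one lies on the first axis; the law of cosines
  forces the first coordinate \<open>u\<close> of the third.\<close>

lemma comparison_triangle:
  fixes a b c :: real
  assumes "0 \<le> a" "0 \<le> b" "0 \<le> c" "a \<le> b + c" "b \<le> a + c" "c \<le> a + b"
  obtains x y z :: "real^2" where "dist x y = a" "dist y z = b" "dist x z = c"
proof (cases "a = 0")
  case True
  define z :: "real^2" where "z = vector [c, 0]"
  have "norm z = c"
    using assms by (simp add: z_def norm_vec_def L2_set_def sum_2)
  then show ?thesis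
    using that [of 0 0 z] True assms by (simp add: dist_norm)
next
  case False
  define u where "u = (a\<^sup>2 + c\<^sup>2 - b\<^sup>2) / (2 * a)"
  have u: "2 * a * u = a\<^sup>2 + c\<^sup>2 - b\<^sup>2"
    using False by (simp add: u_def)
  have "b\<^sup>2 \<le> (a + c)\<^sup>2" "(a - c)\<^sup>2 \<le> b\<^sup>2"
    using assms by (auto simp: abs_le_square_iff [symmetric])
  then have "2 * a * (- c) \<le> 2 * a * u" "2 * a * u \<le> 2 * a * c"
    using u by (auto simp: power2_sum power2_diff)
  moreover have "0 < 2 * a"
    using False assms by simp
  ultimately have "- c \<le> u" "u \<le> c"
    by (simp_all only: mult_le_cancel_left_pos)
  then have "\<bar>u\<bar> \<le> c"
    by linarith
  then have "u\<^sup>2 \<le> c\<^sup>2"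
    using assms by (simp add: abs_le_square_iff [symmetric])
  define v where "v = sqrt (c\<^sup>2 - u\<^sup>2)"
  have v: "v\<^sup>2 = c\<^sup>2 - u\<^sup>2"
    using \<open>u\<^sup>2 \<le> c\<^sup>2\<close> by (simp add: v_def)
  define y z :: "real^2" where "y = vector [a, 0]" and "z = vector [u, v]"
  have "norm y = a"
    using assms by (simp add: y_def norm_vec_def L2_set_def sum_2)
  moreover have "norm z = c"
    using assms v by (simp add: z_def norm_vec_def L2_set_def sum_2)
  moreover have "norm (y - z) = b"
  proof -
    have "(a - u)\<^sup>2 + v\<^sup>2 = b\<^sup>2"
      using u v by (simp add: power2_diff)
    then show ?thesis
      using assms by (simp add: y_def z_def norm_vec_def L2_set_def sum_2)
  qed
  ultimately show ?thesis
    using that [of 0 y z] by (simp add: dist_norm)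
qed

text \<open>The comparison is used with a point of one side and the opposite vertex. In the plane
  their squared distance is exactly the right-hand side (Stewart's identity).\<close>

lemma CAT0_cn:
  assumes cat: "CAT0_space M" and xyz: "x \<in> mspace M" "y \<in> mspace M" and t: "0 \<le> t" "t \<le> 1"
  shows "\<exists>p\<in>mspace M. \<forall>z\<in>mspace M.
    (mdist M z p)\<^sup>2 \<le> (1 - t) * (mdist M z x)\<^sup>2 + t * (mdist M z y)\<^sup>2 - t * (1 - t) * (mdist M x y)\<^sup>2"
proof -
  obtain c where c: "geodesic_between M x y c"
    using cat xyz unfolding CAT0_space_def geodesic_space_def by blast
  define s where "s = t * mdist M x y"
  have s: "s \<in> {0..mdist M x y}"
    using t by (auto simp: s_def mult_left_le_one_le)
  have "c s \<in> mspace M"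
    using c s unfolding geodesic_between_def geodesic_on_def by blast
  moreover have "(mdist M z (c s))\<^sup>2 \<le> (1 - t) * (mdist M z x)\<^sup>2 + t * (mdist M z y)\<^sup>2 - t * (1 - t) * (mdist M x y)\<^sup>2"
    if z: "z \<in> mspace M" for z
  proof -
    obtain c' where c': "geodesic_between M x z c'"
      using cat xyz z unfolding CAT0_space_def geodesic_space_def by blast
    obtain x' y' z' :: "real^2" where d: "dist x' y' = mdist M x y" "dist y' z' = mdist M y z" "dist x' z' = mdist M x z"
      using comparison_triangle [of "mdist M x y" "mdist M y z" "mdist M x z"]
        mdist_triangle [of x M y z] mdist_triangle [of x M z y] mdist_triangle [of y M x z] xyz z
      by (metis mdist_commute mdist_nonneg mdist_triangle add.commute)
    define p where "p = x' + t *\<^sub>R (y' - x')"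
    have p: "p \<in> closed_segment x' y'" "dist x' p = s"
    proof -
      have "p = (1 - t) *\<^sub>R x' + t *\<^sub>R y'"
        by (simp add: p_def algebra_simps)
      then show "p \<in> closed_segment x' y'"
        using t by (auto simp: closed_segment_def)
      have "dist x' p = t * norm (y' - x')"
        using t by (simp add: p_def dist_norm)
      then show "dist x' p = s"
        using d by (simp add: s_def dist_norm norm_minus_commute)
    qed
    have "mdist M (c s) (c' (mdist M x z)) \<le> dist p z'"
      using cat c c' xyz z d p s unfolding CAT0_space_def by (metis atLeastAtMost_iff ends_in_segment(2) mdist_nonneg order_refl)
    then have "mdist M z (c s) \<le> dist p z'"
      using c' by (simp add: geodesic_between_def mdist_commute)
    then have "(mdist M z (c s))\<^sup>2 \<le> (dist p z')\<^sup>2"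
      by (intro power_mono) auto
    also have "(dist p z')\<^sup>2 = (1 - t) * (dist x' z')\<^sup>2 + t * (dist y' z')\<^sup>2 - t * (1 - t) * (dist x' y')\<^sup>2"
      unfolding p_def dist_norm power2_norm_eq_inner
      by (simp add: algebra_simps inner_commute)
    finally show ?thesis
      using d by (simp add: mdist_commute)
  qed
  ultimately show ?thesis
    by blast
qed

lemma hadamard_pd:
  assumes ne: "mspace M \<noteq> {}" and h: "hadamard_space M"
  shows "hadamard_pseudometric (pd M)"
proof
  note r = retr_in [OF ne]
  show "pd M x x = 0" "pd M x y = pd M y x" "pd M x z \<le> pd M x y + pd M y z" for x y z
    by (simp_all add: pd_def r mdist_commute mdist_triangle)
  show "\<exists>l. (\<lambda>n::nat. pd M (s n) l) \<longlonglongrightarrow> 0"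
    if "\<And>e. e > 0 \<Longrightarrow> \<exists>N. \<forall>m\<ge>N. \<forall>n\<ge>N. pd M (s m) (s n) < e" for s
    using complete_pd [OF ne _ that] h unfolding hadamard_space_def by blast
  show "\<exists>p. \<forall>z. (pd M z p)\<^sup>2 \<le> (1 - t) * (pd M z x)\<^sup>2 + t * (pd M z y)\<^sup>2 - t * (1 - t) * (pd M x y)\<^sup>2"
    if t: "0 \<le> t" "t \<le> 1" for t x y
  proof -
    obtain p where "p \<in> mspace M" "\<forall>z\<in>mspace M. (mdist M z p)\<^sup>2 \<le> (1 - t) * (mdist M z (retr M x))\<^sup>2 +
        t * (mdist M z (retr M y))\<^sup>2 - t * (1 - t) * (mdist M (retr M x) (retr M y))\<^sup>2"
      using CAT0_cn [OF _ r r t, of x y] h unfolding hadamard_space_def by blast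
    then show ?thesis
      unfolding pd_def using r by (intro exI [of _ p]) simp
  qed
qed

lemma proper_hadamard_pd:
  assumes ne: "mspace M \<noteq> {}" and h: "hadamard_space M" and lc: "locally_compact_space (mtopology_of M)"
  shows "proper_hadamard_pseudometric (pd M)"
proof (rule hadamard_pseudometric.hopf_rinow [OF hadamard_pd [OF ne h]])
  fix x
  interpret hadamard_pseudometric "pd M"
    by (rule hadamard_pd [OF ne h])
  interpret M: Metric_space "mspace M" "mdist M"
    by (rule Metric_space_mspace_mdist)
  have x: "retr M x \<in> mspace M"
    by (rule retr_in [OF ne])
  obtain U K where U: "openin (mtopology_of M) U" "retr M x \<in> U" "U \<subseteq> K" and K: "compactin (mtopology_of M) K"
    using lc x unfolding locally_compact_space_def by (metis topspace_mtopology_of)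
  obtain r where r: "r > 0" "M.mball (retr M x) r \<subseteq> U"
    using U(1,2) unfolding mtopology_of_def M.openin_mtopology by blast
  have "seq_compact_ball x (r / 2)"
    unfolding seq_compact_ball_def
  proof (intro allI impI)
    fix s :: "nat \<Rightarrow> 'a" assume s: "\<forall>n. pd M x (s n) \<le> r / 2"
    have "retr M (s n) \<in> K" for n
    proof -
      have "mdist M (retr M x) (retr M (s n)) < r"
        using s [rule_format, of n] r(1) unfolding pd_def by linarith
      then have "retr M (s n) \<in> M.mball (retr M x) r"
        using x retr_in [OF ne] by (simp add: M.in_mball)
      then show ?thesis
        using r U(3) by blast
    qed
    then have "range (\<lambda>n. retr M (s n)) \<subseteq> K"
      by blast
    then obtain l q where q: "strict_mono q" "limitin (mtopology_of M) ((\<lambda>n. retr M (s n)) \<circ> q) l sequentially"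
      using K unfolding mtopology_of_def M.compactin_sequentially by blast
    then have "l \<in> mspace M" "(\<lambda>n. mdist M (retr M (s (q n))) l) \<longlonglongrightarrow> 0"
      unfolding limitin_mtopology_of by (auto simp: o_def)
    then have "(\<lambda>n. pd M (s (q n)) l) \<longlonglongrightarrow> 0"
      by (simp add: pd_def)
    with q(1) show "\<exists>r l. strict_mono r \<and> (\<lambda>n. pd M (s (r n)) l) \<longlonglongrightarrow> 0"
      by blast
  qed
  then show "\<exists>r>0. hadamard_pseudometric.seq_compact_ball (pd M) x r"
    using r(1) by (intro exI [of _ "r / 2"]) simp
qed

lemma real_isometry_cases:
  fixes \<tau> :: "real \<Rightarrow> real"
  assumes "\<And>u v. \<bar>\<tau> u - \<tau> v\<bar> = \<bar>u - v\<bar>"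
  obtains \<epsilon> where "\<epsilon> * \<epsilon> = 1" "\<And>u. \<tau> u = \<tau> 0 + \<epsilon> * u"
proof -
  consider "\<tau> 1 = \<tau> 0 + 1" | "\<tau> 1 = \<tau> 0 - 1"
    using assms [of 1 0] by linarith
  then show ?thesis
  proof cases
    case 1
    have "\<tau> u = \<tau> 0 + 1 * u" for u
      using assms [of u 0] assms [of u 1] 1 by linarith
    then show ?thesis
      by (rule that [of 1, rotated]) simp
  next
    case 2
    have "\<tau> u = \<tau> 0 + (- 1) * u" for u
      using assms [of u 0] assms [of u 1] 2 by linarith
    then show ?thesis
      by (rule that [of "- 1", rotated]) simp
  qed
qed

text \<open>The assumption concerns the pseudometric, so that the product is covered too: there the
  inequality of Bruhat and Tits is summed over the factors instead of comparing triangles.\<close>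

locale hadamard_metric =
  fixes M :: "'a metric"
  assumes ne: "mspace M \<noteq> {}" and pseudo: "hadamard_pseudometric (pd M)"

sublocale hadamard_metric \<subseteq> hadamard_pseudometric "pd M"
  by (rule pseudo)

context hadamard_metric
begin

lemma pd_eq_0: "x \<in> mspace M \<Longrightarrow> y \<in> mspace M \<Longrightarrow> pd M x y = 0 \<Longrightarrow> x = y"
  by (simp add: pd_mdist)

lemma rays_in: "c \<in> rays M \<Longrightarrow> 0 \<le> t \<Longrightarrow> c t \<in> mspace M"
  by (auto simp: rays_def geodesic_on_def)

lemma rays_ray: "c \<in> rays M \<Longrightarrow> ray c"
  using rays_in by (auto simp: rays_def geodesic_on_def ray_def pd_mdist)

lemma ray_retr: "ray c \<Longrightarrow> (\<lambda>t. retr M (c t)) \<in> rays M"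
  using retr_in [OF ne] by (auto simp: rays_def geodesic_on_def ray_def pd_def)

lemma asym_retr: "asym c (\<lambda>t. retr M (c t))"
  by (rule asym_of_zero) (simp add: pd_retr [OF ne])

lemma asymptotic_iff: "(c, c') \<in> asymptotic M \<longleftrightarrow> c \<in> rays M \<and> c' \<in> rays M \<and> asym c c'"
proof (cases "c \<in> rays M \<and> c' \<in> rays M")
  case True
  then have "(\<forall>t\<ge>0. mdist M (c t) (c' t) \<le> K) \<longleftrightarrow> (\<forall>t\<ge>0. pd M (c t) (c' t) \<le> K)" for K
    using rays_in by (simp add: pd_mdist)
  then show ?thesis
    using True by (simp add: asymptotic_def asym_def)
qed (auto simp: asymptotic_def)

lemma mem_endpoint: "c' \<in> endpoint M c \<longleftrightarrow> c \<in> rays M \<and> c' \<in> rays M \<and> asym c c'"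
  by (simp add: endpoint_def asymptotic_iff)

lemma endpoint_eq_iff:
  "c \<in> rays M \<Longrightarrow> c' \<in> rays M \<Longrightarrow> endpoint M c = endpoint M c' \<longleftrightarrow> asym c c'"
  using eq_equiv_class_iff [OF equiv_asymptotic, of c M c'] by (simp add: endpoint_def asymptotic_iff)

lemma endpoint_in: "c \<in> rays M \<Longrightarrow> endpoint M c \<in> gboundary M"
  by (simp add: gboundary_def endpoint_def quotientI)

lemma rays_from:
  assumes "c \<in> rays M" "p \<in> mspace M"
  obtains c' where "c' \<in> rays M" "c' 0 = p" "asym c c'"
proof -
  obtain c' where c': "ray c'" "c' 0 = p" "asym c c'"
    using ray_from [OF rays_ray [OF assms(1)]] by blast
  show ?thesis
    using that [of "\<lambda>t. retr M (c' t)"] ray_retr [OF c'(1)] c'(2) assms(2) asym_trans [OF c'(3) asym_retr]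
    by simp
qed

lemma gboundary_endpoint:
  assumes "\<xi> \<in> gboundary M" "c \<in> \<xi>"
  shows "c \<in> rays M" "\<xi> = endpoint M c"
proof -
  obtain e where e: "e \<in> rays M" "\<xi> = endpoint M e"
    using assms(1) unfolding gboundary_def endpoint_def by (blast elim: quotientE)
  then show "c \<in> rays M" "\<xi> = endpoint M c"
    using assms(2) endpoint_eq_iff [of e c] by (auto simp: mem_endpoint)
qed

lemma gboundary_ray_from:
  assumes "\<xi> \<in> gboundary M" "p \<in> mspace M"
  obtains c where "c \<in> rays M" "c 0 = p" "\<xi> = endpoint M c"
proof -
  obtain e where e: "e \<in> rays M" "\<xi> = endpoint M e"
    using assms(1) unfolding gboundary_def endpoint_def by (blast elim: quotientE)
  then show ?thesis
    using rays_from [OF e(1) assms(2)] endpoint_eq_iff [of e] that by metis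
qed

lemma geodesic_pt:
  assumes xy: "x \<in> mspace M" "y \<in> mspace M" and g: "geodesic_between M x y g"
    and s: "0 \<le> s" "s \<le> mdist M x y"
  shows "g s \<in> mspace M" "pd M (g s) (pt x y s) = 0"
proof -
  let ?D = "mdist M x y"
  have on: "\<And>a b. a \<in> {0..?D} \<Longrightarrow> b \<in> {0..?D} \<Longrightarrow> mdist M (g a) (g b) = \<bar>a - b\<bar>" "g ` {0..?D} \<subseteq> mspace M"
    and ends: "g 0 = x" "g ?D = y"
    using g unfolding geodesic_between_def geodesic_on_def by auto
  show gs: "g s \<in> mspace M"
    using on(2) s by auto
  show "pd M (g s) (pt x y s) = 0"
    using on(1) [of 0 s] on(1) [of s ?D] ends s gs xy by (intro pt_unique) (auto simp: pd_mdist)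
qed

lemma geodesic_exists:
  assumes xy: "x \<in> mspace M" "y \<in> mspace M"
  obtains g where "geodesic_between M x y g"
proof -
  define g where "g s = (if s = 0 then x else retr M (pt x y s))" for s
  have x0: "pd M x (pt x y 0) = 0"
    using dist_pt(1) [of 0 x y] by simp
  have gM: "g s \<in> mspace M" "pd M (g s) (pt x y s) = 0" for s
    using xy x0 retr_in [OF ne] pd_retr [OF ne, of "pt x y s"] sym [of "retr M (pt x y s)" "pt x y s"]
    by (auto simp: g_def)
  have "mdist M (g s) (g t) = \<bar>s - t\<bar>" if "s \<in> {0..mdist M x y}" "t \<in> {0..mdist M x y}" for s t
  proof -
    have "mdist M (g s) (g t) = pd M (g s) (g t)"
      using gM(1) by (simp only: pd_mdist)
    also have "\<dots> = pd M (pt x y s) (pt x y t)"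
      by (rule d0_cong [OF gM(2) gM(2)])
    also have "\<dots> = \<bar>s - t\<bar>"
      using that xy by (intro dist_pt_pt) (auto simp: pd_mdist)
    finally show ?thesis .
  qed
  moreover have "g (mdist M x y) = y"
    using xy by (auto simp: g_def pt_def pd_mdist)
  moreover have "g 0 = x"
    by (simp add: g_def)
  ultimately show ?thesis
    using that [of g] gM(1) unfolding geodesic_between_def geodesic_on_def by blast

qed

text \<open>This links the filters to the cone topology, whose subbasic sets allow any base point
  and radius: the ray is moved to the base point \<open>c' 0\<close>, and a late time
  \<open>S\<close> makes the contraction at time \<open>R\<close> beat the slack \<delta>.\<close>

lemma cone_nbhd_open:
  assumes c: "c \<in> rays M" and c': "c' \<in> rays M" and R: "R > 0"
    and \<xi>: "Inr (endpoint M c) \<in> cone_nbhd M c' R \<epsilon>"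
  shows "\<exists>T>0. (\<forall>y\<in>mspace M. y \<in> N c T \<longrightarrow> Inl y \<in> cone_nbhd M c' R \<epsilon>) \<and>
     (\<forall>e\<in>rays M. eventually (\<lambda>y. y \<in> N c T) (nb e) \<longrightarrow> Inr (endpoint M e) \<in> cone_nbhd M c' R \<epsilon>)"
proof -
  obtain g where g: "g \<in> endpoint M c" "g 0 = c' 0" "mdist M (g R) (c' R) < \<epsilon>"
    using \<xi> unfolding cone_nbhd_def by blast
  have gr: "g \<in> rays M" "asym c g"
    using g(1) by (auto simp: mem_endpoint)
  define \<delta> where "\<delta> = \<epsilon> - mdist M (g R) (c' R)"
  have \<delta>: "\<delta> > 0"
    using g(3) by (simp add: \<delta>_def)
  define S where "S = R + R / \<delta> + 1"
  have S: "0 < S" "R < S" "R / S < \<delta>"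
    using R \<delta> by (auto simp: S_def field_simps add_pos_pos)
  have ev: "eventually (\<lambda>y. y \<in> N g S) (nb c)"
    unfolding nb_cong [OF rays_ray [OF c] rays_ray [OF gr(1)] gr(2)]
    by (rule eventually_N [OF rays_ray [OF gr(1)] S(1)])
  then obtain T where T: "T > 0" "\<forall>y\<in>N c T. y \<in> N g S"
    using eventually_nb [OF rays_ray [OF c]] by blast
  have Inl: "Inl y \<in> cone_nbhd M c' R \<epsilon>" if y: "y \<in> mspace M" "y \<in> N c T" for y
  proof -
    have p: "c' 0 \<in> mspace M"
      using rays_in c' by blast
    have yS: "y \<in> N g S"
      using T y by blast
    then have far: "S \<le> mdist M (c' 0) y"
      using y p g(2) by (simp add: N_def pd_mdist)
    obtain h where h: "geodesic_between M (c' 0) y h"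
      using geodesic_exists [OF p y(1)] .
    have hR: "h R \<in> mspace M" "pd M (h R) (pt (c' 0) y R) = 0"
      using geodesic_pt [OF p y(1) h, of R] R S far by auto
    have "pd M (pt (g 0) y R) (g R) \<le> R / S * pd M (pt (g 0) y S) (g S)"
      using S R yS rays_ray [OF gr(1)] by (intro ray_contract) (auto simp: N_def)
    also have "\<dots> \<le> R / S * 1"
      using S R yS by (intro mult_left_mono) (auto simp: N_def)
    finally have "pd M (h R) (g R) < \<delta>"
      using S(3) d0_left [OF hR(2), of "g R"] g(2) by simp
    then have "mdist M (h R) (c' R) < \<epsilon>"
      using mdist_triangle [of "h R" M "g R" "c' R"] hR(1) rays_in [OF gr(1), of R] rays_in [OF c', of R] R
      by (simp add: pd_mdist \<delta>_def)
    then show ?thesis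
      unfolding cone_nbhd_def using y far S h by auto
  qed
  have Inr: "Inr (endpoint M e) \<in> cone_nbhd M c' R \<epsilon>"
    if e: "e \<in> rays M" "eventually (\<lambda>y. y \<in> N c T) (nb e)" for e
  proof -
    obtain e' where e': "e' \<in> rays M" "e' 0 = c' 0" "asym e e'"
      using rays_from [OF e(1) rays_in [OF c', of 0]] by auto
    have "eventually (\<lambda>y. y \<in> N g S) (nb e')"
      using e(2) T(2) unfolding nb_cong [OF rays_ray [OF e(1)] rays_ray [OF e'(1)] e'(3)]
      by (auto elim: eventually_mono)
    then have "pd M (g S) (e' S) < 1"
      using rays_ray [OF gr(1)] rays_ray [OF e'(1)] e'(2) g(2) S(1) by (intro nearD) auto
    then have "R / S * pd M (g S) (e' S) \<le> R / S * 1"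
      using R S by (intro mult_left_mono) auto
    moreover have "pd M (e' R) (g R) \<le> R / S * pd M (e' S) (g S)"
      using rays_ray [OF gr(1)] rays_ray [OF e'(1)] e'(2) g(2) S R by (intro rays_contract) auto
    ultimately have "pd M (e' R) (g R) < \<delta>"
      using S(3) sym [of "e' S" "g S"] by simp
    then have "mdist M (e' R) (c' R) < \<epsilon>"
      using mdist_triangle [of "e' R" M "g R" "c' R"] rays_in [OF e'(1), of R] rays_in [OF gr(1), of R]
        rays_in [OF c', of R] R by (simp add: pd_mdist \<delta>_def)
    moreover have "e' \<in> endpoint M e"
      using e' e by (simp add: mem_endpoint)
    ultimately show ?thesis
      unfolding cone_nbhd_def using endpoint_in [OF e(1)] e'(2) by blast
  qed
  show ?thesis
    using T(1) Inl Inr by blast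
qed

lemma cone_open:
  assumes U: "openin (cone_topology M) U" and \<xi>: "Inr (endpoint M c) \<in> U" and c: "c \<in> rays M"
  shows "\<exists>T>0. (\<forall>y\<in>mspace M. y \<in> N c T \<longrightarrow> Inl y \<in> U) \<and>
     (\<forall>e\<in>rays M. eventually (\<lambda>y. y \<in> N c T) (nb e) \<longrightarrow> Inr (endpoint M e) \<in> U)"
proof -
  have "generate_topology_on ({Inl ` mball_of M x \<epsilon> | x \<epsilon>. x \<in> mspace M \<and> \<epsilon> > 0} \<union>
      {cone_nbhd M c R \<epsilon> | c R \<epsilon>. c \<in> rays M \<and> R > 0 \<and> \<epsilon> > 0}) U"
    using U unfolding cone_topology_def openin_topology_generated_by_iff .
  then show ?thesis
    using \<xi>
  proof induction
    case (Int a b)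
    then obtain T S where T: "T > 0" "\<forall>y\<in>mspace M. y \<in> N c T \<longrightarrow> Inl y \<in> a"
        "\<forall>e\<in>rays M. eventually (\<lambda>y. y \<in> N c T) (nb e) \<longrightarrow> Inr (endpoint M e) \<in> a"
      and S: "S > 0" "\<forall>y\<in>mspace M. y \<in> N c S \<longrightarrow> Inl y \<in> b"
        "\<forall>e\<in>rays M. eventually (\<lambda>y. y \<in> N c S) (nb e) \<longrightarrow> Inr (endpoint M e) \<in> b"
      by blast
    define Q where "Q = max T S"
    have sub: "N c Q \<subseteq> N c T" "N c Q \<subseteq> N c S"
      unfolding Q_def using N_mono [OF rays_ray [OF c]] T(1) S(1) by auto
    then have "eventually (\<lambda>y. y \<in> N c T) (nb e) \<and> eventually (\<lambda>y. y \<in> N c S) (nb e)"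
      if "eventually (\<lambda>y. y \<in> N c Q) (nb e)" for e
      using that by (auto elim: eventually_mono)
    moreover have "Q > 0"
      using T(1) by (simp add: Q_def)
    ultimately show ?case
      using T S sub by blast
  next
    case (UN K)
    then show ?case
      by (meson UnionE UnionI)
  next
    case (Basis s)
    then obtain c' R \<epsilon> where "s = cone_nbhd M c' R \<epsilon>" "c' \<in> rays M" "R > 0"
      by blast
    then show ?case
      using cone_nbhd_open [OF c, of c' R \<epsilon>] Basis by simp
  qed simp
qed

lemma boundary_open:
  assumes "openin (boundary_topology M) U" "endpoint M c \<in> U" "c \<in> rays M"
  shows "\<exists>T>0. \<forall>e\<in>rays M. eventually (\<lambda>y. y \<in> N c T) (nb e) \<longrightarrow> endpoint M e \<in> U"
proof -
  obtain V where V: "openin (cone_topology M) V" "U = Inr -` V \<inter> gboundary M"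
    using assms(1) unfolding boundary_topology_def openin_pullback_topology by blast
  then show ?thesis
    using cone_open [OF V(1) _ assms(3)] assms(2) endpoint_in by blast
qed

text \<open>The image is closed because a half plane is complete, and convex because geodesics are
  unique and the straight segments of the half plane supply them.\<close>

lemma half_plane_imp_bounds:
  assumes \<sigma>: "geodesic_on UNIV M \<sigma>" and hp: "half_plane \<sigma>"
  shows "bounds_flat_half_plane M \<sigma>"
proof -
  interpret Metric_space "mspace M" "mdist M"
    by (rule Metric_space_mspace_mdist)
  obtain F where F: "\<forall>v\<ge>0. \<forall>v'\<ge>0. \<forall>u u'. pd M (F v u) (F v' u') = sqrt ((v - v')\<^sup>2 + (u - u')\<^sup>2)"
      "\<forall>u. pd M (F 0 u) (\<sigma> u) = 0"
    using hp unfolding half_plane_def by blast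
  define H where "H = {0 :: real..} \<times> (UNIV :: real set)"
  \<comment> \<open>On the boundary \<sigma> itself is used, because its range has to be attained
    exactly; elsewhere the retraction brings \<open>F\<close> into the space.\<close>
  define f where "f p = (if fst p = 0 then \<sigma> (snd p) else retr M (F (fst p) (snd p)))" for p :: "real \<times> real"
  have \<sigma>M: "\<sigma> t \<in> mspace M" for t
    using \<sigma> by (auto simp: geodesic_on_def)
  have fM: "f p \<in> mspace M" for p
    using \<sigma>M retr_in [OF ne] by (simp add: f_def)
  have fF: "pd M (f p) (F (fst p) (snd p)) = 0" for p
    using F(2) pd_retr [OF ne, of "F (fst p) (snd p)"] sym [of "f p" "F (fst p) (snd p)"]
    by (simp add: f_def)
  have iso: "mdist M (f p) (f q) = dist p q" if "p \<in> H" "q \<in> H" for p q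
  proof -
    have "mdist M (f p) (f q) = pd M (f p) (f q)"
      using fM by (simp add: pd_mdist)
    also have "\<dots> = pd M (F (fst p) (snd p)) (F (fst q) (snd q))"
      by (rule d0_cong [OF fF fF])
    also have "\<dots> = dist p q"
      using that F(1) by (auto simp: H_def dist_prod_def dist_real_def)
    finally show ?thesis .
  qed
  have "closed H"
    unfolding H_def by (intro closed_Times closed_atLeast closed_UNIV)
  have cl: "closedin (mtopology_of M) (f ` H)"
    unfolding mtopology_of_def metric_closedin_iff_sequentially_closed
  proof (intro conjI allI impI)
    show "f ` H \<subseteq> mspace M"
      using fM by blast
    fix s l assume s: "range s \<subseteq> f ` H \<and> limitin mtopology s l sequentially"
    then have "\<exists>p. p \<in> H \<and> s n = f p" for n :: nat
      by blast
    then obtain p where p: "\<And>n::nat. p n \<in> H" "\<And>n. s n = f (p n)"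
      by metis
    have sM: "range s \<subseteq> mspace M"
      using p(2) fM by (metis image_subsetI)
    have sl: "limitin mtopology s l sequentially"
      using s by blast
    have mc: "MCauchy s"
      by (rule convergent_imp_MCauchy [OF sM sl])
    have sp: "mdist M (s m) (s n) = dist (p m) (p n)" for m n
      unfolding p(2) by (rule iso [OF p(1) p(1)])
    have "Cauchy p"
    proof (rule metric_CauchyI)
      fix e :: real assume "0 < e"
      then obtain K where "\<forall>n n'. K \<le> n \<longrightarrow> K \<le> n' \<longrightarrow> dist (p n) (p n') < e"
        using mc unfolding MCauchy_def sp by meson
      then show "\<exists>K. \<forall>m\<ge>K. \<forall>n\<ge>K. dist (p m) (p n) < e"
        by (intro exI [of _ K]) simp
    qed
    then obtain q where q: "p \<longlonglongrightarrow> q"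
      using Cauchy_convergent_iff [of p] by (auto simp: convergent_def)
    have qH: "q \<in> H"
      by (rule closed_sequentially [OF \<open>closed H\<close> p(1) q])
    have "(\<lambda>n. mdist M (s n) (f q)) \<longlonglongrightarrow> 0"
    proof -
      have "mdist M (s n) (f q) = dist (p n) q" for n
        unfolding p(2) by (rule iso [OF p(1) qH])
      then show ?thesis
        using q tendsto_dist_iff [of p q sequentially] by simp
    qed
    then have "limitin mtopology s (f q) sequentially"
      unfolding limitin_metric_dist_null using fM sM by (simp add: image_subset_iff)
    then have "l = f q"
      by (rule limitin_metric_unique [OF sl]) simp
    then show "l \<in> f ` H"
      using qH by blast
  qed
  have cv: "gconvex M (f ` H)"
    unfolding gconvex_def
  proof (intro conjI ballI allI impI subsetI)
    show "x \<in> mspace M" if "x \<in> f ` H" for x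
      using fM that by blast
    fix x y c z assume "x \<in> f ` H" "y \<in> f ` H" and c: "geodesic_between M x y c"
      and "z \<in> c ` {0..mdist M x y}"
    then obtain p q s where p: "p \<in> H" "x = f p" and q: "q \<in> H" "y = f q"
      and s: "z = c s" "0 \<le> s" "s \<le> mdist M x y"
      by auto
    define t where "t = s / mdist M x y"
    define w where "w = (1 - t) *\<^sub>R p + t *\<^sub>R q"
    have t: "0 \<le> t" "t \<le> 1"
      using s by (auto simp: t_def divide_le_eq_1)
    have tD: "t * mdist M x y = s"
      using s by (cases "mdist M x y = 0") (auto simp: t_def)
    have wH: "w \<in> H"
      using p(1) q(1) t by (auto simp: H_def w_def)
    have "w - p = t *\<^sub>R (q - p)" "q - w = (1 - t) *\<^sub>R (q - p)"
      by (simp_all add: w_def algebra_simps)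
    then have "dist w p = t * dist q p" "dist q w = (1 - t) * dist q p"
      using t by (simp_all add: dist_norm)
    then have D: "mdist M x (f w) = s" "mdist M (f w) y = mdist M x y - s"
    proof -
      have D: "mdist M x y = dist q p"
        using iso [OF p(1) q(1)] p q by (simp add: dist_commute)
      show "mdist M x (f w) = s"
        using iso [OF p(1) wH] p(2) \<open>dist w p = t * dist q p\<close> tD D by (simp add: dist_commute)
      show "mdist M (f w) y = mdist M x y - s"
        using iso [OF wH q(1)] q(2) \<open>dist q w = (1 - t) * dist q p\<close> tD D
        by (simp add: dist_commute left_diff_distrib)
    qed
    then have "pd M (f w) (pt x y s) = 0"
      using s D fM p(2) q(2) by (intro pt_unique) (simp_all add: pd_mdist)
    moreover have cs: "pd M (c s) (pt x y s) = 0" "c s \<in> mspace M"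
      using geodesic_pt [OF _ _ c s(2,3)] fM p q by auto
    ultimately have "pd M (c s) (f w) = 0"
      using d0_left [of "c s" "pt x y s" "f w"] sym [of "f w" "pt x y s"] by simp
    then have "c s = f w"
      using pd_eq_0 cs(2) fM by blast
    then show "z \<in> f ` H"
      using s(1) wH by blast
  qed
  have "f ` ({0} \<times> UNIV) = range (\<lambda>u. f (0, u))"
    by auto
  then have "f ` ({0} \<times> UNIV) = range \<sigma>"
    by (simp add: f_def)
  then show ?thesis
    unfolding bounds_flat_half_plane_def using cl cv iso unfolding H_def by blast
qed

text \<open>The boundary of the half plane is given only as the set \<open>range \<sigma>\<close>.
  Its parametrisation differs from \<sigma> by an isometry \<tau> of the real line, which
  \<open>F\<close> undoes.\<close>

lemma bounds_imp_half_plane: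
  assumes \<sigma>: "geodesic_on UNIV M \<sigma>" and b: "bounds_flat_half_plane M \<sigma>"
  shows "half_plane \<sigma>"
proof -
  let ?H = "{0..} \<times> (UNIV :: real set)"
  obtain A f where A: "gconvex M A" "f ` ?H = A"
    and iso: "\<forall>p\<in>?H. \<forall>q\<in>?H. mdist M (f p) (f q) = dist p q"
    and bd: "f ` ({0 :: real} \<times> (UNIV :: real set)) = range \<sigma>"
    using b unfolding bounds_flat_half_plane_def by blast
  have "\<exists>t. f (0, u) = \<sigma> t" for u
  proof -
    have "f (0, u) \<in> f ` ({0} \<times> UNIV)"
      by blast
    then show ?thesis
      unfolding bd by blast
  qed
  then obtain \<tau> where \<tau>: "\<And>u. f (0, u) = \<sigma> (\<tau> u)"
    by metis
  have "\<bar>\<tau> u - \<tau> v\<bar> = \<bar>u - v\<bar>" for u v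
  proof -
    have "\<bar>\<tau> u - \<tau> v\<bar> = mdist M (\<sigma> (\<tau> u)) (\<sigma> (\<tau> v))"
      using \<sigma> by (simp add: geodesic_on_def)
    also have "\<dots> = dist (0 :: real, u) (0, v)"
      unfolding \<tau> [symmetric] using iso by auto
    finally show ?thesis
      by (simp add: dist_prod_def dist_real_def)
  qed
  then obtain \<epsilon> where \<epsilon>: "\<epsilon> * \<epsilon> = 1" "\<And>u. \<tau> u = \<tau> 0 + \<epsilon> * u"
    using real_isometry_cases [of \<tau>] by blast
  define F where "F v u = f (v, \<epsilon> * (u - \<tau> 0))" for v u
  have "pd M (F v u) (F v' u') = sqrt ((v - v')\<^sup>2 + (u - u')\<^sup>2)" if "0 \<le> v" "0 \<le> v'" for v v' u u'
  proof -
    have "F v u \<in> mspace M" "F v' u' \<in> mspace M"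
      using A that unfolding F_def gconvex_def by auto
    then have "pd M (F v u) (F v' u') = dist (v, \<epsilon> * (u - \<tau> 0)) (v', \<epsilon> * (u' - \<tau> 0))"
      using iso that by (simp add: pd_mdist F_def)
    also have "\<dots> = sqrt ((v - v')\<^sup>2 + (\<epsilon> * (u - u'))\<^sup>2)"
      by (simp add: dist_prod_def dist_real_def right_diff_distrib)
    also have "(\<epsilon> * (u - u'))\<^sup>2 = (u - u')\<^sup>2"
      using \<epsilon>(1) by (simp add: power_mult_distrib power2_eq_square)
    finally show ?thesis .
  qed
  moreover have "pd M (F 0 u) (\<sigma> u) = 0" for u
  proof -
    have "\<tau> (\<epsilon> * (u - \<tau> 0)) = u"
      using \<epsilon>(1) \<epsilon>(2) [of "\<epsilon> * (u - \<tau> 0)"] by (simp flip: mult.assoc)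
    then show ?thesis
      by (simp add: F_def \<tau>)
  qed
  ultimately show ?thesis
    unfolding half_plane_def by blast
qed

end

section \<open>Isometries of locally compact Hadamard spaces\<close>

locale proper_hadamard_metric =
  fixes M :: "'a metric"
  assumes nonempty: "mspace M \<noteq> {}" and hadamard: "hadamard_space M"
    and locally_compact: "locally_compact_space (mtopology_of M)"

definition mact :: "'a metric \<Rightarrow> ('a \<Rightarrow> 'a) \<Rightarrow> 'a \<Rightarrow> 'a" where
  "mact M g x = g (retr M x)"

lemma carrier_isometry_group [simp]: "carrier (isometry_group M) = isometries M"
  by (simp add: isometry_group_def)

lemma isometry_in: "g \<in> isometries M \<Longrightarrow> x \<in> mspace M \<Longrightarrow> g x \<in> mspace M"
  by (auto simp: isometries_def Bij_def bij_betw_def)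

sublocale proper_hadamard_metric \<subseteq> hadamard_metric M
  by (rule hadamard_metric.intro [OF nonempty hadamard_pd [OF nonempty hadamard]])

sublocale proper_hadamard_metric \<subseteq> isometric_action "pd M" "isometry_group M" "mact M"
proof -
  interpret p: proper_hadamard_pseudometric "pd M"
    by (rule proper_hadamard_pd [OF nonempty hadamard locally_compact])
  interpret g: group "isometry_group M"
    by (rule group_isometry_group)
  note r = retr_in [OF nonempty]
  show "isometric_action (pd M) (isometry_group M) (mact M)"
  proof
    show "pd M (mact M g x) (mact M g y) = pd M x y" if "g \<in> carrier (isometry_group M)" for g x y
      using that isometry_in [of g M] r by (simp add: pd_def mact_def isometries_def)
    show "mact M (g \<otimes>\<^bsub>isometry_group M\<^esub> h) x = mact M g (mact M h x)"
      if "g \<in> carrier (isometry_group M)" "h \<in> carrier (isometry_group M)" for g h x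
    proof -
      have "g \<in> Bij (mspace M)" "h \<in> Bij (mspace M)"
        using that by (auto simp: isometries_def)
      then show ?thesis
        using that isometry_in [of h M] r by (simp add: mact_def isometry_group_def BijGroup_def compose_eq)
    qed
    show "pd M (mact M \<one>\<^bsub>isometry_group M\<^esub> x) x = 0" for x
      using r by (simp add: mact_def isometry_group_def BijGroup_def pd_def)
  qed
qed

context hadamard_pseudometric
begin

lemma half_plane_cong:
  assumes "half_plane \<sigma>" "\<And>t. d (\<sigma> t) (\<tau> t) = 0"
  shows "half_plane \<tau>"
proof -
  obtain F where F: "\<forall>v\<ge>0. \<forall>v'\<ge>0. \<forall>u u'. d (F v u) (F v' u') = sqrt ((v - v')\<^sup>2 + (u - u')\<^sup>2)"
      "\<forall>u. d (F 0 u) (\<sigma> u) = 0"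
    using assms(1) unfolding half_plane_def by blast
  have "d (F 0 u) (\<tau> u) = 0" for u
    using F(2) d0_right [OF assms(2), of "F 0 u" u] by simp
  with F(1) show ?thesis
    unfolding half_plane_def by blast
qed

end

context proper_hadamard_metric
begin

lemma rank_oneE:
  assumes "rank_one M h"
  obtains \<sigma> l where "h \<in> isometries M" "geodesic_on UNIV M \<sigma>" "\<And>t. h (\<sigma> t) = \<sigma> (t + l)"
    "axis h \<sigma> l" "\<not> half_plane \<sigma>" "attracting_fixpoint M h = endpoint M \<sigma>"
    "repelling_fixpoint M h = endpoint M (\<lambda>t. \<sigma> (- t))"
proof -
  obtain \<sigma> where h: "h \<in> isometries M" and ax: "is_axis M h \<sigma>" and nb: "\<not> bounds_flat_half_plane M \<sigma>"
    using assms unfolding rank_one_def by blast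
  obtain l where \<sigma>: "geodesic_on UNIV M \<sigma>" and l: "l > 0" "\<And>t. h (\<sigma> t) = \<sigma> (t + l)"
    using ax unfolding is_axis_def by blast
  have \<sigma>M: "\<sigma> t \<in> mspace M" for t
    using \<sigma> by (auto simp: geodesic_on_def)
  then have "line \<sigma>"
    using \<sigma> by (simp add: geodesic_on_def line_def pd_mdist)
  moreover have "pd M (mact M h (\<sigma> t)) (\<sigma> (t + l)) = 0" for t
    using \<sigma>M l(2) by (simp add: mact_def)
  ultimately have "axis h \<sigma> l"
    using l(1) by (simp add: axis_def)
  then show ?thesis
    using that [OF h \<sigma> l(2)] half_plane_imp_bounds [OF \<sigma>] nb attracting_fixpoint_eq [OF h ax]
      repelling_fixpoint_eq [OF h ax] by blast
qed

text \<open>The retraction of an axis for the pseudometric is an axis in the space, since points of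
  the space at distance 0 coincide.\<close>

lemma rank_oneI:
  assumes h: "h \<in> isometries M" and ax: "axis h \<sigma> l" and nh: "\<not> half_plane \<sigma>"
  shows "rank_one M h"
    and "attracting_fixpoint M h = endpoint M (\<lambda>t. retr M (\<sigma> t))"
    and "repelling_fixpoint M h = endpoint M (\<lambda>t. retr M (\<sigma> (- t)))"
proof -
  define \<tau> where "\<tau> t = retr M (\<sigma> t)" for t
  have \<tau>M: "\<tau> t \<in> mspace M" and 0: "pd M (\<sigma> t) (\<tau> t) = 0" for t
    using retr_in [OF ne] pd_retr [OF ne] by (auto simp: \<tau>_def)
  have \<tau>: "geodesic_on UNIV M \<tau>"
    using ax retr_in [OF ne] by (auto simp: geodesic_on_def \<tau>_def axis_def line_def pd_def)
  have "h (\<tau> t) = \<tau> (t + l)" for t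
  proof (rule pd_eq_0)
    show "h (\<tau> t) \<in> mspace M" "\<tau> (t + l) \<in> mspace M"
      using h \<tau>M by (auto intro: isometry_in)
    have "pd M (mact M h (\<sigma> t)) (\<sigma> (t + l)) = 0"
      using ax by (simp add: axis_def)
    then show "pd M (h (\<tau> t)) (\<tau> (t + l)) = 0"
      using d0_right [OF 0, of "mact M h (\<sigma> t)" "t + l"] by (simp add: mact_def \<tau>_def)
  qed
  then have ia: "is_axis M h \<tau>"
    using \<tau> ax unfolding is_axis_def axis_def by blast
  have "\<not> bounds_flat_half_plane M \<tau>"
    using bounds_imp_half_plane [OF \<tau>] half_plane_cong [of \<tau> \<sigma>] nh 0 sym by metis
  then show "rank_one M h"
    using h ia unfolding rank_one_def by blast
  show "attracting_fixpoint M h = endpoint M (\<lambda>t. retr M (\<sigma> t))"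
    "repelling_fixpoint M h = endpoint M (\<lambda>t. retr M (\<sigma> (- t)))"
    using attracting_fixpoint_eq [OF h ia] repelling_fixpoint_eq [OF h ia]
    by (simp_all add: \<tau>_def [abs_def])
qed

end

text \<open>Squared distances add up over the factors, hence so do both sides of the inequality; the
  dividing point is chosen in each factor separately.\<close>

lemma hadamard_metric_product:
  fixes X :: "'n::finite \<Rightarrow> 'a metric"
  assumes ne: "\<And>i. mspace (X i) \<noteq> {}" and h: "\<And>i. hadamard_space (X i)"
  shows "hadamard_metric (product_metric X)"
proof (rule hadamard_metric.intro)
  let ?P = "product_metric X"
  show P: "mspace ?P \<noteq> {}"
    using ne by (simp add: PiE_eq_empty_iff)
  note r = retr_in [OF P]
  have ri: "retr ?P x i \<in> mspace (X i)" for x i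
    using r [of x] by auto
  have sq: "(pd ?P x y)\<^sup>2 = (\<Sum>i\<in>UNIV. (mdist (X i) (retr ?P x i) (retr ?P y i))\<^sup>2)" for x y
    by (simp add: pd_def sum_nonneg)
  show "hadamard_pseudometric (pd ?P)"
  proof
    show "pd ?P x x = 0" for x
      using r by (simp add: pd_def del: mdist_product_metric mspace_product_metric)
    show "pd ?P x y = pd ?P y x" for x y
      unfolding pd_def by (rule mdist_commute)
    show "pd ?P x z \<le> pd ?P x y + pd ?P y z" for x y z
      unfolding pd_def by (rule mdist_triangle [OF r r r])
    show "\<exists>l. (\<lambda>n::nat. pd ?P (s n) l) \<longlonglongrightarrow> 0"
      if s: "\<And>e. e > 0 \<Longrightarrow> \<exists>N. \<forall>m\<ge>N. \<forall>n\<ge>N. pd ?P (s m) (s n) < e" for s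
    proof -
      have "\<exists>l\<in>mspace (X i). (\<lambda>n. pd (X i) (retr ?P (s n) i) l) \<longlonglongrightarrow> 0" for i
      proof (rule complete_pd [OF ne])
        show "mcomplete_of (X i)"
          using h by (simp add: hadamard_space_def)
        fix e :: real assume "e > 0"
        then obtain N where N: "\<forall>m\<ge>N. \<forall>n\<ge>N. pd ?P (s m) (s n) < e"
          using s by blast
        have "pd (X i) (retr ?P (s m) i) (retr ?P (s n) i) \<le> pd ?P (s m) (s n)" for m n
          using mdist_component_le [of X i "retr ?P (s m)" "retr ?P (s n)"] ri by (simp add: pd_def)
        then show "\<exists>N. \<forall>m\<ge>N. \<forall>n\<ge>N. pd (X i) (retr ?P (s m) i) (retr ?P (s n) i) < e"
          using N by (meson le_less_trans)
      qed
      then obtain l where l: "\<And>i. l i \<in> mspace (X i)" "\<And>i. (\<lambda>n. pd (X i) (retr ?P (s n) i) (l i)) \<longlonglongrightarrow> 0"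
        by metis
      have "l \<in> mspace ?P"
        using l(1) by auto
      then have eq: "pd ?P (s n) l = sqrt (\<Sum>i\<in>UNIV. (pd (X i) (retr ?P (s n) i) (l i))\<^sup>2)" for n
        using l(1) ri by (simp add: pd_def)
      have "(\<lambda>n. sqrt (\<Sum>i\<in>UNIV. (pd (X i) (retr ?P (s n) i) (l i))\<^sup>2)) \<longlonglongrightarrow> sqrt (\<Sum>i\<in>(UNIV::'n set). 0\<^sup>2)"
        by (intro tendsto_intros l(2))
      then show ?thesis
        unfolding eq [symmetric] by auto
    qed
    show "\<exists>p. \<forall>z. (pd ?P z p)\<^sup>2 \<le> (1 - t) * (pd ?P z x)\<^sup>2 + t * (pd ?P z y)\<^sup>2 - t * (1 - t) * (pd ?P x y)\<^sup>2"
      if t: "0 \<le> t" "t \<le> 1" for t x y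
    proof -
      have "\<exists>p\<in>mspace (X i). \<forall>z\<in>mspace (X i). (mdist (X i) z p)\<^sup>2 \<le> (1 - t) * (mdist (X i) z (retr ?P x i))\<^sup>2 +
          t * (mdist (X i) z (retr ?P y i))\<^sup>2 - t * (1 - t) * (mdist (X i) (retr ?P x i) (retr ?P y i))\<^sup>2" for i
        using h [of i] by (intro CAT0_cn ri t) (simp add: hadamard_space_def)
      then obtain p where p: "\<And>i. p i \<in> mspace (X i)"
        "\<And>i z. z \<in> mspace (X i) \<Longrightarrow> (mdist (X i) z (p i))\<^sup>2 \<le> (1 - t) * (mdist (X i) z (retr ?P x i))\<^sup>2 +
          t * (mdist (X i) z (retr ?P y i))\<^sup>2 - t * (1 - t) * (mdist (X i) (retr ?P x i) (retr ?P y i))\<^sup>2"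
        by metis
      have "p \<in> mspace ?P"
        using p(1) by auto
      then have [simp]: "retr ?P p = p"
        by simp
      have "(pd ?P z p)\<^sup>2 \<le> (1 - t) * (pd ?P z x)\<^sup>2 + t * (pd ?P z y)\<^sup>2 - t * (1 - t) * (pd ?P x y)\<^sup>2" for z
      proof -
        have "(pd ?P z p)\<^sup>2 = (\<Sum>i\<in>UNIV. (mdist (X i) (retr ?P z i) (p i))\<^sup>2)"
          by (simp add: sq)
        also have "\<dots> \<le> (\<Sum>i\<in>UNIV. (1 - t) * (mdist (X i) (retr ?P z i) (retr ?P x i))\<^sup>2 +
          t * (mdist (X i) (retr ?P z i) (retr ?P y i))\<^sup>2 - t * (1 - t) * (mdist (X i) (retr ?P x i) (retr ?P y i))\<^sup>2)"
          by (intro sum_mono p(2) ri)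
        also have "\<dots> = (1 - t) * (pd ?P z x)\<^sup>2 + t * (pd ?P z y)\<^sup>2 - t * (1 - t) * (pd ?P x y)\<^sup>2"
          unfolding sq by (simp only: sum.distrib sum_subtractf sum_distrib_left)
        finally show ?thesis .
      qed
      then show ?thesis
        by blast
    qed
  qed
qed

lemma finite_if_all_eq: "(\<And>x y. x \<in> A \<Longrightarrow> y \<in> A \<Longrightarrow> x = y) \<Longrightarrow> finite A"
  by (metis finite.simps insertI1 finite_subset subsetI)

section \<open>Groups acting on a product\<close>

locale hadamard_product =
  fixes X :: "'n::finite \<Rightarrow> 'a metric" and \<Gamma> :: "('n \<Rightarrow> 'a \<Rightarrow> 'a) set" and x :: "'n \<Rightarrow> 'a"
  assumes hadamard: "\<And>i. hadamard_space (X i)"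
    and locally_compact: "\<And>i. locally_compact_space (mtopology_of (X i))"
    and subgroup: "subgroup \<Gamma> (product_group UNIV (\<lambda>i. isometry_group (X i)))"
    and x: "x \<in> mspace (product_metric X)"
begin

abbreviation "PG \<equiv> product_group UNIV (\<lambda>i. isometry_group (X i))"

lemma xi: "x i \<in> mspace (X i)"
  using x by auto

lemma phm: "proper_hadamard_metric (X i)"
  by unfold_locales (use xi hadamard locally_compact in auto)

end

sublocale hadamard_product \<subseteq> X: proper_hadamard_metric "X i" for i
  by (rule phm)

sublocale hadamard_product \<subseteq> P: hadamard_metric "product_metric X"
  by (rule hadamard_metric_product) (use xi hadamard in auto)

sublocale hadamard_product \<subseteq> PG: group PG
  by (simp add: group_isometry_group)

context hadamard_product
begin

lemma \<Gamma>_isometry: "\<gamma> \<in> \<Gamma> \<Longrightarrow> \<gamma> i \<in> isometries (X i)"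
  using subgroup.subset [OF subgroup] by (auto simp: PiE_iff)

lemma \<Gamma>_carrier: "\<gamma> \<in> \<Gamma> \<Longrightarrow> \<gamma> \<in> carrier PG"
  using subgroup.subset [OF subgroup] by blast

lemma \<Gamma>_mult:
  assumes "\<gamma> \<in> \<Gamma>" "\<delta> \<in> \<Gamma>"
  shows "\<gamma> \<otimes>\<^bsub>PG\<^esub> \<delta> \<in> \<Gamma>" "(\<gamma> \<otimes>\<^bsub>PG\<^esub> \<delta>) i = \<gamma> i \<otimes>\<^bsub>isometry_group (X i)\<^esub> \<delta> i"
  using subgroup.m_closed [OF subgroup assms] by simp_all

lemma \<Gamma>_inv:
  assumes "\<gamma> \<in> \<Gamma>"
  shows "inv\<^bsub>PG\<^esub> \<gamma> \<in> \<Gamma>" "(inv\<^bsub>PG\<^esub> \<gamma>) i = inv\<^bsub>isometry_group (X i)\<^esub> (\<gamma> i)"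
proof -
  show "inv\<^bsub>PG\<^esub> \<gamma> \<in> \<Gamma>"
    by (rule subgroup.m_inv_closed [OF subgroup assms])
  have "\<gamma> \<in> (\<Pi>\<^sub>E i\<in>UNIV. carrier (isometry_group (X i)))"
    using \<Gamma>_carrier [OF assms] by simp
  then show "(inv\<^bsub>PG\<^esub> \<gamma>) i = inv\<^bsub>isometry_group (X i)\<^esub> (\<gamma> i)"
    using inv_product_group [of \<gamma> UNIV "\<lambda>i. isometry_group (X i)"] group_isometry_group by simp
qed

lemma \<Gamma>_pow:
  assumes "\<gamma> \<in> \<Gamma>"
  shows "\<gamma> [^]\<^bsub>PG\<^esub> (n::nat) \<in> \<Gamma> \<and> (\<forall>i. (\<gamma> [^]\<^bsub>PG\<^esub> n) i = \<gamma> i [^]\<^bsub>isometry_group (X i)\<^esub> n)"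
proof (induction n)
  case 0
  then show ?case
    using subgroup.one_closed [OF subgroup] by (simp add: restrict_UNIV)
next
  case (Suc n)
  have eq: "\<gamma> [^]\<^bsub>PG\<^esub> Suc n = \<gamma> [^]\<^bsub>PG\<^esub> n \<otimes>\<^bsub>PG\<^esub> \<gamma>"
    by (rule nat_pow_Suc)
  note m = \<Gamma>_mult [OF conjunct1 [OF Suc.IH] assms]
  have "(\<gamma> [^]\<^bsub>PG\<^esub> n \<otimes>\<^bsub>PG\<^esub> \<gamma>) i = \<gamma> i [^]\<^bsub>isometry_group (X i)\<^esub> Suc n" for i
    unfolding m(2) using Suc.IH by simp
  then show ?case
    unfolding eq using m(1) by blast
qed

lemma regular_axialD:
  assumes "regular_axial X h"
  shows "\<exists>\<sigma> l. \<forall>i. geodesic_on UNIV (X i) (\<sigma> i) \<and> (\<forall>t. h i (\<sigma> i t) = \<sigma> i (t + l i)) \<and>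
    X.axis i (h i) (\<sigma> i) (l i) \<and> \<not> X.half_plane i (\<sigma> i) \<and>
    attracting_fixpoint (X i) (h i) = endpoint (X i) (\<sigma> i) \<and>
    repelling_fixpoint (X i) (h i) = endpoint (X i) (\<lambda>t. \<sigma> i (- t))"
proof -
  have "\<exists>\<sigma> l. geodesic_on UNIV (X i) \<sigma> \<and> (\<forall>t. h i (\<sigma> t) = \<sigma> (t + l)) \<and> X.axis i (h i) \<sigma> l \<and>
      \<not> X.half_plane i \<sigma> \<and> attracting_fixpoint (X i) (h i) = endpoint (X i) \<sigma> \<and>
      repelling_fixpoint (X i) (h i) = endpoint (X i) (\<lambda>t. \<sigma> (- t))" for i
  proof -
    have "rank_one (X i) (h i)"
      using assms by (simp add: regular_axial_def)
    then show ?thesis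
      by (rule X.rank_oneE) blast
  qed
  then show ?thesis
    by metis
qed

text \<open>Among the conjugates of \<open>h\<close> by the powers of \<open>g\<close>, only finitely many have an end in common
  with the given points, because no power of \<open>g\<close> fixes an end of \<open>h\<close>.\<close>

lemma finite_conjugates_towards:
  assumes g: "g i \<in> isometries (X i)" and ax: "X.axis i (g i) \<sigma> l" and nh: "\<not> X.half_plane i \<sigma>"
    and e: "X.ray i e" "\<not> X.asym i e \<sigma>" "\<not> X.asym i e (\<lambda>t. \<sigma> (- t))"
  shows "finite {k::nat. X.asym i z (\<lambda>t. mact (X i) (g i [^]\<^bsub>isometry_group (X i)\<^esub> k) (e t))}"
proof (rule finite_if_all_eq)
  let ?G = "isometry_group (X i)"
  have less: False if k: "X.asym i z (\<lambda>t. mact (X i) (g i [^]\<^bsub>?G\<^esub> k) (e t))"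
    "X.asym i z (\<lambda>t. mact (X i) (g i [^]\<^bsub>?G\<^esub> k') (e t))" "k < k'" for k k' :: nat
  proof -
    define m where "m = k' - k"
    have m: "0 < m" "k' = k + m"
      using k(3) by (auto simp: m_def)
    have gc: "g i \<in> carrier ?G"
      using g by simp
    have gk: "g i [^]\<^bsub>?G\<^esub> n \<in> carrier ?G" for n :: nat
      by (rule X.nat_pow_closed [OF gc])
    have "g i [^]\<^bsub>?G\<^esub> k' = g i [^]\<^bsub>?G\<^esub> k \<otimes>\<^bsub>?G\<^esub> g i [^]\<^bsub>?G\<^esub> m"
      unfolding m(2) by (rule X.nat_pow_mult [OF gc, symmetric])
    then have eq: "mact (X i) (g i [^]\<^bsub>?G\<^esub> k') (e t) = mact (X i) (g i [^]\<^bsub>?G\<^esub> k) (mact (X i) (g i [^]\<^bsub>?G\<^esub> m) (e t))" for t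
      using X.mult [OF gk gk] by simp
    have "X.asym i (\<lambda>t. mact (X i) (g i [^]\<^bsub>?G\<^esub> k) (mact (X i) (g i [^]\<^bsub>?G\<^esub> m) (e t)))
        (\<lambda>t. mact (X i) (g i [^]\<^bsub>?G\<^esub> k) (e t))"
      using X.asym_trans [OF X.asym_sym [OF k(2)] k(1)] by (simp only: eq)
    then have "X.asym i (\<lambda>t. mact (X i) (g i [^]\<^bsub>?G\<^esub> m) (e t)) e"
      unfolding hadamard_pseudometric.asym_def [OF X.pseudo] X.iso [OF gk] .
    then have "X.asym i e \<sigma> \<or> X.asym i e (\<lambda>t. \<sigma> (- t))"
      by (rule X.axis_fixed_end [OF gk X.axis_pow [OF gc ax m(1)] nh e(1)])
    with e show False
      by blast
  qed
  fix k k' :: nat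
  assume "k \<in> {k. X.asym i z (\<lambda>t. mact (X i) (g i [^]\<^bsub>?G\<^esub> k) (e t))}"
    "k' \<in> {k. X.asym i z (\<lambda>t. mact (X i) (g i [^]\<^bsub>?G\<^esub> k) (e t))}"
  then show "k = k'"
    using less [of k k'] less [of k' k] unfolding mem_Collect_eq by (metis nat_neq_iff)
qed

text \<open>In each factor, each end of \<open>h\<close> excludes finitely many exponents; there are
  finitely many factors, so one exponent \<open>k\<close> is admissible in all of them. Independence
  ensures that no end of \<open>h\<close> is an end of the axis of \<open>g\<close>.\<close>

lemma exists_avoiding:
  assumes g: "g \<in> \<Gamma>" and h: "h \<in> \<Gamma>" and ind: "independent_regular_axial X g h"
  shows "\<exists>a\<in>\<Gamma>. \<exists>\<sigma> l. \<forall>i. X.axis i (a i) (\<sigma> i) (l i) \<and> \<not> X.half_plane i (\<sigma> i) \<and>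
    \<not> X.asym i (z i) (\<sigma> i) \<and> \<not> X.asym i (z i) (\<lambda>t. \<sigma> i (- t))"
proof -
  let ?G = "\<lambda>i. isometry_group (X i)"
  obtain \<sigma> l where g': "\<forall>i. geodesic_on UNIV (X i) (\<sigma> i) \<and> (\<forall>t. g i (\<sigma> i t) = \<sigma> i (t + l i)) \<and>
    X.axis i (g i) (\<sigma> i) (l i) \<and> \<not> X.half_plane i (\<sigma> i) \<and>
    attracting_fixpoint (X i) (g i) = endpoint (X i) (\<sigma> i) \<and>
    repelling_fixpoint (X i) (g i) = endpoint (X i) (\<lambda>t. \<sigma> i (- t))"
    using regular_axialD [of g] ind unfolding independent_regular_axial_def by blast
  obtain \<tau> m where h': "\<forall>i. geodesic_on UNIV (X i) (\<tau> i) \<and> (\<forall>t. h i (\<tau> i t) = \<tau> i (t + m i)) \<and>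
    X.axis i (h i) (\<tau> i) (m i) \<and> \<not> X.half_plane i (\<tau> i) \<and>
    attracting_fixpoint (X i) (h i) = endpoint (X i) (\<tau> i) \<and>
    repelling_fixpoint (X i) (h i) = endpoint (X i) (\<lambda>t. \<tau> i (- t))"
    using regular_axialD [of h] ind unfolding independent_regular_axial_def by blast
  have \<sigma>: "X.axis i (g i) (\<sigma> i) (l i)" "\<not> X.half_plane i (\<sigma> i)"
    and \<tau>: "X.axis i (h i) (\<tau> i) (m i)" "\<not> X.half_plane i (\<tau> i)" for i
    using g' h' by blast+
  have rays: "\<sigma> i \<in> rays (X i)" "(\<lambda>t. \<sigma> i (- t)) \<in> rays (X i)" "\<tau> i \<in> rays (X i)" "(\<lambda>t. \<tau> i (- t)) \<in> rays (X i)" for i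
    using g' h' geodesic_line_ray geodesic_line_reverse by blast+
  have fp: "attracting_fixpoint (X i) (g i) = endpoint (X i) (\<sigma> i)"
    "repelling_fixpoint (X i) (g i) = endpoint (X i) (\<lambda>t. \<sigma> i (- t))"
    "attracting_fixpoint (X i) (h i) = endpoint (X i) (\<tau> i)"
    "repelling_fixpoint (X i) (h i) = endpoint (X i) (\<lambda>t. \<tau> i (- t))" for i
    using g' h' by blast+
  have "independent_isometries (X i) (g i) (h i)" for i
    using ind by (simp add: independent_regular_axial_def)
  then have ends: "\<not> X.asym i (\<tau> i) (\<sigma> i)" "\<not> X.asym i (\<tau> i) (\<lambda>t. \<sigma> i (- t))"
    "\<not> X.asym i (\<lambda>t. \<tau> i (- t)) (\<sigma> i)" "\<not> X.asym i (\<lambda>t. \<tau> i (- t)) (\<lambda>t. \<sigma> i (- t))" for i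
    using X.endpoint_eq_iff [of _ i] rays [of i] unfolding independent_isometries_def fp by auto
  define B where "B = (\<Union>i. {k::nat. X.asym i (z i) (\<lambda>t. mact (X i) (g i [^]\<^bsub>?G i\<^esub> k) (\<tau> i t))} \<union>
    {k::nat. X.asym i (z i) (\<lambda>t. mact (X i) (g i [^]\<^bsub>?G i\<^esub> k) (\<tau> i (- t)))})"
  have "finite B"
    unfolding B_def
  proof (intro finite_UN_I finite_UnI)
    fix i
    show "finite {k::nat. X.asym i (z i) (\<lambda>t. mact (X i) (g i [^]\<^bsub>?G i\<^esub> k) (\<tau> i t))}"
      by (rule finite_conjugates_towards [OF \<Gamma>_isometry [OF g] \<sigma> X.rays_ray [OF rays(3)] ends(1,2)])
    show "finite {k::nat. X.asym i (z i) (\<lambda>t. mact (X i) (g i [^]\<^bsub>?G i\<^esub> k) (\<tau> i (- t)))}"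
      by (rule finite_conjugates_towards [OF \<Gamma>_isometry [OF g] \<sigma> X.rays_ray [OF rays(4)] ends(3,4)])
  qed simp
  then obtain k where k: "k \<notin> B"
    using ex_new_if_finite infinite_UNIV_nat by blast
  define b where "b = g [^]\<^bsub>PG\<^esub> k"
  have b: "b \<in> \<Gamma>" "b i = g i [^]\<^bsub>?G i\<^esub> k" for i
    using \<Gamma>_pow [OF g] by (auto simp: b_def)
  define a where "a = b \<otimes>\<^bsub>PG\<^esub> h \<otimes>\<^bsub>PG\<^esub> inv\<^bsub>PG\<^esub> b"
  have a: "a \<in> \<Gamma>" "a i = b i \<otimes>\<^bsub>?G i\<^esub> h i \<otimes>\<^bsub>?G i\<^esub> inv\<^bsub>?G i\<^esub> (b i)" for i
    using \<Gamma>_mult \<Gamma>_inv b(1) h unfolding a_def by (simp_all del: mult_product_group)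
  have bc: "b i \<in> carrier (?G i)" and hc: "h i \<in> carrier (?G i)" for i
    using \<Gamma>_isometry b(1) h by simp_all
  have "X.axis i (a i) (\<lambda>t. mact (X i) (b i) (\<tau> i t)) (m i)" for i
    unfolding a(2) by (rule X.axis_conj [OF hc bc \<tau>(1)])
  moreover have "\<not> X.half_plane i (\<lambda>t. mact (X i) (b i) (\<tau> i t))" for i
    using X.half_plane_act [OF bc] \<tau>(2) by blast
  moreover have "\<not> X.asym i (z i) (\<lambda>t. mact (X i) (b i) (\<tau> i t))"
    "\<not> X.asym i (z i) (\<lambda>t. mact (X i) (b i) (\<tau> i (- t)))" for i
    using k unfolding B_def b(2) by auto
  ultimately show ?thesis
    using a(1) by (intro bexI [of _ a] exI [of _ "\<lambda>i t. mact (X i) (b i) (\<tau> i t)"] exI [of _ m]) auto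
qed

text \<open>The orbit meets the cone neighbourhoods of a regular ray at all times
  \<open>n + 1\<close>. Geodesics of the product project to geodesics of the factors, traversed at
  the speed \<open>\<theta> i\<close>; since this is positive, the orbit converges in every
  factor.\<close>

lemma limit_sequence:
  assumes "\<xi> \<in> furstenberg_limit_set X \<Gamma> x"
  shows "\<exists>\<gamma> c. (\<forall>n::nat. \<gamma> n \<in> \<Gamma>) \<and> (\<forall>i. c i \<in> rays (X i) \<and> \<xi> i = endpoint (X i) (c i) \<and>
    filterlim (\<lambda>n. \<gamma> n i (x i)) (X.nb i (c i)) sequentially)"
proof -
  let ?P = "product_metric X"
  obtain \<zeta> where \<zeta>: "\<zeta> \<in> limit_set X \<Gamma> x" "\<zeta> \<in> regular_boundary X" "\<xi> = furstenberg_proj X \<zeta>"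
    using assms unfolding furstenberg_limit_set_def by blast
  then obtain \<theta> \<sigma> where rep: "represents X \<zeta> \<theta> \<sigma>" and pos: "\<And>i. 0 < \<theta> i"
    unfolding regular_boundary_def by blast
  have \<xi>: "\<xi> = (\<lambda>i. endpoint (X i) (\<sigma> i))"
    using furstenberg_proj_eq [OF rep pos] \<zeta>(3) by simp
  have \<sigma>: "\<sigma> i \<in> rays (X i)" for i
    using rep by (simp add: represents_def)
  define c where "c t i = \<sigma> i (\<theta> i * t)" for t i
  have \<zeta>b: "\<zeta> \<in> gboundary ?P" "c \<in> \<zeta>"
    using rep unfolding represents_def c_def by auto
  have c: "c \<in> rays ?P"
    by (rule P.gboundary_endpoint [OF \<zeta>b])
  have "\<exists>\<gamma>\<in>\<Gamma>. Inl (act \<gamma> x) \<in> cone_nbhd ?P c (real n + 1) 1" for n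
  proof -
    have cn: "c (real n + 1) \<in> mspace ?P"
      by (rule P.rays_in [OF c]) simp
    have "openin (cone_topology ?P) (cone_nbhd ?P c (real n + 1) 1)"
      unfolding cone_topology_def
      by (intro topology_generated_by_Basis UnI2 CollectI exI [of _ c] exI [of _ "real n + 1"] exI [of _ 1] conjI)
        (use c in auto)
    moreover have "Inr \<zeta> \<in> cone_nbhd ?P c (real n + 1) 1"
    proof -
      have "mdist ?P (c (real n + 1)) (c (real n + 1)) = 0"
        using mdist_zero [OF cn cn] by blast
      then have "mdist ?P (c (real n + 1)) (c (real n + 1)) < 1"
        by (simp only: zero_less_one)
      then show ?thesis
        unfolding cone_nbhd_def by (intro UnI2 imageI CollectI conjI \<zeta>b(1) bexI [OF _ \<zeta>b(2)] refl)
    qed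
    ultimately show ?thesis
      using \<zeta>(1) unfolding limit_set_def in_closure_of by blast
  qed
  then obtain \<gamma> where \<gamma>: "\<And>n. \<gamma> n \<in> \<Gamma>" "\<And>n. Inl (act (\<gamma> n) x) \<in> cone_nbhd ?P c (real n + 1) 1"
    by metis
  have "filterlim (\<lambda>n. \<gamma> n i (x i)) (X.nb i (\<sigma> i)) sequentially" for i
    unfolding filterlim_iff
  proof (intro allI impI)
    fix Q assume "eventually Q (X.nb i (\<sigma> i))"
    then obtain T where T: "T > 0" "\<forall>y\<in>X.N i (\<sigma> i) T. Q y"
      using X.eventually_nb [OF X.rays_ray [OF \<sigma>]] by blast
    \<comment> \<open>The bound of \<open>N_intro\<close> with \<open>C = 1\<close>, rescaled by the
      slope.\<close>
    have "eventually (\<lambda>n. (T + 1 + 2 * T + 1) / \<theta> i \<le> real n) sequentially"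
      using filterlim_real_sequentially unfolding filterlim_at_top by blast
    then show "eventually (\<lambda>n. Q (\<gamma> n i (x i))) sequentially"
    proof eventually_elim
      case (elim n)
      define R where "R = real n + 1"
      have R: "0 < R" "T + 1 + 2 * 1 * T < \<theta> i * R"
        using elim pos [of i] by (auto simp: R_def field_simps)
      define y where "y = act (\<gamma> n) x"
      have yi: "y j \<in> mspace (X j)" "y j = \<gamma> n j (x j)" for j
        using isometry_in [OF \<Gamma>_isometry [OF \<gamma>(1)] xi] by (simp_all add: y_def act_def)
      have yP: "y \<in> mspace ?P"
        using yi by auto
      have c0: "c 0 \<in> mspace ?P" "c 0 j \<in> mspace (X j)" for j
        using P.rays_in [OF c, of 0] by auto
      obtain g where g: "R < mdist ?P (c 0) y" "geodesic_between ?P (c 0) y g" "mdist ?P (g R) (c R) < 1"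
        using \<gamma>(2) [of n] unfolding cone_nbhd_def R_def y_def by blast
      define L where "L = mdist ?P (c 0) y"
      define t where "t = R / L"
      have t: "0 \<le> t" "t \<le> 1" "t * L = R" "0 < L"
        using g(1) R(1) by (auto simp: t_def L_def simp del: mdist_product_metric)
      \<comment> \<open>\<open>q\<close> divides the geodesics of all factors in the same ratio
        \<open>t\<close>; by uniqueness of geodesics in the product it is the point
        \<open>g R\<close>.\<close>
      define w where "w j = X.gp j (c 0 j) (y j) t" for j
      define q where "q j = retr (X j) (w j)" for j
      have qj: "q j \<in> mspace (X j)" "pd (X j) (w j) (q j) = 0" for j
        using retr_in [OF X.ne] pd_retr [OF X.ne] by (auto simp: q_def)
      have q1: "mdist (X j) (c 0 j) (q j) = t * mdist (X j) (c 0 j) (y j)"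
        "mdist (X j) (q j) (y j) = (1 - t) * mdist (X j) (c 0 j) (y j)" for j
        using X.gp_left [OF t(1,2), of j "c 0 j" "y j"] X.gp_right [OF t(1,2), of j "c 0 j" "y j"] qj c0 yi
        by (simp_all add: pd_def w_def q_def)
      have sc: "sqrt (\<Sum>j\<in>UNIV. (s * f j)\<^sup>2) = s * sqrt (\<Sum>j\<in>UNIV. (f j)\<^sup>2)" if "0 \<le> s"
        for s and f :: "'n \<Rightarrow> real"
        using that by (simp add: power_mult_distrib real_sqrt_mult flip: sum_distrib_left)
      have qP: "q \<in> mspace ?P"
        using qj by auto
      have "mdist ?P (c 0) q = t * L" "mdist ?P q y = (1 - t) * L"
        using t sc [of t "\<lambda>j. mdist (X j) (c 0 j) (y j)"] sc [of "1 - t" "\<lambda>j. mdist (X j) (c 0 j) (y j)"]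
        by (simp_all add: q1 L_def)
      then have "pd ?P (c 0) q = R" "pd ?P q y = pd ?P (c 0) y - R"
        using t c0 qP yP by (simp_all add: pd_mdist left_diff_distrib L_def del: mdist_product_metric)
      then have 1: "pd ?P q (P.pt (c 0) y R) = 0"
        using R(1) g(1) c0 yP by (intro P.pt_unique) (auto simp: pd_mdist simp del: mdist_product_metric)
      have 2: "g R \<in> mspace ?P" "pd ?P (g R) (P.pt (c 0) y R) = 0"
        using P.geodesic_pt [OF c0(1) yP g(2), of R] R(1) g(1) by auto
      have "pd ?P (g R) q = 0"
        using P.d0_left [OF 2(2), of q] P.sym [of q "P.pt (c 0) y R"] 1 by simp
      then have "g R = q"
        using P.pd_eq_0 2(1) qP by blast
      then have "mdist ?P q (c R) < 1"
        using g(3) by (simp only:)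
      then have "mdist (X i) (q i) (\<sigma> i (\<theta> i * R)) < 1"
        using mdist_component_le [of X i q "c R"] unfolding c_def by linarith
      moreover have \<sigma>R: "\<sigma> i (\<theta> i * R) \<in> mspace (X i)"
        using X.rays_in [OF \<sigma>, of "\<theta> i * R"] pos [of i] R(1) by simp
      ultimately have "pd (X i) (w i) (\<sigma> i (\<theta> i * R)) \<le> 1"
        using X.d0_left [OF qj(2)] qj(1) by (simp add: pd_mdist)
      moreover have "X.btw i (\<sigma> i 0) (w i) (y i)"
        using X.btw_gp [OF t(1,2), of i "c 0 i" "y i"] by (simp add: w_def c_def)
      ultimately have "y i \<in> X.N i (\<sigma> i) T"
        by (intro X.N_intro [OF X.rays_ray [OF \<sigma>] _ _ T(1) R(2)])
      then show ?case
        using T(2) yi(2) by simp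
    qed
  qed
  then show ?thesis
    using \<gamma>(1) \<sigma> \<xi> by (intro exI [of _ \<gamma>] exI [of _ \<sigma>]) simp
qed

lemma common_subsequence:
  fixes Y :: "nat \<Rightarrow> 'n \<Rightarrow> 'a"
  assumes far: "\<And>i. filterlim (\<lambda>n. pd (X i) (x i) (Y n i)) at_top sequentially"
  shows "\<exists>r z. strict_mono r \<and> (\<forall>i. X.ray i (z i) \<and> filterlim (\<lambda>n. Y (r n) i) (X.nb i (z i)) sequentially)"
proof -
  have "\<exists>r. strict_mono r \<and> (\<forall>i\<in>A. \<exists>z. X.ray i z \<and> filterlim (\<lambda>n. Y (r n) i) (X.nb i z) sequentially)"
    if "finite A" for A
    using that
  proof induction
    case empty
    show ?case
      by (intro exI [of _ "\<lambda>n. n"]) (simp add: strict_mono_def)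
  next
    case (insert j A)
    then obtain r where r: "strict_mono r"
      "\<forall>i\<in>A. \<exists>z. X.ray i z \<and> filterlim (\<lambda>n. Y (r n) i) (X.nb i z) sequentially"
      by blast
    have "filterlim (\<lambda>n. pd (X j) (x j) (Y (r n) j)) at_top sequentially"
      by (rule filterlim_compose [OF far filterlim_subseq [OF r(1)]])
    then obtain q z where q: "strict_mono q" "X.ray j z" "filterlim (\<lambda>n. Y (r (q n)) j) (X.nb j z) sequentially"
      by (rule X.compactify)
    have "\<exists>z. X.ray i z \<and> filterlim (\<lambda>n. Y (r (q n)) i) (X.nb i z) sequentially" if i: "i \<in> A" for i
    proof -
      obtain z where z: "X.ray i z" "filterlim (\<lambda>n. Y (r n) i) (X.nb i z) sequentially"
        using r(2) i by blast
      show ?thesis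
        using z(1) filterlim_compose [OF z(2) filterlim_subseq [OF q(1)]] by blast
    qed
    moreover have "strict_mono (\<lambda>n. r (q n))"
      using strict_mono_o [OF r(1) q(1)] by (simp add: o_def)
    ultimately show ?case
      using q(2,3) by (intro exI [of _ "\<lambda>n. r (q n)"]) blast
  qed
  from this [of UNIV] obtain r where r: "strict_mono r"
    "\<And>i. \<exists>z. X.ray i z \<and> filterlim (\<lambda>n. Y (r n) i) (X.nb i z) sequentially"
    by auto
  obtain z where "\<And>i. X.ray i (z i) \<and> filterlim (\<lambda>n. Y (r n) i) (X.nb i (z i)) sequentially"
    using r(2) by metis
  with r(1) show ?thesis
    by (intro exI [of _ r] exI [of _ z]) simp
qed

lemma approximating_axes:
  assumes g: "g \<in> \<Gamma>" and h: "h \<in> \<Gamma>" and ind: "independent_regular_axial X g h"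
    and \<xi>: "\<xi> \<in> furstenberg_limit_set X \<Gamma> x"
    and c: "\<And>i. c i \<in> rays (X i)" "\<And>i. \<xi> i = endpoint (X i) (c i)" and T: "T > 0"
  shows "\<exists>a\<in>\<Gamma>. \<exists>\<tau> m. \<forall>i. X.axis i (a i) (\<tau> i) (m i) \<and> \<not> X.half_plane i (\<tau> i) \<and>
    eventually (\<lambda>y. y \<in> X.N i (c i) T) (X.nb i (\<tau> i)) \<and>
    eventually (\<lambda>y. y \<in> X.N i (c i) T) (X.nb i (\<lambda>t. \<tau> i (- t)))"
proof -
  let ?G = "\<lambda>i. isometry_group (X i)"
  obtain \<delta> e where \<delta>: "\<And>n::nat. \<delta> n \<in> \<Gamma>" and e: "\<And>i. e i \<in> rays (X i)" "\<And>i. \<xi> i = endpoint (X i) (e i)"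
      "\<And>i. filterlim (\<lambda>n. \<delta> n i (x i)) (X.nb i (e i)) sequentially"
    using limit_sequence [OF \<xi>] by blast
  have cr: "X.ray i (c i)" and er: "X.ray i (e i)" for i
    using c(1) e(1) X.rays_ray by blast+
  have "X.asym i (e i) (c i)" for i
    using X.endpoint_eq_iff [OF e(1) c(1), of i] e(2) [of i] c(2) [of i] by simp
  then have nb: "X.nb i (e i) = X.nb i (c i)" for i
    by (rule X.nb_cong [OF er cr])
  have \<delta>c: "\<delta> n i \<in> carrier (?G i)" for n i
    using \<Gamma>_isometry [OF \<delta>] by simp
  have mx: "mact (X i) (\<delta> n i) (x i) = \<delta> n i (x i)" for n i
    using xi by (simp add: mact_def)
  have lim: "filterlim (\<lambda>n. mact (X i) (\<delta> n i) (x i)) (X.nb i (c i)) sequentially" for i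
    using e(3) [of i] unfolding nb mx .
  \<comment> \<open>An inverse moves \<open>x i\<close> as far as the element itself, so the inverse
    orbit leaves every ball in each factor and has boundary limits along a subsequence.\<close>
  have "filterlim (\<lambda>n. pd (X i) (x i) (mact (X i) (inv\<^bsub>?G i\<^esub> (\<delta> n i)) (x i))) at_top sequentially" for i
  proof -
    have A: "filterlim (\<lambda>n. - pd (X i) (x i) (c i 0) + pd (X i) (c i 0) (mact (X i) (\<delta> n i) (x i))) at_top sequentially"
      using lim [of i] unfolding X.filterlim_nb_iff [OF cr]
      by (intro filterlim_tendsto_add_at_top [OF tendsto_const]) blast
    have B: "- pd (X i) (x i) (c i 0) + pd (X i) (c i 0) (mact (X i) (\<delta> n i) (x i)) \<le>
        pd (X i) (x i) (mact (X i) (inv\<^bsub>?G i\<^esub> (\<delta> n i)) (x i))" for n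
      using X.tri [of i "c i 0" "mact (X i) (\<delta> n i) (x i)" "x i"] X.sym [of i "c i 0" "x i"]
        X.dist_move(1) [OF \<delta>c [of n i], of "x i" "x i"] X.sym [of i "x i" "mact (X i) (\<delta> n i) (x i)"] by linarith
    show ?thesis
      by (rule filterlim_at_top_mono [OF A]) (intro always_eventually allI B)
  qed
  then have "\<exists>r z. strict_mono r \<and> (\<forall>i. X.ray i (z i) \<and>
      filterlim (\<lambda>n. mact (X i) (inv\<^bsub>?G i\<^esub> (\<delta> (r n) i)) (x i)) (X.nb i (z i)) sequentially)"
    by (rule common_subsequence [of "\<lambda>n i. mact (X i) (inv\<^bsub>?G i\<^esub> (\<delta> n i)) (x i)"])
  then obtain r z where r: "strict_mono r" and z': "\<forall>i. X.ray i (z i) \<and>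
      filterlim (\<lambda>n. mact (X i) (inv\<^bsub>?G i\<^esub> (\<delta> (r n) i)) (x i)) (X.nb i (z i)) sequentially"
    by (elim exE conjE)
  have z: "X.ray i (z i)"
    "filterlim (\<lambda>n. mact (X i) (inv\<^bsub>?G i\<^esub> (\<delta> (r n) i)) (x i)) (X.nb i (z i)) sequentially" for i
    using z' by simp_all
  \<comment> \<open>Both ends of \<open>a\<close> avoid the limits \<open>z i\<close> and hence are
    visible from them, as \<open>conj_near\<close> requires.\<close>
  obtain a \<sigma> l where a: "a \<in> \<Gamma>" and \<sigma>': "\<forall>i. X.axis i (a i) (\<sigma> i) (l i) \<and> \<not> X.half_plane i (\<sigma> i) \<and>
    \<not> X.asym i (z i) (\<sigma> i) \<and> \<not> X.asym i (z i) (\<lambda>t. \<sigma> i (- t))"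
    using exists_avoiding [OF g h ind, of z] by (elim bexE exE)
  have \<sigma>: "X.axis i (a i) (\<sigma> i) (l i)" "\<not> X.half_plane i (\<sigma> i)"
    "\<not> X.asym i (z i) (\<sigma> i)" "\<not> X.asym i (z i) (\<lambda>t. \<sigma> i (- t))" for i
    using \<sigma>' by simp_all
  have ac: "a i \<in> carrier (?G i)" for i
    using \<Gamma>_isometry [OF a] by simp
  have \<sigma>r: "X.ray i (\<sigma> i)" "X.ray i (\<lambda>t. \<sigma> i (- t))" for i
    using \<sigma>(1) [of i] X.line_ray X.line_reverse unfolding X.axis_def by blast+
  have vis: "X.vis i (z i) (\<sigma> i)" for i
    by (rule X.vis_axis [OF ac \<sigma>(1,2) z(1) \<sigma>(3)])
  have nh: "\<not> X.half_plane i (\<lambda>t. \<sigma> i (- t))" for i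
    using X.half_plane_reverse \<sigma>(2) by blast
  have vis': "X.vis i (z i) (\<lambda>t. \<sigma> i (- t))" for i
    by (rule X.vis_axis [OF X.inv_closed [OF ac] X.axis_inv [OF ac \<sigma>(1)] nh z(1) \<sigma>(4)])
  have limr: "filterlim (\<lambda>n. mact (X i) (\<delta> (r n) i) (x i)) (X.nb i (c i)) sequentially" for i
    by (rule filterlim_compose [OF lim filterlim_subseq [OF r]])
  have "eventually (\<lambda>n. eventually (\<lambda>y. y \<in> X.N i (c i) T) (X.nb i (\<lambda>t. mact (X i) (\<delta> (r n) i) (\<sigma> i t)))) sequentially" for i
    by (rule X.conj_near [OF cr \<delta>c limr z(2) z(1) \<sigma>r(1) vis X.eventually_N [OF cr T]])
  moreover have "eventually (\<lambda>n. eventually (\<lambda>y. y \<in> X.N i (c i) T) (X.nb i (\<lambda>t. mact (X i) (\<delta> (r n) i) (\<sigma> i (- t))))) sequentially" for i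
    by (rule X.conj_near [OF cr \<delta>c limr z(2) z(1) \<sigma>r(2) vis' X.eventually_N [OF cr T]])
  ultimately have "eventually (\<lambda>n. \<forall>i. eventually (\<lambda>y. y \<in> X.N i (c i) T) (X.nb i (\<lambda>t. mact (X i) (\<delta> (r n) i) (\<sigma> i t))) \<and>
      eventually (\<lambda>y. y \<in> X.N i (c i) T) (X.nb i (\<lambda>t. mact (X i) (\<delta> (r n) i) (\<sigma> i (- t))))) sequentially"
    by (intro eventually_all_finite eventually_conj)
  then obtain n where n: "\<And>i. eventually (\<lambda>y. y \<in> X.N i (c i) T) (X.nb i (\<lambda>t. mact (X i) (\<delta> (r n) i) (\<sigma> i t)))"
      "\<And>i. eventually (\<lambda>y. y \<in> X.N i (c i) T) (X.nb i (\<lambda>t. mact (X i) (\<delta> (r n) i) (\<sigma> i (- t))))"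
    using eventually_happens' [OF sequentially_bot] by blast
  define k where "k = \<delta> (r n)"
  define b where "b = k \<otimes>\<^bsub>PG\<^esub> a \<otimes>\<^bsub>PG\<^esub> inv\<^bsub>PG\<^esub> k"
  have k: "k \<in> \<Gamma>"
    using \<delta> by (simp add: k_def)
  have b: "b \<in> \<Gamma>" "b i = k i \<otimes>\<^bsub>?G i\<^esub> a i \<otimes>\<^bsub>?G i\<^esub> inv\<^bsub>?G i\<^esub> (k i)" for i
    using \<Gamma>_mult \<Gamma>_inv k a unfolding b_def by (simp_all del: mult_product_group)
  have "X.axis i (b i) (\<lambda>t. mact (X i) (k i) (\<sigma> i t)) (l i)" for i
    unfolding b(2) k_def by (rule X.axis_conj [OF ac \<delta>c \<sigma>(1)])
  moreover have "\<not> X.half_plane i (\<lambda>t. mact (X i) (k i) (\<sigma> i t))" for i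
    using X.half_plane_act [OF \<delta>c] \<sigma>(2) unfolding k_def by blast
  ultimately show ?thesis
    using b(1) n unfolding k_def
    by (intro bexI [of _ b] exI [of _ "\<lambda>i t. mact (X i) (\<delta> (r n) i) (\<sigma> i t)"] exI [of _ l]) auto
qed

text \<open>The axes combine to a geodesic of the product whose slope is proportional to the
  translation lengths \<open>l i\<close>, hence regular. \<gamma> translates it by \<open>L\<close>,
  so the images of \<open>x\<close> under powers of \<gamma> follow it at bounded distance.\<close>

lemma attracting_in_limit_set:
  assumes \<gamma>: "\<gamma> \<in> \<Gamma>" and \<sigma>: "\<And>i. geodesic_on UNIV (X i) (\<sigma> i)" and l: "\<And>i. 0 < l i"
    and sh: "\<And>i t. \<gamma> i (\<sigma> i t) = \<sigma> i (t + l i)"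
  shows "(\<lambda>i. endpoint (X i) (\<sigma> i)) \<in> furstenberg_limit_set X \<Gamma> x"
proof -
  let ?P = "product_metric X"
  define L where "L = sqrt (\<Sum>i\<in>UNIV. (l i)\<^sup>2)"
  have "0 < (\<Sum>i\<in>UNIV. (l i)\<^sup>2)"
    using l by (intro sum_pos) (auto simp: less_imp_neq [THEN not_sym])
  then have L: "0 < L" "L\<^sup>2 = (\<Sum>i\<in>UNIV. (l i)\<^sup>2)"
    by (auto simp: L_def)
  define \<theta> where "\<theta> i = l i / L" for i
  have \<theta>: "0 < \<theta> i" "\<theta> i * L = l i" for i
    using l L by (auto simp: \<theta>_def)
  have \<theta>1: "(\<Sum>i\<in>UNIV. (\<theta> i)\<^sup>2) = 1"
  proof -
    have "(\<Sum>i\<in>UNIV. (\<theta> i)\<^sup>2) = (\<Sum>i\<in>UNIV. (l i)\<^sup>2) / L\<^sup>2"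
      by (simp add: \<theta>_def power_divide sum_divide_distrib)
    also have "\<dots> = 1"
      using L(1) unfolding L(2) [symmetric] by simp
    finally show ?thesis .
  qed
  define c where "c t i = \<sigma> i (\<theta> i * t)" for t i
  have \<sigma>M: "\<sigma> i t \<in> mspace (X i)" for i t
    using \<sigma> by (auto simp: geodesic_on_def)
  have "mdist ?P (c s) (c t) = \<bar>s - t\<bar>" for s t
  proof -
    have "mdist (X i) (c s i) (c t i) = \<theta> i * \<bar>s - t\<bar>" for i
    proof -
      have "mdist (X i) (c s i) (c t i) = \<bar>\<theta> i * s - \<theta> i * t\<bar>"
        using \<sigma> [of i] unfolding c_def by (simp add: geodesic_on_def)
      then show ?thesis
        using \<theta>(1) [of i] by (simp add: abs_mult flip: right_diff_distrib)
    qed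
    then have "mdist ?P (c s) (c t) = sqrt ((\<Sum>i\<in>UNIV. (\<theta> i)\<^sup>2) * \<bar>s - t\<bar>\<^sup>2)"
      unfolding sum_distrib_right by (simp add: power_mult_distrib)
    then show ?thesis
      using \<theta>1 by simp
  qed
  moreover have cM: "c t \<in> mspace ?P" for t
    using \<sigma>M by (auto simp: c_def)
  ultimately have c: "c \<in> rays ?P"
    unfolding rays_def geodesic_on_def by blast
  define \<zeta> where "\<zeta> = endpoint ?P c"
  have \<zeta>: "\<zeta> \<in> gboundary ?P" "c \<in> \<zeta>"
    using P.endpoint_in [OF c] c P.asym_refl by (auto simp: \<zeta>_def P.mem_endpoint)
  have rep: "represents X \<zeta> \<theta> \<sigma>"
    unfolding represents_def
  proof (intro conjI allI)
    show "\<sigma> i \<in> rays (X i)" "0 \<le> \<theta> i" for i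
      using geodesic_line_ray [OF \<sigma>] less_imp_le [OF \<theta>(1)] by blast+
    show "(\<lambda>t i. \<sigma> i (\<theta> i * t)) \<in> \<zeta>"
      using \<zeta>(2) unfolding c_def [abs_def] .
  qed (use \<zeta> \<theta>1 in auto)
  have reg: "\<zeta> \<in> regular_boundary X"
    unfolding regular_boundary_def using rep \<zeta>(1) \<theta>(1) by blast
  define p where "p n = \<gamma> [^]\<^bsub>PG\<^esub> n" for n :: nat
  have p: "p n \<in> \<Gamma>" for n
    using \<Gamma>_pow [OF \<gamma>] by (simp add: p_def)
  have pM: "act (p n) y \<in> mspace ?P" if "y \<in> mspace ?P" for n y
    using that isometry_in [OF \<Gamma>_isometry [OF p]] by (auto simp: act_def)
  have pc: "act (p n) (c 0) = c (real n * L)" for n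
  proof
    fix i
    have "p n i (\<sigma> i 0) = \<sigma> i (real n * l i)"
    proof (induction n)
      case 0
      then show ?case
        using \<sigma>M \<Gamma>_pow [OF \<gamma>, of 0] by (simp add: p_def isometry_group_def BijGroup_def)
    next
      case (Suc n)
      have "p (Suc n) i = p n i \<otimes>\<^bsub>isometry_group (X i)\<^esub> \<gamma> i"
        using \<Gamma>_pow [OF \<gamma>, of "Suc n"] \<Gamma>_pow [OF \<gamma>, of n] by (simp add: p_def)
      also have "\<dots> = \<gamma> i \<otimes>\<^bsub>isometry_group (X i)\<^esub> p n i"
        using X.nat_pow_comm [of "\<gamma> i" i n 1] \<Gamma>_isometry [OF \<gamma>, of i] \<Gamma>_pow [OF \<gamma>, of n] by (simp add: p_def)
      finally have "p (Suc n) i (\<sigma> i 0) = \<gamma> i (p n i (\<sigma> i 0))"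
        using \<Gamma>_isometry [OF \<gamma>, of i] \<Gamma>_isometry [OF p, of n i] \<sigma>M
        by (simp add: isometry_group_def BijGroup_def isometries_def compose_eq)
      then show ?case
        using Suc.IH sh by (simp add: algebra_simps)
    qed
    then show "act (p n) (c 0) i = c (real n * L) i"
      using \<theta>(2) [of i] by (simp add: act_def c_def mult.left_commute)
  qed
  have pd: "pd ?P (c (real n * L)) (act (p n) x) \<le> pd ?P (c 0) x" for n
  proof -
    have "mdist (X i) (p n i (c 0 i)) (p n i (x i)) = mdist (X i) (c 0 i) (x i)" for i
      using \<Gamma>_isometry [OF p, of n i] xi [of i] cM [of 0] by (auto simp: isometries_def)
    then have "mdist ?P (act (p n) (c 0)) (act (p n) x) = mdist ?P (c 0) x"
      by (simp add: act_def)
    then show ?thesis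
      using pM [OF x] cM x unfolding pc by (simp add: pd_mdist del: mdist_product_metric mspace_product_metric)
  qed
  have cr: "P.ray c"
    by (rule P.rays_ray [OF c])
  have "filterlim (\<lambda>n. real n * L) at_top sequentially"
    by (intro filterlim_at_top_mult_tendsto_pos [OF tendsto_const L(1)] filterlim_real_sequentially)
  then have "filterlim (\<lambda>n. c (real n * L)) (P.nb c) sequentially"
    by (rule filterlim_compose [OF P.filterlim_ray [OF cr]])
  then have lim: "filterlim (\<lambda>n. act (p n) x) (P.nb c) sequentially"
    by (rule P.filterlim_nb_perturb [OF cr _ pd])
  have "Inr \<zeta> \<in> cone_topology ?P closure_of (Inl ` {act \<gamma> x | \<gamma>. \<gamma> \<in> \<Gamma>})"
    unfolding in_closure_of
  proof (intro conjI allI impI)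
    show "Inr \<zeta> \<in> topspace (cone_topology ?P)"
      using \<zeta>(1) by (simp add: topspace_cone_topology)
    fix U assume U: "Inr \<zeta> \<in> U \<and> openin (cone_topology ?P) U"
    then obtain T where T: "T > 0" "\<forall>y\<in>mspace ?P. y \<in> P.N c T \<longrightarrow> Inl y \<in> U"
      using P.cone_open [of U c] c unfolding \<zeta>_def by blast
    have "eventually (\<lambda>n. act (p n) x \<in> P.N c T) sequentially"
      by (rule eventually_compose_filterlim [OF P.eventually_N [OF cr T(1)] lim])
    then obtain n where "act (p n) x \<in> P.N c T"
      using eventually_happens' [OF sequentially_bot] by blast
    then have "Inl (act (p n) x) \<in> U"
      using T(2) pM [OF x] by blast
    then show "\<exists>y. y \<in> Inl ` {act \<gamma> x | \<gamma>. \<gamma> \<in> \<Gamma>} \<and> y \<in> U"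
      using p by blast
  qed
  then have "\<zeta> \<in> limit_set X \<Gamma> x"
    using \<zeta>(1) by (simp add: limit_set_def)
  then show ?thesis
    unfolding furstenberg_limit_set_def using reg furstenberg_proj_eq [OF rep \<theta>(1)] by (metis IntI imageI)
qed

text \<open>The statement covers all \<open>S \<ge> T\<close>, so that the thresholds of two
  neighbourhoods and of the separation of the limits can be replaced by their maximum.\<close>

lemma furstenberg_open:
  assumes U: "openin (furstenberg_topology X) U" and c: "\<And>i. c i \<in> rays (X i)"
    and in_U: "(\<lambda>i. endpoint (X i) (c i)) \<in> U"
  shows "\<exists>T>0. \<forall>S\<ge>T. \<forall>e. (\<forall>i. e i \<in> rays (X i) \<and> eventually (\<lambda>y. y \<in> X.N i (c i) S) (X.nb i (e i))) \<longrightarrow>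
    (\<lambda>i. endpoint (X i) (e i)) \<in> U"
proof -
  have "\<exists>V. finite {i \<in> UNIV. V i \<noteq> topspace (boundary_topology (X i))} \<and>
      (\<forall>i\<in>UNIV. openin (boundary_topology (X i)) (V i)) \<and>
      (\<lambda>i. endpoint (X i) (c i)) \<in> Pi\<^sub>E UNIV V \<and> Pi\<^sub>E UNIV V \<subseteq> U"
    using bspec [OF U [unfolded furstenberg_topology_def openin_product_topology_alt] in_U] .
  then obtain V where V: "\<forall>i. openin (boundary_topology (X i)) (V i)"
    "(\<lambda>i. endpoint (X i) (c i)) \<in> Pi\<^sub>E UNIV V" "Pi\<^sub>E UNIV V \<subseteq> U"
    unfolding ball_UNIV by (elim exE conjE)
  have "\<exists>T>0. \<forall>e\<in>rays (X i). eventually (\<lambda>y. y \<in> X.N i (c i) T) (X.nb i e) \<longrightarrow> endpoint (X i) e \<in> V i" for i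
    using V(1,2) by (intro X.boundary_open c) (auto simp: PiE_iff)
  then obtain t where t: "\<And>i. 0 < t i" "\<And>i e. e \<in> rays (X i) \<Longrightarrow>
      eventually (\<lambda>y. y \<in> X.N i (c i) (t i)) (X.nb i e) \<Longrightarrow> endpoint (X i) e \<in> V i"
    by metis
  have le: "t i \<le> Max (range t)" for i
    by simp
  show ?thesis
  proof (intro exI [of _ "Max (range t)"] conjI allI impI)
    show "0 < Max (range t)"
      using less_le_trans [OF t(1) le] .
    fix S e
    assume S: "Max (range t) \<le> S"
      and e: "\<forall>i. e i \<in> rays (X i) \<and> eventually (\<lambda>y. y \<in> X.N i (c i) S) (X.nb i (e i))"
    have "endpoint (X i) (e i) \<in> V i" for i
    proof (rule t(2))
      have "X.N i (c i) S \<subseteq> X.N i (c i) (t i)"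
        by (rule X.N_mono [OF X.rays_ray [OF c] t(1) order_trans [OF le S]])
      then show "eventually (\<lambda>y. y \<in> X.N i (c i) (t i)) (X.nb i (e i))"
        by (rule eventually_mono [OF conjunct2 [OF spec [OF e]] subsetD])
    qed (use e in blast)
    then show "(\<lambda>i. endpoint (X i) (e i)) \<in> U"
      using V(3) by (auto simp: PiE_iff)
  qed
qed

text \<open>Asymptotic rays have the same filter, and this cannot eventually lie in two disjoint
  sets.\<close>

lemma not_asym_of_separated:
  assumes e: "X.ray i e" "X.ray i e'" and c: "X.ray i c" "X.ray i c'" and S: "0 < S" "S \<le> T"
    and disj: "X.N i c S \<inter> X.N i c' S = {}"
    and ev: "eventually (\<lambda>y. y \<in> X.N i c T) (X.nb i e)" "eventually (\<lambda>y. y \<in> X.N i c' T) (X.nb i e')"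
  shows "\<not> X.asym i e e'"
proof
  assume "X.asym i e e'"
  then have nb: "X.nb i e = X.nb i e'"
    by (rule X.nb_cong [OF e])
  have "eventually (\<lambda>y. y \<in> X.N i c T \<inter> X.N i c' T) (X.nb i e')"
    unfolding Int_iff by (rule eventually_conj [OF ev(1) [unfolded nb] ev(2)])
  moreover have "X.N i c T \<inter> X.N i c' T = {}"
    using X.N_mono [OF c(1) S] X.N_mono [OF c(2) S] disj by blast
  ultimately show False
    using X.nb_nontrivial [OF e(2)] by simp
qed

text \<open>The repelling end of \<gamma> is the attracting end of its inverse, whose axis is the
  reversed one. The two ends differ in every factor because \<open>\<sigma> i t\<close> and
  \<open>\<sigma> i (- t)\<close> are \<open>2 * t\<close> apart.\<close>

lemma fixed_points_in_limit_set:
  assumes \<gamma>: "\<gamma> \<in> \<Gamma>" and reg: "regular_axial X \<gamma>"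
  shows "(attracting_tuple X \<gamma>, repelling_tuple X \<gamma>) \<in>
    furstenberg_limit_set X \<Gamma> x \<times> furstenberg_limit_set X \<Gamma> x - fat_diagonal X"
proof -
  obtain \<sigma> l where \<gamma>': "\<forall>i. geodesic_on UNIV (X i) (\<sigma> i) \<and> (\<forall>t. \<gamma> i (\<sigma> i t) = \<sigma> i (t + l i)) \<and>
    X.axis i (\<gamma> i) (\<sigma> i) (l i) \<and> \<not> X.half_plane i (\<sigma> i) \<and>
    attracting_fixpoint (X i) (\<gamma> i) = endpoint (X i) (\<sigma> i) \<and>
    repelling_fixpoint (X i) (\<gamma> i) = endpoint (X i) (\<lambda>t. \<sigma> i (- t))"
    using regular_axialD [OF reg] by blast
  then have \<sigma>: "geodesic_on UNIV (X i) (\<sigma> i)" "\<gamma> i (\<sigma> i t) = \<sigma> i (t + l i)" "0 < l i" for i t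
    unfolding hadamard_pseudometric.line_def X.axis_def by blast+
  have tuples: "attracting_tuple X \<gamma> = (\<lambda>i. endpoint (X i) (\<sigma> i))"
    "repelling_tuple X \<gamma> = (\<lambda>i. endpoint (X i) (\<lambda>t. \<sigma> i (- t)))"
    using \<gamma>' by (auto simp: attracting_tuple_def repelling_tuple_def)
  have \<sigma>M: "\<sigma> i t \<in> mspace (X i)" for i t
    using \<sigma>(1) by (auto simp: geodesic_on_def)
  note inv = \<Gamma>_inv [OF \<gamma>]
  have "(inv\<^bsub>PG\<^esub> \<gamma>) i (\<sigma> i (- t)) = \<sigma> i (- (t + l i))" for i t
  proof -
    have \<gamma>c: "\<gamma> i \<in> carrier (isometry_group (X i))"
      using \<Gamma>_isometry [OF \<gamma>] by simp
    have "\<gamma> i (\<sigma> i (- (t + l i))) = \<sigma> i (- t)"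
      unfolding \<sigma>(2) by simp
    then have "mact (X i) ((inv\<^bsub>PG\<^esub> \<gamma>) i) (mact (X i) (\<gamma> i) (\<sigma> i (- (t + l i)))) = (inv\<^bsub>PG\<^esub> \<gamma>) i (\<sigma> i (- t))"
      using \<sigma>M by (simp add: mact_def del: inv_product_group)
    then have "pd (X i) ((inv\<^bsub>PG\<^esub> \<gamma>) i (\<sigma> i (- t))) (\<sigma> i (- (t + l i))) = 0"
      using X.inv_left [OF \<gamma>c, of "\<sigma> i (- (t + l i))"] unfolding inv(2) by simp
    then show ?thesis
      by (rule X.pd_eq_0 [OF isometry_in [OF \<Gamma>_isometry [OF inv(1)] \<sigma>M] \<sigma>M])
  qed
  then have "repelling_tuple X \<gamma> \<in> furstenberg_limit_set X \<Gamma> x"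
    unfolding tuples by (intro attracting_in_limit_set [OF inv(1) geodesic_line_reverse [OF \<sigma>(1)] \<sigma>(3)])
  moreover have "attracting_tuple X \<gamma> \<in> furstenberg_limit_set X \<Gamma> x"
    unfolding tuples by (rule attracting_in_limit_set [OF \<gamma> \<sigma>(1,3,2)])
  moreover have "endpoint (X i) (\<sigma> i) \<noteq> endpoint (X i) (\<lambda>t. \<sigma> i (- t))" for i
  proof
    assume "endpoint (X i) (\<sigma> i) = endpoint (X i) (\<lambda>t. \<sigma> i (- t))"
    then have "X.asym i (\<sigma> i) (\<lambda>t. \<sigma> i (- t))"
      using X.endpoint_eq_iff [OF geodesic_line_ray geodesic_line_ray] \<sigma>(1) geodesic_line_reverse by blast
    then obtain K where K: "\<And>t. t \<ge> 0 \<Longrightarrow> pd (X i) (\<sigma> i t) (\<sigma> i (- t)) \<le> K"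
      unfolding hadamard_pseudometric.asym_def [OF X.pseudo] by blast
    define t where "t = \<bar>K\<bar> + 1"
    have "pd (X i) (\<sigma> i t) (\<sigma> i (- t)) = \<bar>2 * t\<bar>"
      using \<sigma>(1) [of i] \<sigma>M by (simp add: pd_mdist geodesic_on_def)
    then show False
      using K [of t] by (simp add: t_def)
  qed
  ultimately show ?thesis
    unfolding fat_diagonal_def tuples by (auto simp: fun_eq_iff)
qed

lemma limit_set_approximation:
  assumes ind: "\<exists>g\<in>\<Gamma>. \<exists>h\<in>\<Gamma>. independent_regular_axial X g h"
    and \<xi>: "\<xi> \<in> furstenberg_limit_set X \<Gamma> x" and \<eta>: "\<eta> \<in> furstenberg_limit_set X \<Gamma> x"
    and ne: "(\<xi>, \<eta>) \<notin> fat_diagonal X"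
    and U: "openin (furstenberg_topology X) U" "\<xi> \<in> U"
    and V: "openin (furstenberg_topology X) V" "\<eta> \<in> V"
  shows "\<exists>\<gamma>\<in>\<Gamma>. regular_axial X \<gamma> \<and> attracting_tuple X \<gamma> \<in> U \<and> repelling_tuple X \<gamma> \<in> V"
proof -
  let ?G = "\<lambda>i. isometry_group (X i)"
  obtain g h where gh: "g \<in> \<Gamma>" "h \<in> \<Gamma>" "independent_regular_axial X g h"
    using ind by blast
  have bd: "\<xi> i \<in> gboundary (X i)" "\<eta> i \<in> gboundary (X i)" for i
    using limit_sequence [OF \<xi>] limit_sequence [OF \<eta>] X.endpoint_in by metis+
  have "\<exists>c. c \<in> rays (X i) \<and> c 0 = x i \<and> \<xi> i = endpoint (X i) c" for i
    by (rule X.gboundary_ray_from [OF bd(1) xi]) blast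
  then obtain c where c: "\<And>i. c i \<in> rays (X i)" "\<And>i. c i 0 = x i" "\<And>i. \<xi> i = endpoint (X i) (c i)"
    by metis
  have "\<exists>c. c \<in> rays (X i) \<and> c 0 = x i \<and> \<eta> i = endpoint (X i) c" for i
    by (rule X.gboundary_ray_from [OF bd(2) xi]) blast
  then obtain c' where c': "\<And>i. c' i \<in> rays (X i)" "\<And>i. c' i 0 = x i" "\<And>i. \<eta> i = endpoint (X i) (c' i)"
    by metis
  have cr: "X.ray i (c i)" and cr': "X.ray i (c' i)" for i
    using c(1) c'(1) X.rays_ray by blast+
  have "\<xi> i \<noteq> \<eta> i" for i
    using ne bd unfolding fat_diagonal_def furstenberg_boundary_def by auto
  then have na: "\<not> X.asym i (c i) (c' i)" for i
    using X.endpoint_eq_iff [OF c(1) c'(1), of i] unfolding c(3) c'(3) by simp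
  have "\<exists>s>0. X.N i (c i) s \<inter> X.N i (c' i) s = {}" for i
    by (rule X.N_disjoint [OF cr cr' _ na]) (use c(2) c'(2) in auto)
  then obtain s where s: "\<And>i. 0 < s i" "\<And>i. X.N i (c i) (s i) \<inter> X.N i (c' i) (s i) = {}"
    by metis
  have eq: "\<xi> = (\<lambda>i. endpoint (X i) (c i))" "\<eta> = (\<lambda>i. endpoint (X i) (c' i))"
    using c(3) c'(3) by auto
  obtain T1 where T1: "T1 > 0" "\<And>S e. S \<ge> T1 \<Longrightarrow>
      (\<forall>i. e i \<in> rays (X i) \<and> eventually (\<lambda>y. y \<in> X.N i (c i) S) (X.nb i (e i))) \<Longrightarrow>
      (\<lambda>i. endpoint (X i) (e i)) \<in> U"
    using furstenberg_open [OF U(1) c(1)] U(2) unfolding eq by blast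
  obtain T2 where T2: "T2 > 0" "\<And>S e. S \<ge> T2 \<Longrightarrow>
      (\<forall>i. e i \<in> rays (X i) \<and> eventually (\<lambda>y. y \<in> X.N i (c' i) S) (X.nb i (e i))) \<Longrightarrow>
      (\<lambda>i. endpoint (X i) (e i)) \<in> V"
    using furstenberg_open [OF V(1) c'(1)] V(2) unfolding eq by blast
  \<comment> \<open>Large enough for both neighbourhoods and for separating the limits in every
    factor; hence the attracting ends of \<open>a\<close> and \<open>b\<close> differ, and so do the
    repelling ones.\<close>
  define T where "T = max (Max (range s)) (max T1 T2)"
  have T: "T1 \<le> T" "T2 \<le> T" "0 < T"
    using T1(1) by (auto simp: T_def)
  have sT: "s i \<le> T" for i
    unfolding T_def by (rule order_trans [OF _ max.cobounded1]) simp
  obtain a \<sigma> l where a: "a \<in> \<Gamma>" and \<sigma>': "\<forall>i. X.axis i (a i) (\<sigma> i) (l i) \<and> \<not> X.half_plane i (\<sigma> i) \<and>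
    eventually (\<lambda>y. y \<in> X.N i (c i) T) (X.nb i (\<sigma> i)) \<and>
    eventually (\<lambda>y. y \<in> X.N i (c i) T) (X.nb i (\<lambda>t. \<sigma> i (- t)))"
    using approximating_axes [OF gh \<xi> c(1,3) T(3)] by (elim bexE exE)
  obtain b \<tau> m where b: "b \<in> \<Gamma>" and \<tau>': "\<forall>i. X.axis i (b i) (\<tau> i) (m i) \<and> \<not> X.half_plane i (\<tau> i) \<and>
    eventually (\<lambda>y. y \<in> X.N i (c' i) T) (X.nb i (\<tau> i)) \<and>
    eventually (\<lambda>y. y \<in> X.N i (c' i) T) (X.nb i (\<lambda>t. \<tau> i (- t)))"
    using approximating_axes [OF gh \<eta> c'(1,3) T(3)] by (elim bexE exE)
  have \<sigma>: "X.axis i (a i) (\<sigma> i) (l i)" "\<not> X.half_plane i (\<sigma> i)"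
    "eventually (\<lambda>y. y \<in> X.N i (c i) T) (X.nb i (\<sigma> i))"
    "eventually (\<lambda>y. y \<in> X.N i (c i) T) (X.nb i (\<lambda>t. \<sigma> i (- t)))" for i
    using \<sigma>' by simp_all
  have \<tau>: "X.axis i (b i) (\<tau> i) (m i)" "\<not> X.half_plane i (\<tau> i)"
    "eventually (\<lambda>y. y \<in> X.N i (c' i) T) (X.nb i (\<tau> i))"
    "eventually (\<lambda>y. y \<in> X.N i (c' i) T) (X.nb i (\<lambda>t. \<tau> i (- t)))" for i
    using \<tau>' by simp_all
  have r: "X.ray i (\<sigma> i)" "X.ray i (\<lambda>t. \<sigma> i (- t))" "X.ray i (\<tau> i)" "X.ray i (\<lambda>t. \<tau> i (- t))" for i
    using \<sigma>(1) [of i] \<tau>(1) [of i] X.line_ray X.line_reverse unfolding X.axis_def by blast+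
  have indep: "\<not> X.asym i (\<sigma> i) (\<tau> i)" "\<not> X.asym i (\<lambda>t. \<sigma> i (- t)) (\<lambda>t. \<tau> i (- t))" for i
    by (rule not_asym_of_separated [OF r(1,3) cr cr' s(1) sT s(2) \<sigma>(3) \<tau>(3)]
        not_asym_of_separated [OF r(2,4) cr cr' s(1) sT s(2) \<sigma>(4) \<tau>(4)])+
  have ac: "a i \<in> carrier (?G i)" and bc: "b i \<in> carrier (?G i)" for i
    using \<Gamma>_isometry a b by simp_all
  define good where "good n i \<longleftrightarrow> (\<exists>\<rho> k.
      X.axis i (a i [^]\<^bsub>?G i\<^esub> n \<otimes>\<^bsub>?G i\<^esub> inv\<^bsub>?G i\<^esub> (b i [^]\<^bsub>?G i\<^esub> n)) \<rho> k \<and> \<not> X.half_plane i \<rho> \<and>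
      eventually (\<lambda>y. y \<in> X.N i (c i) T) (X.nb i \<rho>) \<and>
      eventually (\<lambda>y. y \<in> X.N i (c' i) T) (X.nb i (\<lambda>t. \<rho> (- t))))" for n :: nat and i
  \<comment> \<open>Ping-pong succeeds in each factor for all large exponents, so some exponent
    serves all factors.\<close>
  have "eventually (\<lambda>n. good n i) sequentially" for i
    unfolding good_def by (rule X.pingpong [OF ac \<sigma>(1,2) bc \<tau>(1,2) indep \<sigma>(3) \<tau>(3)])
  then have "eventually (\<lambda>n. \<forall>i. good n i) sequentially"
    by (intro eventually_all_finite)
  then obtain n where n: "\<And>i. good n i"
    using eventually_happens' [OF sequentially_bot] by blast
  define \<gamma> where "\<gamma> = a [^]\<^bsub>PG\<^esub> n \<otimes>\<^bsub>PG\<^esub> inv\<^bsub>PG\<^esub> (b [^]\<^bsub>PG\<^esub> n)"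
  have \<gamma>: "\<gamma> \<in> \<Gamma>" "\<gamma> i = a i [^]\<^bsub>?G i\<^esub> n \<otimes>\<^bsub>?G i\<^esub> inv\<^bsub>?G i\<^esub> (b i [^]\<^bsub>?G i\<^esub> n)" for i
    using \<Gamma>_mult \<Gamma>_inv \<Gamma>_pow [OF a] \<Gamma>_pow [OF b] unfolding \<gamma>_def by (simp_all del: mult_product_group)
  obtain \<rho> k where \<rho>: "\<And>i. X.axis i (\<gamma> i) (\<rho> i) (k i)" "\<And>i. \<not> X.half_plane i (\<rho> i)"
      "\<And>i. eventually (\<lambda>y. y \<in> X.N i (c i) T) (X.nb i (\<rho> i))"
      "\<And>i. eventually (\<lambda>y. y \<in> X.N i (c' i) T) (X.nb i (\<lambda>t. \<rho> i (- t)))"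
    using n unfolding good_def \<gamma>(2) [symmetric] by metis
  have \<rho>r: "X.ray i (\<rho> i)" "X.ray i (\<lambda>t. \<rho> i (- t))" for i
    using \<rho>(1) [of i] X.line_ray X.line_reverse unfolding X.axis_def by blast+
  note ro = X.rank_oneI [OF \<Gamma>_isometry [OF \<gamma>(1)] \<rho>(1,2)]
  have retr: "(\<lambda>t. retr (X i) (\<rho> i t)) \<in> rays (X i)" "(\<lambda>t. retr (X i) (\<rho> i (- t))) \<in> rays (X i)" for i
    using X.ray_retr \<rho>r by blast+
  have nb: "X.nb i (\<lambda>t. retr (X i) (\<rho> i t)) = X.nb i (\<rho> i)"
    "X.nb i (\<lambda>t. retr (X i) (\<rho> i (- t))) = X.nb i (\<lambda>t. \<rho> i (- t))" for i
    by (rule X.nb_cong [OF \<rho>r(1) X.rays_ray [OF retr(1)] X.asym_retr, symmetric]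
        X.nb_cong [OF \<rho>r(2) X.rays_ray [OF retr(2)] X.asym_retr, symmetric])+
  have "regular_axial X \<gamma>"
    unfolding regular_axial_def using ro(1) by blast
  moreover have "attracting_tuple X \<gamma> \<in> U"
    unfolding attracting_tuple_def ro(2)
    by (rule T1(2) [OF T(1)]) (use retr(1) \<rho>(3) in \<open>simp add: nb\<close>)
  moreover have "repelling_tuple X \<gamma> \<in> V"
    unfolding repelling_tuple_def ro(3)
    by (rule T2(2) [OF T(2)]) (use retr(2) \<rho>(4) in \<open>simp add: nb\<close>)
  ultimately show ?thesis
    using \<gamma>(1) by blast
qed

lemma furstenberg_limit_set_subset: "furstenberg_limit_set X \<Gamma> x \<subseteq> topspace (furstenberg_topology X)"
proof
  fix \<xi> assume "\<xi> \<in> furstenberg_limit_set X \<Gamma> x"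
  then have "\<xi> i \<in> gboundary (X i)" for i
    using limit_sequence X.endpoint_in by metis
  then show "\<xi> \<in> topspace (furstenberg_topology X)"
    by (simp add: topspace_furstenberg_topology furstenberg_boundary_def PiE_iff)
qed

end

section \<open>Density of the pairs of fixed points\<close>

theorem theoremC:
  fixes X :: "'n::finite \<Rightarrow> 'a metric"
    and \<Gamma> :: "('n \<Rightarrow> 'a \<Rightarrow> 'a) set"
    and x :: "'n \<Rightarrow> 'a"
  assumes "\<And>i. hadamard_space (X i)"
    and "\<And>i. locally_compact_space (mtopology_of (X i))"
    and "subgroup \<Gamma> (product_group UNIV (\<lambda>i. isometry_group (X i)))"
    and "acts_properly_discontinuously X \<Gamma>"
    and "\<exists>g\<in>\<Gamma>. \<exists>h\<in>\<Gamma>. independent_regular_axial X g h"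
    and "x \<in> mspace (product_metric X)"
  shows "dense_in (prod_topology (furstenberg_topology X) (furstenberg_topology X))
           {(attracting_tuple X \<gamma>, repelling_tuple X \<gamma>) | \<gamma>. \<gamma> \<in> \<Gamma> \<and> regular_axial X \<gamma>}
           (furstenberg_limit_set X \<Gamma> x \<times> furstenberg_limit_set X \<Gamma> x - fat_diagonal X)"
proof -
  interpret hadamard_product X \<Gamma> x
    by (rule hadamard_product.intro [OF assms(1-3,6)])
  let ?F = "furstenberg_limit_set X \<Gamma> x" and ?T = "furstenberg_topology X"
  let ?A = "{(attracting_tuple X \<gamma>, repelling_tuple X \<gamma>) | \<gamma>. \<gamma> \<in> \<Gamma> \<and> regular_axial X \<gamma>}"
  have "p \<in> prod_topology ?T ?T closure_of ?A" if p: "p \<in> ?F \<times> ?F - fat_diagonal X" for p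
    unfolding in_closure_of
  proof (intro conjI allI impI)
    obtain \<xi> \<eta> where p': "p = (\<xi>, \<eta>)" "\<xi> \<in> ?F" "\<eta> \<in> ?F" "(\<xi>, \<eta>) \<notin> fat_diagonal X"
      using p by blast
    show "p \<in> topspace (prod_topology ?T ?T)"
      using p' furstenberg_limit_set_subset by auto
    fix W assume W: "p \<in> W \<and> openin (prod_topology ?T ?T) W"
    then obtain U V where UV: "openin ?T U" "openin ?T V" "\<xi> \<in> U" "\<eta> \<in> V" "U \<times> V \<subseteq> W"
      unfolding openin_prod_topology_alt p'(1) by meson
    obtain \<gamma> where "\<gamma> \<in> \<Gamma>" "regular_axial X \<gamma>" "attracting_tuple X \<gamma> \<in> U" "repelling_tuple X \<gamma> \<in> V"
      using limit_set_approximation [OF assms(5) p'(2-4) UV(1,3,2,4)] by blast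
    then show "\<exists>y. y \<in> ?A \<and> y \<in> W"
      using UV(5) by blast
  qed
  then show ?thesis
    unfolding dense_in_def using fixed_points_in_limit_set by blast
qed

end
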